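(* Suppose that (a) $\mathcal{M}$ is a compact Riemannian submanifold of $\mathbb{R}^n$, the retraction $R$ is globally defined (its domain is the whole tangent bundle), and $f:\mathbb{R}^n\to\mathbb{R}$ has Lipschitz continuous gradient with constant $L$ in the convex hull of $\mathcal{M}$, i.e. $\|\nabla f(x)-\nabla f(y)\|\le L\|x-y\|$ for all $x,y$ in the convex hull of $\mathcal{M}$. Let $\{\hat x_k\}$ denote the sequence generated by Algorithm RPN-G (defined in the context) with $\epsilon=0$, and let $x_*$ denote an accumulation point of $\{\hat x_k\}$. Then $x_*$ is a stationary point of $F$ on $\mathcal{M}$. Further, suppose that (b) $x_*$ is a strict local optimal point and isolated stationary point of $F=f+\mu\|\cdot\|_1$ on $\mathcal{M}$, i.e. there exists a neighborhood $\mathcal{N}_{x_*}$ of $x_*$ on $\mathcal{M}$ such that $F(y)>F(x_* )$ for all $y\in\mathcal{N}_{x_*}$ with $y\ne x_*$, and $x_*$ is the only stationary point in $\mathcal{N}_{x_*}$; (c) Assumption A and Assumption B (stated in the context) hold at $x_*$, and $J(x_* )$ (defined in the context) is nonsingular. Then there exists $\epsilon>0$ such that the iterates $\{x_k\}$ generated by Algorithm RPN-G with this $\epsilon$ converge to the local optimal point $x_*$, and the local convergence rate is quadratic.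
   Context: Setting. $\mathcal{M}$ is an $(n-d)$-dimensional embedded submanifold of the Euclidean space $\mathbb{R}^n$, with the Riemannian metric inherited from $\mathbb{R}^n$; $f:\mathbb{R}^n\to\mathbb{R}$ is sufficiently smooth (as often continuously differentiable as needed, at least twice), with Euclidean gradient $\nabla f$ and Hessian $\nabla^2 f$; $\mu>0$, $h(x)=\mu\|x\|_1$, $F=f+h$, and $t>0$ is fixed. The problem is $\min_{x\in\mathcal{M}}F(x)$. $\mathrm{T}_x\mathcal{M}$ is the tangent space and $\mathrm{N}_x\mathcal{M}$ its orthogonal complement (normal space). $B_x\in\mathbb{R}^{n\times d}$ is a matrix whose columns form an orthonormal basis of $\mathrm{N}_x\mathcal{M}$, chosen so that $x\mapsto B_x$ is locally smooth. $R$ is a retraction on $\mathcal{M}$: a smooth map from the tangent bundle to $\mathcal{M}$, with restriction $R_x$ to $\mathrm{T}_x\mathcal{M}$, such that $R_x(0_x)=x$ and $\mathrm{D}R_x(0_x)$ is the identity. Proximal direction. For $x\in\mathcal{M}$, $v(x)=\operatorname{argmin}_{v\in \mathrm{T}_x\mathcal{M}} f(x)+\nabla f(x)^{\mathrm T}v+\frac{1}{2t}\|v\|^2+h(x+v)$, and $\lambda(x)\in\mathbb{R}^d$ is the corresponding Lagrange multiplier, i.e. $v(x)=\mathrm{prox}_{th}\big(x-t[\nabla f(x)+B_x\lambda(x)]\big)-x$ and $B_x^{\mathrm T}v(x)=0$, where $\mathrm{prox}_{th}(z)=\max(|z|-t\mu,0)\odot\mathrm{sign}(z)$ entrywise. A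 point $x\in\mathcal{M}$ is a stationary point of $F$ if $v(x)=0$. $M_x$ is the diagonal $n\times n$ matrix with $(M_x)_{ii}=0$ if $\big|x-t[\nabla f(x)+B_x\lambda(x)]\big|_i\le t\mu$ and $(M_x)_{ii}=1$ otherwise. Operator $J$. Let $H_x=(B_x^{\mathrm T}M_xB_x)^{-1}$ and $\Lambda_x=M_x-M_xB_xH_xB_x^{\mathrm T}M_x$. The Weingarten map is $\mathcal{W}_x:\mathrm{T}_x\mathcal{M}\times \mathrm{N}_x\mathcal{M}\to \mathrm{T}_x\mathcal{M}$, $\mathcal{W}_x(w,u)=\mathrm{D}(x\mapsto \mathrm{Proj}_x)(x)[w]\cdot u$, with $\mathrm{Proj}_x$ the orthogonal projector onto $\mathrm{T}_x\mathcal{M}$. Let $\mathcal{L}_x(\cdot)=\mathcal{W}_x(\cdot,B_x\lambda(x))$ and $$J(x)=-\big[I_n-\Lambda_x+t\Lambda_x(\nabla^2 f(x)-\mathcal{L}_x)\big],$$ regarded as a linear operator $\mathrm{T}_x\mathcal{M}\to\mathrm{T}_x\mathcal{M}$. Algorithm RPN-G. Input: $x_0\in\mathcal{M}$, $t>0$, $\rho\in(0,\frac12]$, and the switching parameter $\epsilon$ ($\epsilon>0$, or $\epsilon=0$ where so stated). The same $x_0,t,\rho$ are used for both values of $\epsilon$ in the claim. Phase 1: starting from $k=0$, loop: compute $v_k=v(x_k)$; if $\|v_k\|\le\epsilon$, set $K=k$ and leave the loop; otherwise set $\alpha=1$, and while $F(R_{x_k}(\alpha v_k))>F(x_k)-\frac12\alpha\|v_k\|^2$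 replace $\alpha$ by $\rho\alpha$; then set $x_{k+1}=R_{x_k}(\alpha v_k)$ and increase $k$ by $1$. Phase 2: for $k=K,K+1,\dots$: compute $v_k=v(x_k)$; compute $u_k\in \mathrm{T}_{x_k}\mathcal{M}$ solving $J(x_k)[u_k]=-v_k$; set $x_{k+1}=R_{x_k}(u_k)$. Convention. Coordinates are ordered (without loss of generality) so that $x_*=[\bar x_*^{\mathrm T},0^{\mathrm T}]^{\mathrm T}$ with $\bar x_*\in\mathbb{R}^j$ having all entries nonzero; then $M_{x_*}=\mathrm{diag}(I_j,0_{n-j})$. Assumption A. Writing $B_{x_*}^{\mathrm T}=[\bar B_{x_*}^{\mathrm T},\hat B_{x_*}^{\mathrm T}]$ with $\bar B_{x_*}\in\mathbb{R}^{j\times d}$, $\hat B_{x_*}\in\mathbb{R}^{(n-j)\times d}$, one has $j\ge d$ and $\bar B_{x_*}$ has full column rank. Assumption B. There is a neighborhood $\mathcal{U}$ of $x_*$ on $\mathcal{M}$ such that for every $x=[\bar x^{\mathrm T},\hat x^{\mathrm T}]^{\mathrm T}\in\mathcal{U}$ (with $\bar x\in\mathbb{R}^j$), writing $v(x)=[\bar v^{\mathrm T},\hat v^{\mathrm T}]^{\mathrm T}$, all entries of $\bar x+\bar v$ are nonzero and $\hat x+\hat v=0$. Quadratic local convergence rate means $x_k\to x_*$ and, for all large $k$, $\|x_{k+1}-x_*\|\le C\|x_k-x_*\|^2$ for some constant $C$.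
   Formalization: Stationarity of accumulation points is claimed only for t<2 (it fails for t≥2 with the printed line-search test); a Phase 2 step is taken to require J(x_k) nonsingular, so that J(x_k)[u_k]=-v_k determines u_k. *)

theory Defs
  imports "HOL-Analysis.Analysis"
begin

section \<open>Smooth maps\<close>

text \<open>
  \<open>C_diff_on k S f\<close>: \<open>f\<close> is \<open>k\<close> times continuously differentiable on the open set \<open>S\<close>,
  expressed through iterated directional derivatives so that the codomain does not change.
\<close>

primrec C_diff_on ::
  "nat \<Rightarrow> 'a::euclidean_space set \<Rightarrow> ('a \<Rightarrow> 'b::real_normed_vector) \<Rightarrow> bool"
where
  "C_diff_on 0 S f \<longleftrightarrow> continuous_on S f"
| "C_diff_on (Suc k) S f \<longleftrightarrow>
     (\<forall>x\<in>S. f differentiable (at x)) \<and>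
     (\<forall>w. C_diff_on k S (\<lambda>x. frechet_derivative f (at x) w))"

definition smooth_on_open ::
  "'a::euclidean_space set \<Rightarrow> ('a \<Rightarrow> 'b::real_normed_vector) \<Rightarrow> bool"
where
  "smooth_on_open S f \<longleftrightarrow> open S \<and> (\<forall>k. C_diff_on k S f)"

text \<open>
  Smoothness on a subset of a Euclidean space that need not be open (a submanifold, its tangent
  bundle): locally, the map is the restriction of a smooth map on an open set of the ambient space.
\<close>

definition smooth_map_on ::
  "'a::euclidean_space set \<Rightarrow> ('a \<Rightarrow> 'b::real_normed_vector) \<Rightarrow> bool"
where
  "smooth_map_on A f \<longleftrightarrow>
     (\<forall>p\<in>A. \<exists>W g. p \<in> W \<and> smooth_on_open W g \<and> (\<forall>q\<in>W \<inter> A. g q = f q))"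


section \<open>Embedded submanifolds of \<open>real^'n\<close>\<close>

text \<open>
  The codimension \<open>d\<close> is \<open>CARD('d)\<close>: near each of its points, \<open>\<M>\<close> is the zero set of a smooth
  submersion into \<open>real^'d\<close>.
\<close>

definition embedded_submanifold :: "'d::finite itself \<Rightarrow> (real^'n) set \<Rightarrow> bool"
where
  "embedded_submanifold (_ :: 'd itself) \<M> \<longleftrightarrow>
     (\<forall>x\<in>\<M>. \<exists>U (c :: real^'n \<Rightarrow> real^'d).
        x \<in> U \<and> smooth_on_open U c \<and> \<M> \<inter> U = {y\<in>U. c y = 0} \<and>
        (\<forall>y\<in>\<M> \<inter> U. surj (frechet_derivative c (at y))))"

text \<open>
  Velocities at \<open>x\<close> of the curves in \<open>\<M>\<close> through \<open>x\<close>. On an embedded submanifold it makes no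
  difference whether the curves are differentiable at \<open>0\<close> only, or smooth.
\<close>

definition tangent_space :: "(real^'n) set \<Rightarrow> real^'n \<Rightarrow> (real^'n) set"
where
  "tangent_space \<M> x =
     {w. \<exists>\<gamma> e. 0 < e \<and> (\<forall>s\<in>{-e<..<e}. \<gamma> s \<in> \<M>) \<and> \<gamma> 0 = x \<and>
           (\<gamma> has_vector_derivative w) (at (0::real))}"

definition normal_space :: "(real^'n) set \<Rightarrow> real^'n \<Rightarrow> (real^'n) set"
where
  "normal_space \<M> x = orthogonal_comp (tangent_space \<M> x)"

definition tangent_bundle :: "(real^'n) set \<Rightarrow> ((real^'n) \<times> (real^'n)) set"
where
  "tangent_bundle \<M> = {(x, w). x \<in> \<M> \<and> w \<in> tangent_space \<M> x}"

definition Proj :: "(real^'n) set \<Rightarrow> real^'n \<Rightarrow> real^'n^'n"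
where
  "Proj \<M> x = matrix (\<lambda>z. THE p. p \<in> tangent_space \<M> x \<and> z - p \<in> normal_space \<M> x)"

text \<open>
  \<open>Proj \<M>\<close> is only meaningful on \<open>\<M>\<close>, so it is differentiated within \<open>\<M>\<close>. Such a derivative
  is determined on tangent vectors, and it is only applied to those.
\<close>

definition Weingarten :: "(real^'n) set \<Rightarrow> real^'n \<Rightarrow> real^'n \<Rightarrow> real^'n \<Rightarrow> real^'n"
where
  "Weingarten \<M> x w u = frechet_derivative (Proj \<M>) (at x within \<M>) w *v u"

text \<open>A retraction whose domain is the whole tangent bundle.\<close>

definition global_retraction :: "(real^'n) set \<Rightarrow> (real^'n \<Rightarrow> real^'n \<Rightarrow> real^'n) \<Rightarrow> bool"
where
  "global_retraction \<M> R \<longleftrightarrow>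
     (\<forall>(x, w)\<in>tangent_bundle \<M>. R x w \<in> \<M>) \<and>
     smooth_map_on (tangent_bundle \<M>) (\<lambda>(x, w). R x w) \<and>
     (\<forall>x\<in>\<M>. R x 0 = x \<and> (R x has_derivative (\<lambda>w. w)) (at 0 within tangent_space \<M> x))"

definition orthonormal_normal_frame ::
  "(real^'n) set \<Rightarrow> real^'n \<Rightarrow> real^'d^'n \<Rightarrow> bool"
where
  "orthonormal_normal_frame \<M> x b \<longleftrightarrow>
     transpose b ** b = mat 1 \<and> span (columns b) = normal_space \<M> x"


section \<open>The composite problem and the proximal direction\<close>

definition grad :: "(real^'n \<Rightarrow> real) \<Rightarrow> real^'n \<Rightarrow> real^'n"
where
  "grad f x = (\<chi> i. frechet_derivative f (at x) (axis i 1))"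

definition hessian :: "(real^'n \<Rightarrow> real) \<Rightarrow> real^'n \<Rightarrow> real^'n^'n"
where
  "hessian f x = jacobian (grad f) (at x)"

definition l1_norm :: "real^'n \<Rightarrow> real"
where
  "l1_norm x = (\<Sum>i\<in>UNIV. \<bar>x $ i\<bar>)"

definition F_obj :: "(real^'n \<Rightarrow> real) \<Rightarrow> real \<Rightarrow> real^'n \<Rightarrow> real"
where
  "F_obj f \<mu> x = f x + \<mu> * l1_norm x"

definition prox_dir ::
  "(real^'n) set \<Rightarrow> (real^'n \<Rightarrow> real) \<Rightarrow> real \<Rightarrow> real \<Rightarrow> real^'n \<Rightarrow> real^'n"
where
  "prox_dir \<M> f \<mu> t x =
     arg_min (\<lambda>v. f x + grad f x \<bullet> v + 1 / (2 * t) * (norm v)\<^sup>2 + \<mu> * l1_norm (x + v))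
       (\<lambda>v. v \<in> tangent_space \<M> x)"

definition prox_l1 :: "real \<Rightarrow> real \<Rightarrow> real^'n \<Rightarrow> real^'n"
where
  "prox_l1 t \<mu> z = (\<chi> i. max (\<bar>z $ i\<bar> - t * \<mu>) 0 * sgn (z $ i))"

definition prox_arg ::
  "(real^'n \<Rightarrow> real) \<Rightarrow> real \<Rightarrow> real^'d^'n \<Rightarrow> real^'d \<Rightarrow> real^'n \<Rightarrow> real^'n"
where
  "prox_arg f t b l x = x - t *\<^sub>R (grad f x + b *v l)"

definition is_multiplier ::
  "(real^'n) set \<Rightarrow> (real^'n \<Rightarrow> real) \<Rightarrow> real \<Rightarrow> real \<Rightarrow> real^'d^'n \<Rightarrow> real^'n \<Rightarrow> real^'d \<Rightarrow> bool"
where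
  "is_multiplier \<M> f \<mu> t b x l \<longleftrightarrow>
     prox_dir \<M> f \<mu> t x = prox_l1 t \<mu> (prox_arg f t b l x) - x \<and>
     transpose b *v prox_dir \<M> f \<mu> t x = 0"

definition stationary ::
  "(real^'n) set \<Rightarrow> (real^'n \<Rightarrow> real) \<Rightarrow> real \<Rightarrow> real \<Rightarrow> real^'n \<Rightarrow> bool"
where
  "stationary \<M> f \<mu> t x \<longleftrightarrow> x \<in> \<M> \<and> prox_dir \<M> f \<mu> t x = 0"


section \<open>The operator \<open>J\<close>\<close>

text \<open>In this section \<open>b\<close> stands for \<open>B x\<close> and \<open>l\<close> for the multiplier at \<open>x\<close>.\<close>

definition M_mat ::
  "(real^'n \<Rightarrow> real) \<Rightarrow> real \<Rightarrow> real \<Rightarrow> real^'d^'n \<Rightarrow> real^'d \<Rightarrow> real^'n \<Rightarrow> real^'n^'n"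
where
  "M_mat f \<mu> t b l x =
     (\<chi> i k. if i = k \<and> \<not> \<bar>prox_arg f t b l x $ i\<bar> \<le> t * \<mu> then 1 else 0)"

definition BMB ::
  "(real^'n \<Rightarrow> real) \<Rightarrow> real \<Rightarrow> real \<Rightarrow> real^'d^'n \<Rightarrow> real^'d \<Rightarrow> real^'n \<Rightarrow> real^'d^'d"
where
  "BMB f \<mu> t b l x = transpose b ** M_mat f \<mu> t b l x ** b"

definition Lambda_mat ::
  "(real^'n \<Rightarrow> real) \<Rightarrow> real \<Rightarrow> real \<Rightarrow> real^'d^'n \<Rightarrow> real^'d \<Rightarrow> real^'n \<Rightarrow> real^'n^'n"
where
  "Lambda_mat f \<mu> t b l x =
     (let m = M_mat f \<mu> t b l x; H = matrix_inv (BMB f \<mu> t b l x)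
      in m - m ** b ** H ** transpose b ** m)"

definition J_op ::
  "(real^'n) set \<Rightarrow> (real^'n \<Rightarrow> real) \<Rightarrow> real \<Rightarrow> real \<Rightarrow> real^'d^'n \<Rightarrow> real^'d \<Rightarrow>
     real^'n \<Rightarrow> real^'n \<Rightarrow> real^'n"
where
  "J_op \<M> f \<mu> t b l x w =
     (let \<Lambda> = Lambda_mat f \<mu> t b l x
      in - (w - \<Lambda> *v w + t *\<^sub>R (\<Lambda> *v (hessian f x *v w - Weingarten \<M> x w (b *v l)))))"

definition J_nonsingular ::
  "(real^'n) set \<Rightarrow> (real^'n \<Rightarrow> real) \<Rightarrow> real \<Rightarrow> real \<Rightarrow> real^'d^'n \<Rightarrow> real^'d \<Rightarrow>
     real^'n \<Rightarrow> bool"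
where
  "J_nonsingular \<M> f \<mu> t b l x \<longleftrightarrow>
     invertible (BMB f \<mu> t b l x) \<and>
     bij_betw (J_op \<M> f \<mu> t b l x) (tangent_space \<M> x) (tangent_space \<M> x)"


section \<open>Algorithm RPN-G\<close>

definition sufficient_decrease ::
  "(real^'n) set \<Rightarrow> (real^'n \<Rightarrow> real^'n \<Rightarrow> real^'n) \<Rightarrow> (real^'n \<Rightarrow> real) \<Rightarrow> real \<Rightarrow> real \<Rightarrow>
     real^'n \<Rightarrow> real \<Rightarrow> bool"
where
  "sufficient_decrease \<M> R f \<mu> t x \<alpha> \<longleftrightarrow>
     (let v = prox_dir \<M> f \<mu> t x
      in F_obj f \<mu> (R x (\<alpha> *\<^sub>R v)) \<le> F_obj f \<mu> x - 1 / 2 * \<alpha> * (norm v)\<^sup>2)"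

definition phase1_step ::
  "(real^'n) set \<Rightarrow> (real^'n \<Rightarrow> real^'n \<Rightarrow> real^'n) \<Rightarrow> (real^'n \<Rightarrow> real) \<Rightarrow> real \<Rightarrow> real \<Rightarrow>
     real \<Rightarrow> real^'n \<Rightarrow> real^'n \<Rightarrow> bool"
where
  "phase1_step \<M> R f \<mu> t \<rho> x x' \<longleftrightarrow>
     (\<exists>m. sufficient_decrease \<M> R f \<mu> t x (\<rho> ^ m) \<and>
          (\<forall>i<m. \<not> sufficient_decrease \<M> R f \<mu> t x (\<rho> ^ i)) \<and>
          x' = R x (\<rho> ^ m *\<^sub>R prox_dir \<M> f \<mu> t x))"

text \<open>
  The linear system of Phase 2 is understood to determine its solution: a step exists only where
  \<open>J\<close> is defined (\<open>invertible (BMB \<dots>)\<close>) and nonsingular on the tangent space. Otherwise, starting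
  from a stationary point with singular \<open>J\<close>, any kernel vector would be a legitimate \<open>u\<close>.
\<close>

definition phase2_step ::
  "(real^'n) set \<Rightarrow> (real^'n \<Rightarrow> real^'n \<Rightarrow> real^'n) \<Rightarrow> (real^'n \<Rightarrow> real) \<Rightarrow> real \<Rightarrow> real \<Rightarrow>
     (real^'n \<Rightarrow> real^'d^'n) \<Rightarrow> (real^'n \<Rightarrow> real^'d) \<Rightarrow> real^'n \<Rightarrow> real^'n \<Rightarrow> bool"
where
  "phase2_step \<M> R f \<mu> t B lam x x' \<longleftrightarrow>
     J_nonsingular \<M> f \<mu> t (B x) (lam x) x \<and>
     (\<exists>u\<in>tangent_space \<M> x.
        J_op \<M> f \<mu> t (B x) (lam x) x u = - prox_dir \<M> f \<mu> t x \<and> x' = R x u)"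

text \<open>
  The switching index \<open>K\<close> is the first \<open>k\<close> with \<open>norm (v (x k)) \<le> \<epsilon>\<close> (infinite if there is none),
  so \<open>k < K\<close> iff all \<open>i \<le> k\<close> have \<open>norm (v (x i)) > \<epsilon>\<close>. A run is an infinite sequence; in
  particular every line search in it terminates.
\<close>

definition RPN_G_run ::
  "(real^'n) set \<Rightarrow> (real^'n \<Rightarrow> real^'n \<Rightarrow> real^'n) \<Rightarrow> (real^'n \<Rightarrow> real) \<Rightarrow> real \<Rightarrow> real \<Rightarrow>
     (real^'n \<Rightarrow> real^'d^'n) \<Rightarrow> (real^'n \<Rightarrow> real^'d) \<Rightarrow> real \<Rightarrow> real^'n \<Rightarrow> real \<Rightarrow>
     (nat \<Rightarrow> real^'n) \<Rightarrow> bool"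
where
  "RPN_G_run \<M> R f \<mu> t B lam \<rho> x0 \<epsilon> x \<longleftrightarrow>
     x 0 = x0 \<and>
     (\<forall>k. if \<forall>i\<le>k. norm (prox_dir \<M> f \<mu> t (x i)) > \<epsilon>
          then phase1_step \<M> R f \<mu> t \<rho> (x k) (x (Suc k))
          else phase2_step \<M> R f \<mu> t B lam (x k) (x (Suc k)))"


section \<open>Assumptions at the limit point, and convergence rate\<close>

definition strict_isolated_minimum ::
  "(real^'n) set \<Rightarrow> (real^'n \<Rightarrow> real) \<Rightarrow> real \<Rightarrow> real \<Rightarrow> real^'n \<Rightarrow> bool"
where
  "strict_isolated_minimum \<M> f \<mu> t xs \<longleftrightarrow>
     stationary \<M> f \<mu> t xs \<and>
     (\<exists>U. open U \<and> xs \<in> U \<and>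
        (\<forall>y\<in>\<M> \<inter> U. y \<noteq> xs \<longrightarrow> F_obj f \<mu> y > F_obj f \<mu> xs) \<and>
        (\<forall>y\<in>\<M> \<inter> U. stationary \<M> f \<mu> t y \<longrightarrow> y = xs))"

text \<open>
  The index type \<open>'n\<close> carries no order, so the block of the first \<open>j\<close> coordinates is the support
  \<open>{i. xs $ i \<noteq> 0}\<close>. The block of the corresponding rows of \<open>b\<close> is padded with zero rows, which
  does not change its rank.
\<close>

definition assumption_A :: "real^'d^'n \<Rightarrow> real^'n \<Rightarrow> bool"
where
  "assumption_A b xs \<longleftrightarrow>
     CARD('d) \<le> card {i. xs $ i \<noteq> 0} \<and>
     rank ((\<chi> i. if xs $ i \<noteq> 0 then b $ i else 0) :: real^'d^'n) = CARD('d)"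

definition assumption_B ::
  "(real^'n) set \<Rightarrow> (real^'n \<Rightarrow> real) \<Rightarrow> real \<Rightarrow> real \<Rightarrow> real^'n \<Rightarrow> bool"
where
  "assumption_B \<M> f \<mu> t xs \<longleftrightarrow>
     (\<exists>U. open U \<and> xs \<in> U \<and>
        (\<forall>x\<in>\<M> \<inter> U. \<forall>i.
           (xs $ i \<noteq> 0 \<longrightarrow> (x + prox_dir \<M> f \<mu> t x) $ i \<noteq> 0) \<and>
           (xs $ i = 0 \<longrightarrow> (x + prox_dir \<M> f \<mu> t x) $ i = 0)))"

definition converges_quadratically :: "(nat \<Rightarrow> 'a::real_normed_vector) \<Rightarrow> 'a \<Rightarrow> bool"
where
  "converges_quadratically x xs \<longleftrightarrow>
     x \<longlonglongrightarrow> xs \<and>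
     (\<exists>C. \<forall>\<^sub>F k in sequentially. norm (x (Suc k) - xs) \<le> C * (norm (x k - xs))\<^sup>2)"

end

theory Submission
  imports Defs
begin

text \<open>
  Write \<open>v x\<close> for the proximal direction and \<open>T x\<close> for the tangent space at \<open>x\<close>.

  Accumulation points are stationary for the following reason. On \<open>T x\<close> the proximal model is strongly convex
  with modulus \<open>1/t\<close>, so comparing its minimizer \<open>v x\<close> with \<open>0\<close> bounds the linearized change of the objective
  by \<open>- (norm (v x))\<^sup>2 / t\<close>. Since \<open>R x u\<close> differs from \<open>x + u\<close> only to second order in \<open>u\<close>, uniformly near
  a point of \<open>\<M>\<close>, a step \<open>\<beta> *\<^sub>R v x\<close> lowers the objective by at least
  \<open>\<beta> / t * (norm (v x))\<^sup>2 - K * \<beta>\<^sup>2\<close> (\<open>line_search_decrease\<close>). The line search asks for the factor \<open>1/2\<close>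
  in place of \<open>1/t\<close>, so for \<open>t < 2\<close> its step lengths stay away from \<open>0\<close> near a nonstationary point, where \<open>v\<close>
  is continuous (\<open>prox_dir_continuous\<close>). But the decreases sum to a finite amount, which forces
  \<open>\<alpha>\<^sub>k * (norm (v x\<^sub>k))\<^sup>2\<close> to \<open>0\<close> for the accepted lengths \<open>\<alpha>\<^sub>k\<close>. A run that hits a stationary point stays
  there (\<open>phase2_step_at_stationary\<close>).

  If the accumulation point \<open>xs\<close> is a strict local minimizer, the whole run with \<open>\<epsilon> = 0\<close> converges to it: the
  objective values decrease to the value at \<open>xs\<close> and, since \<open>\<alpha>\<^sub>k \<le> 1\<close>, the steps tend to \<open>0\<close>. On a thin annulus
  around \<open>xs\<close> the objective exceeds its value at \<open>xs\<close> by a fixed amount, so the iterates can neither enter nor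
  jump over it (\<open>phase1_converges_to_strict_minimum\<close>).

  The Newton-type step converges quadratically near \<open>xs\<close>. There \<open>assumption_B\<close> fixes the active coordinates
  and their signs, which turns the proximal equation into a smooth system. The matrix \<open>\<Lambda> x\<close> annihilates the
  normal vectors \<open>B x *v y\<close>, so it eliminates the multiplier; this yields
  \<open>v x = J(x) (P x (x - xs)) + O((norm (x - xs))\<^sup>2)\<close>, where \<open>P x\<close> is the projector onto \<open>T x\<close>, without
  differentiating the multiplier or an inverse matrix (\<open>v_newton_expansion\<close>). The extension of \<open>J(x)\<close> by the
  identity on the normal space is a continuous matrix function that is invertible at \<open>xs\<close>, so its inverse is
  bounded nearby, and the solution of \<open>J(x) u = - v x\<close> satisfies \<open>x + u = xs + O((norm (x - xs))\<^sup>2)\<close>.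
  The retraction changes this only by another quadratic term (\<open>newton_step_quadratic\<close>).

  It remains to choose \<open>\<epsilon>\<close>. From some index \<open>N\<close> on, the run with \<open>\<epsilon> = 0\<close> lies in the basin of the Newton-type
  step. A threshold below all \<open>norm (v x\<^sub>i)\<close> with \<open>i < N\<close> makes every run coincide with it up to an index that is
  at least \<open>N\<close> and continue by Newton-type steps from there (\<open>switching_threshold_exists\<close>).

  Underlying all this is that the tangent space, defined by velocities of curves, is the kernel of the
  derivative of a local defining function \<open>c\<close> (\<open>tangent_space_eq_kernel\<close>). With \<open>A\<close> the derivative of \<open>c\<close>,
  the projector is \<open>mat 1 - transpose A ** matrix_inv (A ** transpose A) ** A\<close>, hence differentiable, and
  the secant \<open>x - xs\<close> is tangent at \<open>x\<close> up to second order.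
\<close>

section \<open>Continuously differentiable maps\<close>

lemma C_diff_on_imp_continuous_on:
  assumes "C_diff_on k S f"
  shows "continuous_on S f"
proof (cases k)
  case 0
  then show ?thesis using assms by simp
next
  case (Suc m)
  then have "\<forall>x\<in>S. f differentiable (at x)" using assms by simp
  then show ?thesis
    by (simp add: continuous_at_imp_continuous_on differentiable_imp_continuous_within)
qed

lemma C_diff_on_SucD: "C_diff_on (Suc k) S f \<Longrightarrow> C_diff_on k S f"
proof (induction k arbitrary: f)
  case 0
  then show ?case using C_diff_on_imp_continuous_on[OF 0] by simp
next
  case (Suc k)
  then show ?case by (metis C_diff_on.simps(2))
qed

text \<open>
  \<open>C_diff_on\<close> speaks of one direction at a time; expanding in a basis turns bounds for finitely many
  directions into bounds for the derivative as a linear map.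
\<close>

lemma frechet_derivative_expand:
  fixes f :: "'a::euclidean_space \<Rightarrow> 'b::real_normed_vector"
  assumes "f differentiable (at x)"
  shows "frechet_derivative f (at x) h = (\<Sum>b\<in>Basis. (h \<bullet> b) *\<^sub>R frechet_derivative f (at x) b)"
proof -
  have lin: "linear (frechet_derivative f (at x))"
    by (rule linear_frechet_derivative[OF assms])
  have "frechet_derivative f (at x) h = frechet_derivative f (at x) (\<Sum>b\<in>Basis. (h \<bullet> b) *\<^sub>R b)"
    by (simp add: euclidean_representation)
  also have "\<dots> = (\<Sum>b\<in>Basis. (h \<bullet> b) *\<^sub>R frechet_derivative f (at x) b)"
    by (simp add: linear_sum[OF lin] linear_cmul[OF lin])
  finally show ?thesis .
qed

lemma C1_derivative_bounded:
  fixes f :: "'a::euclidean_space \<Rightarrow> 'b::real_normed_vector"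
  assumes "open S" "C_diff_on (Suc 0) S f" "x0 \<in> S"
  obtains r K where "r > 0" "K \<ge> 0" "cball x0 r \<subseteq> S"
    "\<And>x h. x \<in> cball x0 r \<Longrightarrow> norm (frechet_derivative f (at x) h) \<le> K * norm h"
proof -
  obtain r where r: "r > 0" "cball x0 r \<subseteq> S" using assms(1,3) open_contains_cball by blast
  have "\<exists>K. \<forall>x\<in>cball x0 r. norm (frechet_derivative f (at x) b) \<le> K" for b
  proof -
    have "continuous_on (cball x0 r) (\<lambda>x. frechet_derivative f (at x) b)"
      using assms(2) r(2) by (auto intro: continuous_on_subset)
    then have "bounded ((\<lambda>x. frechet_derivative f (at x) b) ` cball x0 r)"
      by (simp add: compact_continuous_image compact_imp_bounded)
    then show ?thesis by (auto simp: bounded_iff)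
  qed
  then obtain k where k: "\<And>b x. x \<in> cball x0 r \<Longrightarrow> norm (frechet_derivative f (at x) b) \<le> k b"
    by metis
  have k0: "k b \<ge> 0" for b using k[of x0 b] r by (meson centre_in_cball less_imp_le norm_ge_zero order_trans)
  show ?thesis
  proof (rule that[OF r(1) _ r(2)])
    show "0 \<le> (\<Sum>b\<in>Basis. k b)" by (simp add: k0 sum_nonneg)
    fix x h assume x: "x \<in> cball x0 r"
    have "norm (frechet_derivative f (at x) h) = norm (\<Sum>b\<in>Basis. (h \<bullet> b) *\<^sub>R frechet_derivative f (at x) b)"
      using frechet_derivative_expand assms(2) r(2) x by (metis C_diff_on.simps(2) subsetD)
    also have "\<dots> \<le> (\<Sum>b\<in>Basis. norm h * k b)"
    proof (rule order_trans[OF norm_sum], rule sum_mono)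
      fix b :: 'a assume b: "b \<in> Basis"
      show "norm ((h \<bullet> b) *\<^sub>R frechet_derivative f (at x) b) \<le> norm h * k b"
        using Basis_le_norm[OF b, of h] k[OF x, of b] by (simp add: mult_mono)
    qed
    finally show "norm (frechet_derivative f (at x) h) \<le> (\<Sum>b\<in>Basis. k b) * norm h"
      by (simp add: sum_distrib_left[symmetric] mult.commute)
  qed
qed

lemma C1_locally_lipschitz:
  fixes f :: "'a::euclidean_space \<Rightarrow> 'b::real_normed_vector"
  assumes "open S" "C_diff_on (Suc 0) S f" "x0 \<in> S"
  obtains r K where "r > 0" "K \<ge> 0" "cball x0 r \<subseteq> S"
    "\<And>x y. x \<in> cball x0 r \<Longrightarrow> y \<in> cball x0 r \<Longrightarrow> norm (f y - f x) \<le> K * norm (y - x)"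
proof -
  obtain r K where rK: "r > 0" "K \<ge> 0" "cball x0 r \<subseteq> S"
    "\<And>x h. x \<in> cball x0 r \<Longrightarrow> norm (frechet_derivative f (at x) h) \<le> K * norm h"
    using C1_derivative_bounded[OF assms] by metis
  show ?thesis
  proof (rule that[OF rK(1-3)])
    fix x y assume xy: "x \<in> cball x0 r" "y \<in> cball x0 r"
    show "norm (f y - f x) \<le> K * norm (y - x)"
    proof (rule differentiable_bound[OF convex_cball _ _ xy(2,1)])
      fix z assume z: "z \<in> cball x0 r"
      then have "f differentiable (at z)" using rK(3) assms(2) by auto
      then show "(f has_derivative frechet_derivative f (at z)) (at z within cball x0 r)"
        using frechet_derivative_works has_derivative_at_withinI by blast
      show "onorm (frechet_derivative f (at z)) \<le> K" by (rule onorm_le) (rule rK(4)[OF z])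
    qed
  qed
qed

lemma C2_derivative_locally_lipschitz:
  fixes f :: "'a::euclidean_space \<Rightarrow> 'b::real_normed_vector"
  assumes "open S" "C_diff_on 2 S f" "x0 \<in> S"
  obtains r K where "r > 0" "K \<ge> 0" "cball x0 r \<subseteq> S"
    "\<And>x y h. x \<in> cball x0 r \<Longrightarrow> y \<in> cball x0 r \<Longrightarrow>
       norm (frechet_derivative f (at y) h - frechet_derivative f (at x) h) \<le> K * norm (y - x) * norm h"
proof -
  have C2: "\<forall>w. C_diff_on (Suc 0) S (\<lambda>x. frechet_derivative f (at x) w)"
    and diff: "\<And>x. x \<in> S \<Longrightarrow> f differentiable (at x)"
    using assms(2) by (simp_all add: numeral_2_eq_2)
  have "\<exists>r K. r > 0 \<and> K \<ge> 0 \<and> cball x0 r \<subseteq> S \<and> (\<forall>x\<in>cball x0 r. \<forall>y\<in>cball x0 r.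
     norm (frechet_derivative f (at y) b - frechet_derivative f (at x) b) \<le> K * norm (y - x))" for b
    using C1_locally_lipschitz[OF assms(1) C2[rule_format, of b] assms(3)] by metis
  then obtain r K where rK: "\<And>b. r b > 0" "\<And>b. K b \<ge> 0" "\<And>b. cball x0 (r b) \<subseteq> S"
    "\<And>b x y. x\<in>cball x0 (r b) \<Longrightarrow> y\<in>cball x0 (r b) \<Longrightarrow>
     norm (frechet_derivative f (at y) b - frechet_derivative f (at x) b) \<le> K b * norm (y - x)"
    by metis
  define r0 where "r0 = Min (r ` (Basis :: 'a set))"
  have r0: "r0 > 0" unfolding r0_def using rK(1) by (subst Min_gr_iff) auto
  have r0b: "r0 \<le> r b" if "b \<in> Basis" for b unfolding r0_def using that by simp
  obtain b0 :: 'a where b0: "b0 \<in> Basis" using nonempty_Basis by blast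
  have sub: "cball x0 r0 \<subseteq> S" using r0b[OF b0] rK(3)[of b0] by auto
  show ?thesis
  proof (rule that[OF r0 _ sub])
    show "0 \<le> (\<Sum>b\<in>Basis. K b)" by (simp add: rK sum_nonneg)
    fix x y h assume x: "x \<in> cball x0 r0" and y: "y \<in> cball x0 r0"
    have "norm (frechet_derivative f (at y) h - frechet_derivative f (at x) h)
       = norm (\<Sum>b\<in>Basis. (h \<bullet> b) *\<^sub>R (frechet_derivative f (at y) b - frechet_derivative f (at x) b))"
      by (subst (1 2) frechet_derivative_expand) (use x y sub diff in \<open>auto simp: sum_subtractf scaleR_diff_right\<close>)
    also have "\<dots> \<le> (\<Sum>b\<in>Basis. norm h * (K b * norm (y - x)))"
    proof (rule order_trans[OF norm_sum], rule sum_mono)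
      fix b :: 'a assume b: "b \<in> Basis"
      have "norm (frechet_derivative f (at y) b - frechet_derivative f (at x) b) \<le> K b * norm (y - x)"
        using r0b[OF b] x y by (intro rK(4)) auto
      then show "norm ((h \<bullet> b) *\<^sub>R (frechet_derivative f (at y) b - frechet_derivative f (at x) b))
          \<le> norm h * (K b * norm (y - x))"
        using Basis_le_norm[OF b, of h] by (simp add: mult_mono)
    qed
    also have "\<dots> = (\<Sum>b\<in>Basis. K b) * norm (y - x) * norm h"
      by (simp add: sum_distrib_left sum_distrib_right mult_ac)
    finally show "norm (frechet_derivative f (at y) h - frechet_derivative f (at x) h)
       \<le> (\<Sum>b\<in>Basis. K b) * norm (y - x) * norm h" .
  qed
qed

text \<open>
  Both points vary near \<open>x0\<close>, and the derivative is taken at the first of them: a Newton-type step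
  linearizes at the current iterate, not at the limit.
\<close>

lemma C2_taylor:
  fixes f :: "'a::euclidean_space \<Rightarrow> 'b::real_normed_vector"
  assumes "open S" "C_diff_on 2 S f" "x0 \<in> S"
  obtains r K where "r > 0" "K \<ge> 0" "cball x0 r \<subseteq> S"
    "\<And>x y. x \<in> cball x0 r \<Longrightarrow> y \<in> cball x0 r \<Longrightarrow>
       norm (f y - f x - frechet_derivative f (at x) (y - x)) \<le> K * (norm (y - x))\<^sup>2"
proof -
  obtain r K where rK: "r > 0" "K \<ge> 0" "cball x0 r \<subseteq> S"
    "\<And>x y h. x \<in> cball x0 r \<Longrightarrow> y \<in> cball x0 r \<Longrightarrow>
       norm (frechet_derivative f (at y) h - frechet_derivative f (at x) h) \<le> K * norm (y - x) * norm h"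
    using C2_derivative_locally_lipschitz[OF assms] by metis
  have diff: "\<And>x. x \<in> S \<Longrightarrow> (f has_derivative frechet_derivative f (at x)) (at x)"
    using assms(2) by (simp add: numeral_2_eq_2 frechet_derivative_works)
  show ?thesis
  proof (rule that[OF rK(1-3)])
    fix x y assume x: "x \<in> cball x0 r" and y: "y \<in> cball x0 r"
    have seg: "closed_segment x y \<subseteq> cball x0 r"
      by (rule closed_segment_subset[OF x y convex_cball])
    have lin: "bounded_linear (frechet_derivative f (at x))"
      using diff x rK(3) has_derivative_bounded_linear by blast
    let ?g = "\<lambda>z. f z - frechet_derivative f (at x) z"
    have "norm (?g y - ?g x) \<le> (K * norm (y - x)) * norm (y - x)"
    proof (rule differentiable_bound[of "closed_segment x y" ?g
          "\<lambda>z h. frechet_derivative f (at z) h - frechet_derivative f (at x) h"])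
      fix z assume z: "z \<in> closed_segment x y"
      have zb: "z \<in> cball x0 r" using z seg by blast
      show "(?g has_derivative (\<lambda>h. frechet_derivative f (at z) h - frechet_derivative f (at x) h))
         (at z within closed_segment x y)"
        by (intro has_derivative_diff has_derivative_at_withinI[OF diff]
            bounded_linear_imp_has_derivative[OF lin]) (use zb rK(3) in auto)
      have nz: "norm (z - x) \<le> norm (y - x)"
        using segment_bound(1)[OF z] by (simp add: norm_minus_commute)
      show "onorm (\<lambda>h. frechet_derivative f (at z) h - frechet_derivative f (at x) h) \<le> K * norm (y - x)"
        by (rule onorm_le, rule order_trans[OF rK(4)[OF x zb]])
          (intro mult_right_mono mult_left_mono nz rK(2), auto)
    qed auto
    then show "norm (f y - f x - frechet_derivative f (at x) (y - x)) \<le> K * (norm (y - x))\<^sup>2"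
      using bounded_linear.linear[OF lin] by (simp add: linear_diff power2_eq_square algebra_simps)
  qed
qed

lemma has_derivative_vec_lambda:
  fixes f :: "'a::real_normed_vector \<Rightarrow> 'i::finite \<Rightarrow> 'b::euclidean_space"
  assumes "\<And>i. ((\<lambda>x. f x i) has_derivative D i) (at x within S)"
  shows "((\<lambda>x. \<chi> i. f x i) has_derivative (\<lambda>h. \<chi> i. D i h)) (at x within S)"
proof (subst has_derivative_componentwise_within, rule ballI)
  fix e :: "'b^'i" assume "e \<in> Basis"
  then obtain i u where e: "e = axis i u" by (auto simp: Basis_vec_def)
  show "((\<lambda>x. (\<chi> i. f x i) \<bullet> e) has_derivative (\<lambda>h. (\<chi> i. D i h) \<bullet> e)) (at x within S)"
    unfolding e inner_axis by (simp add: has_derivative_inner_left assms)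
qed

lemma differentiable_vec_lambda:
  fixes f :: "'a::real_normed_vector \<Rightarrow> 'i::finite \<Rightarrow> 'b::euclidean_space"
  assumes "\<And>i. (\<lambda>x. f x i) differentiable (at x within S)"
  shows "(\<lambda>x. \<chi> i. f x i) differentiable (at x within S)"
  using assms has_derivative_vec_lambda[of f _ x S] unfolding differentiable_def by metis

lemma C_diff_on_subset: "C_diff_on k S f \<Longrightarrow> S' \<subseteq> S \<Longrightarrow> C_diff_on k S' f"
proof (induction k arbitrary: f)
  case 0
  then show ?case by (auto intro: continuous_on_subset)
qed auto

text \<open>
  This transfers the smoothness of \<open>f\<close> to its gradient, which is defined coordinate by coordinate.
\<close>

lemma C_diff_on_vec_lambda:
  fixes \<phi> :: "'i::finite \<Rightarrow> 'a::euclidean_space \<Rightarrow> real"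
  assumes "\<And>i. C_diff_on k UNIV (\<phi> i)"
  shows "C_diff_on k UNIV (\<lambda>x. \<chi> i. \<phi> i x)"
  using assms
proof (induction k arbitrary: \<phi>)
  case 0
  then show ?case by (simp add: continuous_on_vec_lambda)
next
  case (Suc k)
  have der: "((\<lambda>x. \<chi> i. \<phi> i x) has_derivative (\<lambda>h. \<chi> i. frechet_derivative (\<phi> i) (at x) h)) (at x)" for x
    using Suc.prems by (intro has_derivative_vec_lambda) (simp add: frechet_derivative_works)
  have "frechet_derivative (\<lambda>x. \<chi> i. \<phi> i x) (at x) w = (\<chi> i. frechet_derivative (\<phi> i) (at x) w)" for x w
    using frechet_derivative_at[OF der] by metis
  moreover have "C_diff_on k UNIV (\<lambda>x. \<chi> i. frechet_derivative (\<phi> i) (at x) w)" for w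
    using Suc.prems by (intro Suc.IH) simp
  moreover have "(\<lambda>x. \<chi> i. \<phi> i x) differentiable (at x)" for x
    using der differentiableI by blast
  ultimately show ?case by simp
qed

lemma grad_C2: "C_diff_on 3 UNIV f \<Longrightarrow> C_diff_on 2 UNIV (grad f)"
  unfolding grad_def by (rule C_diff_on_vec_lambda) (simp add: numeral_3_eq_3 numeral_2_eq_2)

lemma frechet_derivative_eq_grad:
  assumes "f differentiable (at x)"
  shows "frechet_derivative f (at x) w = grad f x \<bullet> w"
proof -
  have lin: "linear (frechet_derivative f (at x))" by (rule linear_frechet_derivative[OF assms])
  have "w = (\<Sum>i\<in>UNIV. w $ i *\<^sub>R axis i 1)"
    using basis_expansion[of w] by (simp add: scalar_mult_eq_scaleR)
  then have "frechet_derivative f (at x) w = frechet_derivative f (at x) (\<Sum>i\<in>UNIV. w $ i *\<^sub>R axis i 1)"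
    by (rule arg_cong)
  also have "\<dots> = (\<Sum>i\<in>UNIV. w $ i * frechet_derivative f (at x) (axis i 1))"
    by (simp add: linear_sum[OF lin] linear_cmul[OF lin])
  finally show ?thesis by (simp add: grad_def inner_vec_def mult.commute)
qed


section \<open>Matrices depending on a parameter\<close>

text \<open>
  Matrix products are rewritten below with \<open>transpose A *v x\<close> kept as it is; the default simplification to
  a row-vector product would hide the products \<open>transpose b ** b\<close> and \<open>transpose b ** m ** b\<close>.
\<close>

declare transpose_matrix_vector [simp del]

lemma bounded_bilinear_matrix_vector: "bounded_bilinear ((*v) :: real^'n^'m \<Rightarrow> real^'n \<Rightarrow> real^'m)"
  unfolding bilinear_conv_bounded_bilinear[symmetric] bilinear_def
  by (auto intro!: linearI simp: matrix_vector_mult_add_rdistrib vec.add scaleR_matrix_vector_assoc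
      matrix_vector_mult_scaleR)

lemma bounded_bilinear_matrix_matrix:
  "bounded_bilinear ((**) :: real^'n^'m \<Rightarrow> real^'p^'n \<Rightarrow> real^'p^'m)"
  unfolding bilinear_conv_bounded_bilinear[symmetric] bilinear_def
  by (auto intro!: linearI simp: matrix_add_ldistrib vec_eq_iff matrix_matrix_mult_def
      sum.distrib sum_distrib_left algebra_simps)

lemma bounded_linear_transpose: "bounded_linear (transpose :: real^'n^'m \<Rightarrow> real^'m^'n)"
  unfolding linear_conv_bounded_linear[symmetric]
  by (auto intro!: linearI simp: transpose_def vec_eq_iff)

lemma differentiable_prod_real:
  fixes f :: "'i \<Rightarrow> 'a::real_normed_vector \<Rightarrow> real"
  assumes "\<And>i. i \<in> I \<Longrightarrow> f i differentiable (at x)"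
  shows "(\<lambda>y. \<Prod>i\<in>I. f i y) differentiable (at x)"
  using assms
  by (induction I rule: infinite_finite_induct) auto

lemma differentiable_det:
  fixes E :: "'a::real_normed_vector \<Rightarrow> 'n::finite \<Rightarrow> 'n \<Rightarrow> real"
  assumes "\<And>i j. (\<lambda>y. E y i j) differentiable (at x)"
  shows "(\<lambda>y. det (\<chi> i j. E y i j)) differentiable (at x)"
  unfolding det_def
  by (intro differentiable_sum ballI differentiable_mult differentiable_const finite_permutations)
    (auto intro!: differentiable_prod_real assms)

lemma matrix_inv_inverse:
  fixes A :: "real^'n^'n"
  assumes "invertible A"
  shows "matrix_inv A ** A = mat 1" "A ** matrix_inv A = mat 1"
  using someI_ex[OF assms[unfolded invertible_def]] unfolding matrix_inv_def by auto

lemma matrix_inv_cramer: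
  fixes A :: "real^'n^'n"
  assumes "invertible A"
  shows "matrix_inv A = (\<chi> k l. det (\<chi> i j. if j = k then axis l 1 $ i else A $ i $ j) / det A)"
proof -
  have d: "det A \<noteq> 0" using assms invertible_det_nz by blast
  have "A *v (matrix_inv A *v axis l 1) = axis l 1" for l :: 'n
    by (simp add: matrix_vector_mul_assoc matrix_inv_inverse(2)[OF assms])
  then have "matrix_inv A *v axis l 1 = (\<chi> k. det (\<chi> i j. if j = k then axis l 1 $ i else A $ i $ j) / det A)" for l
    unfolding cramer[OF d] .
  then show ?thesis
    by (simp add: vec_eq_iff matrix_vector_mult_basis column_def)
qed

lemma open_invertible: "open {A :: real^'n^'n. invertible A}"
proof -
  have "(\<lambda>A :: real^'n^'n. det (\<chi> i j. A $ i $ j)) differentiable (at A)" for A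
    by (rule differentiable_det) (auto intro!: bounded_linear_imp_differentiable
        bounded_linear_compose[OF bounded_linear_vec_nth bounded_linear_vec_nth])
  then have "isCont (\<lambda>A :: real^'n^'n. det (\<chi> i j. A $ i $ j)) A" for A
    by (rule differentiable_imp_continuous_within)
  then have "continuous_on UNIV (det :: real^'n^'n \<Rightarrow> real)"
    by (simp add: continuous_on_eq_continuous_at)
  then have "open {A :: real^'n^'n. det A \<noteq> 0}"
    by (intro open_Collect_neq continuous_on_const)
  then show ?thesis by (simp add: invertible_det_nz)
qed

text \<open>
  Determinants are polynomials in the entries, so Cramer's rule gives a differentiable formula that is valid
  on the open set of invertible matrices.
\<close>

lemma differentiable_matrix_inv:
  fixes A :: "real^'n^'n"
  assumes "invertible A"
  shows "matrix_inv differentiable (at A)"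
proof -
  have entry: "(\<lambda>X :: real^'n^'n. X $ i $ j) differentiable (at A)" for i j
    by (auto intro!: bounded_linear_imp_differentiable
        bounded_linear_compose[OF bounded_linear_vec_nth bounded_linear_vec_nth])
  have d: "(\<lambda>X :: real^'n^'n. det (\<chi> i j. X $ i $ j)) differentiable (at A)"
    by (rule differentiable_det) (rule entry)
  then have d: "det differentiable (at A)" by simp
  have replaced: "(\<lambda>X :: real^'n^'n. if j = k then axis l 1 $ i else X $ i $ j) differentiable (at A)" for i j k l
    by (cases "j = k") (simp_all add: entry)
  have "det A \<noteq> 0" using assms invertible_det_nz by blast
  then have "(\<lambda>X :: real^'n^'n. \<chi> k l. det (\<chi> i j. if j = k then axis l 1 $ i else X $ i $ j) / det X)
     differentiable (at A)"
    by (intro differentiable_vec_lambda differentiable_divide differentiable_det d replaced)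
  then obtain D where "((\<lambda>X :: real^'n^'n. \<chi> k l. det (\<chi> i j. if j = k then axis l 1 $ i else X $ i $ j) / det X)
     has_derivative D) (at A)" unfolding differentiable_def by blast
  then have "(matrix_inv has_derivative D) (at A)"
    by (rule has_derivative_transform_within_open[OF _ open_invertible]) (auto simp: assms matrix_inv_cramer)
  then show ?thesis unfolding differentiable_def by blast
qed

lemma tendsto_matrix_inv:
  fixes A :: "'a \<Rightarrow> real^'n^'n"
  assumes "(A \<longlongrightarrow> A0) F" "invertible A0"
  shows "((\<lambda>x. matrix_inv (A x)) \<longlongrightarrow> matrix_inv A0) F"
    and "\<forall>\<^sub>F x in F. invertible (A x)"
proof -
  show "((\<lambda>x. matrix_inv (A x)) \<longlongrightarrow> matrix_inv A0) F"
    using differentiable_matrix_inv[OF assms(2)] assms(1)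
    by (auto intro: isCont_tendsto_compose differentiable_imp_continuous_within)
  show "\<forall>\<^sub>F x in F. invertible (A x)"
    using topological_tendstoD[OF assms(1) open_invertible] assms(2) by simp
qed

lemmas matrix_matrix_diff = bounded_bilinear.diff_left[OF bounded_bilinear_matrix_matrix]
  bounded_bilinear.diff_right[OF bounded_bilinear_matrix_matrix]

lemma matrix_vector_mult_minus [simp]:
  fixes A :: "real^'n^'m"
  shows "A *v (- x) = - (A *v x)" "(- A) *v x = - (A *v x)"
  by (rule bounded_bilinear.minus_right[OF bounded_bilinear_matrix_vector]
      bounded_bilinear.minus_left[OF bounded_bilinear_matrix_vector])+

text \<open>
  \<open>\<Lambda>\<close> is the oblique analogue of a projector: it removes from \<open>m\<close> the part seen by the columns of \<open>b\<close>. That it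
  kills \<open>b\<close> on one side and is killed by \<open>transpose b\<close> on the other makes it eliminate multipliers and map
  into the tangent space.
\<close>

lemma reduced_projection_algebra:
  fixes b :: "real^'d^'n" and m :: "real^'n^'n"
  assumes mm: "m ** m = m" and inv: "invertible (transpose b ** m ** b)"
  defines "H \<equiv> matrix_inv (transpose b ** m ** b)"
  defines "\<Lambda> \<equiv> m - m ** b ** H ** transpose b ** m"
  shows "\<Lambda> ** b = 0" and "transpose b ** \<Lambda> = 0" and "\<Lambda> ** m = \<Lambda>"
proof -
  note HA = matrix_inv_inverse[OF inv, folded H_def]
  have "m ** b ** H ** transpose b ** m ** b = m ** b ** (H ** (transpose b ** m ** b))"
    by (simp only: matrix_mul_assoc)
  then show "\<Lambda> ** b = 0" unfolding \<Lambda>_def by (simp add: matrix_matrix_diff HA)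
  have "transpose b ** (m ** b ** H ** transpose b ** m) = ((transpose b ** m ** b) ** H) ** (transpose b ** m)"
    by (simp only: matrix_mul_assoc)
  then show "transpose b ** \<Lambda> = 0" unfolding \<Lambda>_def by (simp add: matrix_matrix_diff HA)
  show "\<Lambda> ** m = \<Lambda>"
    unfolding \<Lambda>_def by (simp add: matrix_matrix_diff mm matrix_mul_assoc[symmetric])
qed


section \<open>Relative neighbourhoods and orders of vanishing\<close>

text \<open>Neighbourhoods of \<open>p\<close> relative to \<open>S\<close>; unlike \<open>at p within S\<close> this includes \<open>p\<close>.\<close>

abbreviation nhds_in :: "'a::topological_space set \<Rightarrow> 'a \<Rightarrow> 'a filter" where
  "nhds_in S p \<equiv> inf (nhds p) (principal S)"

lemma tendsto_nhds_in:
  assumes "continuous (at p within S) g"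
  shows "(g \<longlongrightarrow> g p) (nhds_in S p)"
proof (rule topological_tendstoI)
  fix V assume V: "open V" "g p \<in> V"
  have "\<forall>\<^sub>F x in at p within S. g x \<in> V"
    using assms V unfolding continuous_within by (rule topological_tendstoD)
  then show "\<forall>\<^sub>F x in nhds_in S p. g x \<in> V"
    unfolding eventually_inf_principal eventually_at_filter
    by (rule eventually_mono) (use V(2) in auto)
qed

lemma eventually_nhds_in: "p \<in> S \<Longrightarrow> eventually P (nhds_in S p) \<Longrightarrow> P p"
  unfolding eventually_inf_principal by (auto dest: eventually_nhds_x_imp_x)

lemma isCont_tendsto_nhds: "isCont f x \<Longrightarrow> (f \<longlongrightarrow> f x) (nhds x)"
  by (simp add: isCont_def tendsto_at_iff_tendsto_nhds)

lemma filterlim_nhds_in: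
  assumes "y \<longlonglongrightarrow> p" "\<And>k. y k \<in> S"
  shows "filterlim y (nhds_in S p) sequentially"
  using assms by (simp add: filterlim_inf filterlim_principal)

text \<open>
  Orders of vanishing \<open>g x = O((norm (x - p))\<^sup>k)\<close> along a filter. The values of \<open>g\<close> lie in arbitrary normed
  spaces, so that vectors and matrices can be multiplied with the orders adding up.
\<close>

definition vanishes :: "'a filter \<Rightarrow> 'a::real_normed_vector \<Rightarrow> nat \<Rightarrow> ('a \<Rightarrow> 'b::real_normed_vector) \<Rightarrow> bool" where
  "vanishes F p k g \<longleftrightarrow> (\<exists>C\<ge>0. \<forall>\<^sub>F x in F. norm (g x) \<le> C * norm (x - p) ^ k)"

lemma vanishesI: "C \<ge> 0 \<Longrightarrow> \<forall>\<^sub>F x in F. norm (g x) \<le> C * norm (x - p) ^ k \<Longrightarrow> vanishes F p k g"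
  unfolding vanishes_def by blast

lemma vanishes_add:
  assumes "vanishes F p k g" "vanishes F p k h"
  shows "vanishes F p k (\<lambda>x. g x + h x)"
proof -
  obtain C D where C: "C \<ge> 0" "\<forall>\<^sub>F x in F. norm (g x) \<le> C * norm (x - p) ^ k"
    and D: "D \<ge> 0" "\<forall>\<^sub>F x in F. norm (h x) \<le> D * norm (x - p) ^ k"
    using assms unfolding vanishes_def by blast
  have "\<forall>\<^sub>F x in F. norm (g x + h x) \<le> (C + D) * norm (x - p) ^ k"
    using C(2) D(2)
  proof eventually_elim
    case (elim x)
    then show ?case using norm_triangle_ineq[of "g x" "h x"] by (simp add: distrib_right)
  qed
  then show ?thesis using C D by (intro vanishesI[of "C + D"]) auto
qed

lemma vanishes_minus: "vanishes F p k g \<Longrightarrow> vanishes F p k (\<lambda>x. - g x)"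
  unfolding vanishes_def by simp

lemma vanishes_diff: "vanishes F p k g \<Longrightarrow> vanishes F p k h \<Longrightarrow> vanishes F p k (\<lambda>x. g x - h x)"
  using vanishes_add[OF _ vanishes_minus, of F p k g h] by simp

lemma vanishes_cong:
  assumes "vanishes F p k g" "\<forall>\<^sub>F x in F. h x = g x"
  shows "vanishes F p k h"
proof -
  obtain C where C: "C \<ge> 0" "\<forall>\<^sub>F x in F. norm (g x) \<le> C * norm (x - p) ^ k"
    using assms(1) unfolding vanishes_def by blast
  have "\<forall>\<^sub>F x in F. norm (h x) \<le> C * norm (x - p) ^ k"
    using C(2) assms(2) by eventually_elim simp
  then show ?thesis using C(1) by (rule vanishesI[rotated])
qed

lemma vanishes_bilinear:
  assumes h: "bounded_bilinear h" and g: "vanishes F p j g" and g': "vanishes F p k g'"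
  shows "vanishes F p (j + k) (\<lambda>x. h (g x) (g' x))"
proof -
  obtain C D where C: "C \<ge> 0" "\<forall>\<^sub>F x in F. norm (g x) \<le> C * norm (x - p) ^ j"
    and D: "D \<ge> 0" "\<forall>\<^sub>F x in F. norm (g' x) \<le> D * norm (x - p) ^ k"
    using g g' unfolding vanishes_def by blast
  obtain K where K: "K > 0" "\<And>a b. norm (h a b) \<le> norm a * norm b * K"
    using bounded_bilinear.pos_bounded[OF h] by metis
  have "\<forall>\<^sub>F x in F. norm (h (g x) (g' x)) \<le> (C * D * K) * norm (x - p) ^ (j + k)"
    using C(2) D(2)
  proof eventually_elim
    case (elim x)
    have "norm (h (g x) (g' x)) \<le> norm (g x) * norm (g' x) * K" by (rule K)
    also have "\<dots> \<le> (C * norm (x - p) ^ j) * (D * norm (x - p) ^ k) * K"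
      using elim K(1) C(1) by (intro mult_right_mono mult_mono) auto
    finally show ?case by (simp add: power_add mult_ac)
  qed
  then show ?thesis using C D K by (intro vanishesI[of "C * D * K"]) auto
qed

lemmas vanishes_mult_vec = vanishes_bilinear[OF bounded_bilinear_matrix_vector]
lemmas vanishes_scaleR = vanishes_bilinear[OF bounded_bilinear_scaleR]

lemma vanishes_0_of_tendsto:
  assumes "(g \<longlongrightarrow> l) F"
  shows "vanishes F p 0 g"
proof -
  have "\<forall>\<^sub>F x in F. norm (g x) < norm l + 1"
    by (intro order_tendstoD(2)[OF tendsto_norm[OF assms]]) simp
  then have "\<forall>\<^sub>F x in F. norm (g x) \<le> (norm l + 1) * norm (x - p) ^ 0"
    by (rule eventually_mono) simp
  then show ?thesis by (intro vanishesI[of "norm l + 1"]) auto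
qed

lemma vanishes_self: "vanishes F p (Suc 0) (\<lambda>x. x - p)"
  by (rule vanishesI[of 1]) auto

lemma vanishes_le:
  assumes F: "F \<le> nhds p" and g: "vanishes F p k g" and jk: "j \<le> k"
  shows "vanishes F p j g"
proof -
  obtain C where C: "C \<ge> 0" "\<forall>\<^sub>F x in F. norm (g x) \<le> C * norm (x - p) ^ k"
    using g unfolding vanishes_def by blast
  have "\<forall>\<^sub>F x in nhds p. x \<in> ball p 1" by (intro eventually_nhds_in_open) auto
  then have "\<forall>\<^sub>F x in F. x \<in> ball p 1" using F filter_leD by blast
  with C(2) have "\<forall>\<^sub>F x in F. norm (g x) \<le> C * norm (x - p) ^ j"
  proof eventually_elim
    case (elim x)
    have "norm (x - p) ^ k \<le> norm (x - p) ^ j"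
      using elim(2) jk by (intro power_decreasing) (auto simp: dist_norm norm_minus_commute)
    then show ?case using elim(1) C(1) by (meson mult_left_mono order_trans)
  qed
  then show ?thesis using C(1) by (rule vanishesI[rotated])
qed

lemma vanishes_tendsto_0:
  assumes F: "F \<le> nhds p" and g: "vanishes F p (Suc 0) g"
  shows "(g \<longlongrightarrow> 0) F"
proof -
  obtain C where C: "C \<ge> 0" "\<forall>\<^sub>F x in F. norm (g x) \<le> C * norm (x - p)"
    using g unfolding vanishes_def by auto
  have "((\<lambda>x. x) \<longlongrightarrow> p) F" using F by (simp add: filterlim_def)
  then have "((\<lambda>x. C * norm (x - p)) \<longlongrightarrow> C * norm (p - p)) F" by (intro tendsto_intros)
  then show ?thesis using C(2) by (intro Lim_null_comparison[of g]) auto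
qed

lemma vanishes_C1:
  fixes g :: "'a::euclidean_space \<Rightarrow> 'b::real_normed_vector"
  assumes "open S" "C_diff_on (Suc 0) S g" "p \<in> S" "F \<le> nhds p"
  shows "vanishes F p (Suc 0) (\<lambda>x. g x - g p)"
proof -
  obtain r K where rK: "r > 0" "K \<ge> 0"
    "\<And>x y. x \<in> cball p r \<Longrightarrow> y \<in> cball p r \<Longrightarrow> norm (g y - g x) \<le> K * norm (y - x)"
    using C1_locally_lipschitz[OF assms(1-3)] by metis
  have "\<forall>\<^sub>F x in nhds p. x \<in> ball p r" using rK(1) by (intro eventually_nhds_in_open) auto
  then have "\<forall>\<^sub>F x in F. x \<in> ball p r" using assms(4) filter_leD by blast
  then have "\<forall>\<^sub>F x in F. norm (g x - g p) \<le> K * norm (x - p) ^ Suc 0"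
    by (rule eventually_mono) (use rK in auto)
  then show ?thesis using rK(2) by (rule vanishesI[rotated])
qed

lemma vanishes_C2:
  fixes g :: "'a::euclidean_space \<Rightarrow> 'b::real_normed_vector"
  assumes "open S" "C_diff_on 2 S g" "p \<in> S" "F \<le> nhds p"
  shows "vanishes F p 2 (\<lambda>x. g x - g p - frechet_derivative g (at x) (x - p))"
proof -
  obtain r K where rK: "r > 0" "K \<ge> 0" "cball p r \<subseteq> S"
    "\<And>x y. x \<in> cball p r \<Longrightarrow> y \<in> cball p r \<Longrightarrow>
       norm (g y - g x - frechet_derivative g (at x) (y - x)) \<le> K * (norm (y - x))\<^sup>2"
    using C2_taylor[OF assms(1-3)] by metis
  have "\<forall>\<^sub>F x in nhds p. x \<in> ball p r" using rK(1) by (intro eventually_nhds_in_open) auto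
  then have "\<forall>\<^sub>F x in F. x \<in> ball p r" using assms(4) filter_leD by blast
  then have "\<forall>\<^sub>F x in F. norm (g x - g p - frechet_derivative g (at x) (x - p)) \<le> K * norm (x - p) ^ 2"
  proof eventually_elim
    case (elim x)
    then have x: "x \<in> cball p r" by auto
    then have "g differentiable (at x)" using assms(2) rK(3) by (auto simp: numeral_2_eq_2)
    then have "frechet_derivative g (at x) (p - x) = - frechet_derivative g (at x) (x - p)"
      using linear_neg[OF linear_frechet_derivative, of g "at x" "x - p"] by simp
    then have eq: "g x - g p - frechet_derivative g (at x) (x - p)
        = - (g p - g x - frechet_derivative g (at x) (p - x))" by simp
    have "norm (g p - g x - frechet_derivative g (at x) (p - x)) \<le> K * (norm (p - x))\<^sup>2"
      using x rK(1) by (intro rK(4)) auto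
    then show ?case unfolding eq by (simp only: norm_minus_cancel norm_minus_commute)
  qed
  then show ?thesis using rK(2) by (rule vanishesI[rotated])
qed


section \<open>Tangent spaces, projectors and the Weingarten map\<close>

text \<open>
  For small \<open>s\<close> the equation \<open>\<Psi> z = s *\<^sub>R w\<close> is a fixed point problem for \<open>z - \<Psi> z + s *\<^sub>R w\<close>, which maps
  a ball of radius \<open>\<bar>s\<bar>\<close> around \<open>x + s *\<^sub>R w\<close> into itself because \<open>\<Psi>\<close> is close to \<open>z - x\<close>; Brouwer's
  theorem provides a solution. Any solution within \<open>O(s)\<close> of \<open>x\<close> is automatically \<open>x + s *\<^sub>R w + o(s)\<close>, so the
  solutions may be chosen independently of each other and still form a curve with velocity \<open>w\<close>.
\<close>

lemma curve_through_level_set: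
  fixes \<Psi> :: "'a::euclidean_space \<Rightarrow> 'a"
  assumes U: "open U" "x \<in> U" and cont: "continuous_on U \<Psi>" and \<Psi>x: "\<Psi> x = 0"
    and deriv: "(\<Psi> has_derivative (\<lambda>h. h)) (at x)"
  obtains \<gamma> e where "e > 0" "\<And>s. \<bar>s\<bar> < e \<Longrightarrow> \<gamma> s \<in> U \<and> \<Psi> (\<gamma> s) = s *\<^sub>R w" "\<gamma> 0 = x"
    "(\<gamma> has_vector_derivative w) (at 0)"
proof -
  have approx: "\<exists>d>0. \<forall>y. norm (y - x) < d \<longrightarrow> norm (y - x - \<Psi> y) \<le> \<eta> * norm (y - x)" if "\<eta> > 0" for \<eta>
    using deriv that unfolding has_derivative_at_alt
    by (metis \<Psi>x diff_zero norm_minus_commute)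
  \<comment> \<open>\<open>q * \<bar>s\<bar>\<close> bounds the distance from \<open>x\<close> to the points of the ball of radius \<open>\<bar>s\<bar>\<close> around \<open>x + s *\<^sub>R w\<close>.\<close>
  define q where "q = norm w + 1"
  have q: "q > 0" unfolding q_def by (simp add: add_nonneg_pos)
  obtain d1 where d1: "d1 > 0" "\<And>y. norm (y - x) < d1 \<Longrightarrow> norm (y - x - \<Psi> y) \<le> 1 / q * norm (y - x)"
    using approx[of "1 / q"] q by auto
  obtain d2 where d2: "d2 > 0" "ball x d2 \<subseteq> U" using U open_contains_ball by blast
  define e where "e = min d1 d2 / q"
  have e: "e > 0" using d1 d2 q by (simp add: e_def)
  have sol: "\<exists>z\<in>U. \<Psi> z = s *\<^sub>R w \<and> norm (z - x) \<le> q * \<bar>s\<bar>" if s: "\<bar>s\<bar> < e" for s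
  proof -
    let ?D = "cball (x + s *\<^sub>R w) \<bar>s\<bar>"
    have close: "norm (z - x) \<le> q * \<bar>s\<bar>" if "z \<in> ?D" for z
    proof -
      have "norm (z - x) \<le> norm (z - (x + s *\<^sub>R w)) + norm (s *\<^sub>R w)"
        using norm_triangle_ineq[of "z - (x + s *\<^sub>R w)" "s *\<^sub>R w"] by simp
      also have "\<dots> \<le> \<bar>s\<bar> + \<bar>s\<bar> * norm w"
        using that by (simp add: dist_norm norm_minus_commute)
      finally show ?thesis by (simp add: q_def algebra_simps)
    qed
    have lt: "q * \<bar>s\<bar> < min d1 d2" using s q by (simp add: e_def field_simps)
    have sub: "?D \<subseteq> U"
    proof
      fix z assume "z \<in> ?D"
      then have "norm (z - x) < d2" using close lt by fastforce
      then show "z \<in> U" using d2(2) by (auto simp: dist_norm norm_minus_commute)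
    qed
    obtain z where z: "z \<in> ?D" "z - \<Psi> z + s *\<^sub>R w = z"
    proof (rule brouwer[of ?D "\<lambda>z. z - \<Psi> z + s *\<^sub>R w"])
      show "continuous_on ?D (\<lambda>z. z - \<Psi> z + s *\<^sub>R w)"
        by (intro continuous_intros continuous_on_subset[OF cont sub])
      show "(\<lambda>z. z - \<Psi> z + s *\<^sub>R w) \<in> ?D \<rightarrow> ?D"
      proof
        fix z assume z: "z \<in> ?D"
        have "norm (z - x) < d1" using close[OF z] lt by simp
        then have "norm (z - x - \<Psi> z) \<le> 1 / q * norm (z - x)" using d1(2) by blast
        also have "\<dots> \<le> 1 / q * (q * \<bar>s\<bar>)"
          using close[OF z] q by (intro mult_left_mono) auto
        also have "\<dots> = \<bar>s\<bar>" using q by simp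
        finally show "z - \<Psi> z + s *\<^sub>R w \<in> ?D"
          by (simp add: dist_norm norm_minus_commute algebra_simps)
      qed
    qed (use that in auto)
    then show ?thesis using close sub by (intro bexI[of _ z]) auto
  qed
  define \<gamma> where "\<gamma> s = (SOME z. z \<in> U \<and> \<Psi> z = s *\<^sub>R w \<and> norm (z - x) \<le> q * \<bar>s\<bar>)" for s
  have \<gamma>: "\<gamma> s \<in> U \<and> \<Psi> (\<gamma> s) = s *\<^sub>R w \<and> norm (\<gamma> s - x) \<le> q * \<bar>s\<bar>" if "\<bar>s\<bar> < e" for s
    unfolding \<gamma>_def by (rule someI_ex) (use sol[OF that] in blast)
  have \<gamma>0: "\<gamma> 0 = x" using \<gamma>[of 0] e by simp
  have "(\<gamma> has_vector_derivative w) (at 0)"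
    unfolding has_vector_derivative_def has_derivative_at_alt
  proof (intro conjI allI impI)
    show "bounded_linear (\<lambda>h. h *\<^sub>R w)" by (rule bounded_linear_scaleR_left)
    fix \<eta> :: real assume \<eta>: "\<eta> > 0"
    obtain d where d: "d > 0" "\<And>y. norm (y - x) < d \<Longrightarrow> norm (y - x - \<Psi> y) \<le> \<eta> / q * norm (y - x)"
      using approx[of "\<eta> / q"] q \<eta> by auto
    show "\<exists>d>0. \<forall>y. norm (y - 0) < d \<longrightarrow> norm (\<gamma> y - \<gamma> 0 - (y - 0) *\<^sub>R w) \<le> \<eta> * norm (y - 0)"
    proof (intro exI[of _ "min e (d / q)"] conjI allI impI)
      show "min e (d / q) > 0" using e d q by simp
      fix s :: real assume "norm (s - 0) < min e (d / q)"
      then have s: "\<bar>s\<bar> < e" "q * \<bar>s\<bar> < d" using q by (auto simp: field_simps)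
      note g = \<gamma>[OF s(1)]
      have "norm (\<gamma> s - x - s *\<^sub>R w) \<le> \<eta> / q * norm (\<gamma> s - x)"
        using d(2)[of "\<gamma> s"] g s(2) by simp
      also have "\<dots> \<le> \<eta> / q * (q * \<bar>s\<bar>)"
        using g \<eta> q by (intro mult_left_mono) auto
      finally show "norm (\<gamma> s - \<gamma> 0 - (s - 0) *\<^sub>R w) \<le> \<eta> * norm (s - 0)"
        using q \<gamma>0 by simp
    qed
  qed
  then show ?thesis using that[of e \<gamma>] e \<gamma> \<gamma>0 by blast
qed

text \<open>
  A right inverse \<open>G\<close> of the derivative \<open>A\<close> of \<open>c\<close> straightens the level set:
  \<open>\<Psi> z = (z - x) - G (A (z - x)) + G (c z)\<close> has the identity as derivative at \<open>x\<close>, and \<open>A (\<Psi> z) = c z\<close>, so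
  solutions of \<open>\<Psi> z = s *\<^sub>R w\<close> with \<open>A w = 0\<close> lie on \<open>c = 0\<close>.
\<close>

lemma tangent_space_eq_kernel:
  fixes c :: "real^'n \<Rightarrow> real^'d"
  assumes U: "open U" "x \<in> U" and MU: "\<M> \<inter> U = {y \<in> U. c y = 0}" and xM: "x \<in> \<M>"
    and diff: "\<And>y. y \<in> U \<Longrightarrow> c differentiable (at y)"
    and surj: "surj (frechet_derivative c (at x))"
  shows "tangent_space \<M> x = {w. frechet_derivative c (at x) w = 0}"
proof (intro equalityI subsetI CollectI)
  let ?A = "frechet_derivative c (at x)"
  have der: "(c has_derivative ?A) (at x)" using diff U(2) frechet_derivative_works by blast
  have cx: "c x = 0" using MU U(2) xM by blast
  {
    fix w assume "w \<in> tangent_space \<M> x"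
    then obtain \<gamma> e where g: "0 < e" "\<And>s. s \<in> {-e<..<e} \<Longrightarrow> \<gamma> s \<in> \<M>" "\<gamma> 0 = x"
      "(\<gamma> has_vector_derivative w) (at (0::real))"
      unfolding tangent_space_def by blast
    have "(c \<circ> \<gamma> has_vector_derivative ?A w) (at 0)"
    proof (rule vector_derivative_diff_chain_within[OF g(4), where g = c and g' = ?A])
      show "(c has_derivative ?A) (at (\<gamma> 0) within range \<gamma>)"
        unfolding g(3) by (rule has_derivative_at_withinI[OF der])
    qed
    moreover have "(c \<circ> \<gamma> has_vector_derivative 0) (at 0)"
    proof -
      have "isCont \<gamma> 0" using g(4) has_vector_derivative_continuous by blast
      then have "(\<gamma> \<longlongrightarrow> x) (nhds 0)"
        using isCont_tendsto_nhds g(3) by metis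
      then have "\<forall>\<^sub>F s in nhds 0. \<gamma> s \<in> U"
        using U by (rule topological_tendstoD)
      then have "\<forall>\<^sub>F s in nhds 0. c (\<gamma> s) = 0"
      proof (rule eventually_elim2[where Q="\<lambda>s. s \<in> {-e<..<e}"])
        show "\<forall>\<^sub>F s in nhds 0. s \<in> {-e<..<e}"
          using g(1) by (intro eventually_nhds_in_open) auto
        show "c (\<gamma> s) = 0" if "\<gamma> s \<in> U" "s \<in> {-e<..<e}" for s
          using g(2)[OF that(2)] that(1) MU by blast
      qed
      then obtain V where V: "open V" "0 \<in> V" "\<And>s. s \<in> V \<Longrightarrow> c (\<gamma> s) = 0"
        unfolding eventually_nhds by blast
      show ?thesis
        by (rule has_vector_derivative_transform_within_open[OF has_vector_derivative_const[of 0] V(1,2)])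
          (simp add: V(3))
    qed
    ultimately show "?A w = 0" by (rule vector_derivative_unique_at)
  next
    fix w assume "w \<in> {w. ?A w = 0}"
    then have w: "?A w = 0" by simp
    have linA: "linear ?A" using der has_derivative_linear by blast
    obtain G where G: "linear G" "?A \<circ> G = id"
      using linear_surjective_right_inverse[OF linA surj] by blast
    have G': "?A (G z) = z" for z using G(2) by (metis comp_apply id_apply)
    let ?\<Psi> = "\<lambda>z. (z - x) - G (?A (z - x)) + G (c z)"
    have blG: "bounded_linear G" and blA: "bounded_linear ?A"
      using G(1) linA linear_conv_bounded_linear by blast+
    have contc: "continuous_on U c"
      using diff by (simp add: continuous_at_imp_continuous_on differentiable_imp_continuous_within)
    obtain \<gamma> e where g: "e > 0" "\<And>s. \<bar>s\<bar> < e \<Longrightarrow> \<gamma> s \<in> U \<and> ?\<Psi> (\<gamma> s) = s *\<^sub>R w" "\<gamma> 0 = x"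
      "(\<gamma> has_vector_derivative w) (at 0)"
    proof (rule curve_through_level_set[OF U, of ?\<Psi>])
      show "continuous_on U ?\<Psi>"
        by (intro continuous_intros bounded_linear.continuous_on[OF blG] bounded_linear.continuous_on[OF blA] contc)
      show "?\<Psi> x = 0" using cx linear_0[OF G(1)] linear_0[OF linA] by simp
      have "(?\<Psi> has_derivative (\<lambda>h. (h - 0) - G (?A (h - 0)) + G (?A h))) (at x)"
        by (intro derivative_intros bounded_linear.has_derivative[OF blG] bounded_linear.has_derivative[OF blA] der)
      then show "(?\<Psi> has_derivative (\<lambda>h. h)) (at x)" by simp
    qed (use that in auto)
    have "c (\<gamma> s) = 0" if "\<bar>s\<bar> < e" for s
    proof -
      have "?A (?\<Psi> (\<gamma> s)) = ?A (s *\<^sub>R w)" using g(2)[OF that] by simp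
      then show ?thesis
        using w by (simp add: linear_add[OF linA] linear_diff[OF linA] linear_cmul[OF linA] G')
    qed
    then have "\<gamma> s \<in> \<M>" if "s \<in> {-e<..<e}" for s
      using that g(2)[of s] MU by (auto simp: abs_less_iff)
    then show "w \<in> tangent_space \<M> x"
      unfolding tangent_space_def using g(1,3,4) by blast
  }
qed

lemma submanifold_chart:
  fixes \<M> :: "(real^'n) set"
  assumes "embedded_submanifold TYPE('d::finite) \<M>" "p \<in> \<M>"
  obtains U and c :: "real^'n \<Rightarrow> real^'d"
  where "open U" "p \<in> U" "C_diff_on 2 U c" "\<M> \<inter> U = {y \<in> U. c y = 0}"
    "\<And>y. y \<in> U \<Longrightarrow> c differentiable (at y)"
    "\<And>y. y \<in> \<M> \<inter> U \<Longrightarrow> surj (frechet_derivative c (at y))"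
    "\<And>y. y \<in> \<M> \<inter> U \<Longrightarrow> tangent_space \<M> y = {w. frechet_derivative c (at y) w = 0}"
proof -
  have "\<exists>U (c :: real^'n \<Rightarrow> real^'d). p \<in> U \<and> smooth_on_open U c \<and> \<M> \<inter> U = {y\<in>U. c y = 0} \<and>
     (\<forall>y\<in>\<M> \<inter> U. surj (frechet_derivative c (at y)))"
    using assms(1)[unfolded embedded_submanifold_def] assms(2) by (rule bspec)
  then obtain U and c :: "real^'n \<Rightarrow> real^'d" where c: "p \<in> U" "smooth_on_open U c"
    "\<M> \<inter> U = {y\<in>U. c y = 0}" "\<forall>y\<in>\<M> \<inter> U. surj (frechet_derivative c (at y))"
    by (elim exE conjE)
  have U: "open U" and C2: "C_diff_on 2 U c" using c(2) unfolding smooth_on_open_def by blast+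
  have diff: "\<And>y. y \<in> U \<Longrightarrow> c differentiable (at y)"
    using C2 by (simp add: numeral_2_eq_2)
  show ?thesis
  proof (rule that[OF U c(1) C2 c(3) diff])
    fix y assume y: "y \<in> \<M> \<inter> U"
    show surj: "surj (frechet_derivative c (at y))" using c(4) y by blast
    show "tangent_space \<M> y = {w. frechet_derivative c (at y) w = 0}"
      using y by (intro tangent_space_eq_kernel[OF U _ c(3) _ diff surj]) auto
  qed
qed

lemma subspace_tangent_space:
  fixes \<M> :: "(real^'n) set"
  assumes "embedded_submanifold TYPE('d::finite) \<M>" "x \<in> \<M>"
  shows "subspace (tangent_space \<M> x)"
proof -
  obtain U and c :: "real^'n \<Rightarrow> real^'d"
    where "x \<in> U" "\<And>y. y \<in> U \<Longrightarrow> c differentiable (at y)"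
    "\<And>y. y \<in> \<M> \<inter> U \<Longrightarrow> tangent_space \<M> y = {w. frechet_derivative c (at y) w = 0}"
    using submanifold_chart[OF assms] by metis
  then show ?thesis
    using assms(2) by (simp add: linear_frechet_derivative linear_subspace_kernel)
qed

lemma normal_space_iff: "u \<in> normal_space \<M> x \<longleftrightarrow> (\<forall>w\<in>tangent_space \<M> x. w \<bullet> u = 0)"
  by (simp add: normal_space_def orthogonal_comp_def orthogonal_def)

lemma Proj_eqI:
  assumes T: "subspace (tangent_space \<M> x)"
    and Q: "\<And>z. Q *v z \<in> tangent_space \<M> x" "\<And>z. z - Q *v z \<in> normal_space \<M> x"
  shows "Proj \<M> x = Q"
proof -
  have "(THE p. p \<in> tangent_space \<M> x \<and> z - p \<in> normal_space \<M> x) = Q *v z" for z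
  proof (rule the_equality)
    fix p assume p: "p \<in> tangent_space \<M> x \<and> z - p \<in> normal_space \<M> x"
    have t: "p - Q *v z \<in> tangent_space \<M> x" using p Q(1) subspace_diff[OF T] by blast
    have "(p - Q *v z) \<bullet> (p - Q *v z) = (p - Q *v z) \<bullet> (z - Q *v z) - (p - Q *v z) \<bullet> (z - p)"
      by (simp add: inner_diff_right inner_diff_left)
    also have "\<dots> = 0" using t p Q(2)[of z] unfolding normal_space_iff by simp
    finally show "p = Q *v z" by simp
  qed (use Q in blast)
  then show ?thesis unfolding Proj_def by (simp add: matrix_of_matrix_vector_mul)
qed

lemma inner_transpose: "(A *v x) \<bullet> y = x \<bullet> (transpose A *v y)" for A :: "real^'n^'m"
  by (metis dot_lmul_matrix inner_commute transpose_matrix_vector)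

definition derivative_matrix :: "(real^'n \<Rightarrow> real^'d) \<Rightarrow> real^'n \<Rightarrow> real^'n^'d" where
  "derivative_matrix c y = matrix (frechet_derivative c (at y))"

lemma derivative_matrix_works:
  "c differentiable (at y) \<Longrightarrow> derivative_matrix c y *v w = frechet_derivative c (at y) w"
  unfolding derivative_matrix_def by (simp add: linear_frechet_derivative)

lemma invertible_gram:
  fixes A :: "real^'n^'d"
  assumes "surj ((*v) A)"
  shows "invertible (A ** transpose A)"
proof -
  have "y = 0" if "(A ** transpose A) *v y = 0" for y
  proof -
    have "(transpose A *v y) \<bullet> (transpose A *v y) = ((A ** transpose A) *v y) \<bullet> y"
      by (simp add: inner_transpose matrix_vector_mul_assoc[symmetric])
    then have z: "transpose A *v y = 0" using that by simp
    obtain x where x: "y = A *v x" using assms by (metis surjD)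
    then have "y \<bullet> y = x \<bullet> (transpose A *v y)" by (metis inner_transpose)
    then show ?thesis using z by simp
  qed
  then show ?thesis
    by (metis invertible_left_inverse matrix_left_invertible_ker)
qed

text \<open>
  This is the usual least squares formula for the orthogonal projector onto a kernel. It expresses the projector
  through the derivative of the defining function and so transfers smoothness to it.
\<close>

lemma Proj_from_chart:
  fixes c :: "real^'n \<Rightarrow> real^'d"
  assumes T: "tangent_space \<M> y = {w. frechet_derivative c (at y) w = 0}"
    and diff: "c differentiable (at y)" and surj: "surj (frechet_derivative c (at y))"
  defines "A \<equiv> derivative_matrix c y"
  shows "invertible (A ** transpose A)"
    and "Proj \<M> y = mat 1 - transpose A ** matrix_inv (A ** transpose A) ** A"
proof -
  have A: "A *v w = frechet_derivative c (at y) w" for w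
    unfolding A_def by (rule derivative_matrix_works[OF diff])
  have "surj ((*v) A)" using surj A by (simp add: fun_eq_iff[symmetric] ext)
  then show inv: "invertible (A ** transpose A)" by (rule invertible_gram)
  show "Proj \<M> y = mat 1 - transpose A ** matrix_inv (A ** transpose A) ** A"
  proof (rule Proj_eqI)
    show "subspace (tangent_space \<M> y)"
      unfolding T by (rule linear_subspace_kernel[OF linear_frechet_derivative[OF diff]])
    fix z :: "real^'n"
    let ?z = "matrix_inv (A ** transpose A) *v (A *v z)"
    have Q: "(mat 1 - transpose A ** matrix_inv (A ** transpose A) ** A) *v z = z - transpose A *v ?z"
      by (simp add: matrix_vector_mult_diff_rdistrib matrix_vector_mul_assoc matrix_mul_assoc)
    have "A *v (transpose A *v ?z) = A *v z"
      by (simp add: matrix_vector_mul_assoc matrix_inv_inverse(2)[OF inv] matrix_mul_assoc)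
    then show "(mat 1 - transpose A ** matrix_inv (A ** transpose A) ** A) *v z \<in> tangent_space \<M> y"
      unfolding Q T by (simp add: A[symmetric] matrix_vector_mult_diff_distrib)
    show "z - (mat 1 - transpose A ** matrix_inv (A ** transpose A) ** A) *v z \<in> normal_space \<M> y"
      unfolding Q normal_space_iff T by (auto simp: inner_transpose[symmetric] A)
  qed
qed

lemma derivative_matrix_differentiable:
  fixes c :: "real^'n \<Rightarrow> real^'d"
  assumes "C_diff_on 2 U c" "y \<in> U"
  shows "derivative_matrix c differentiable (at y)"
proof -
  have "(\<lambda>y. \<chi> i j. frechet_derivative c (at y) (axis j 1) $ i) differentiable (at y)"
  proof (intro differentiable_vec_lambda)
    fix i j
    have "(\<lambda>y. frechet_derivative c (at y) (axis j 1)) differentiable (at y)"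
      using assms by (simp add: numeral_2_eq_2)
    then show "(\<lambda>y. frechet_derivative c (at y) (axis j 1) $ i) differentiable (at y)"
      using differentiable_compose[OF bounded_linear_imp_differentiable[OF bounded_linear_vec_nth]]
      by blast
  qed
  then show ?thesis unfolding derivative_matrix_def matrix_def .
qed

lemma differentiable_matrix_mult:
  fixes A :: "'a::real_normed_vector \<Rightarrow> real^'n^'m"
  assumes "A differentiable (at x within S)" "B differentiable (at x within S)"
  shows "(\<lambda>x. A x ** B x) differentiable (at x within S)"
  using assms bounded_bilinear.FDERIV[OF bounded_bilinear_matrix_matrix]
  unfolding differentiable_def by blast

lemma right_inverse_matrix_differentiable:
  fixes c :: "real^'n \<Rightarrow> real^'d"
  assumes c: "C_diff_on 2 U c" "p \<in> U"
    and inv: "invertible (derivative_matrix c p ** transpose (derivative_matrix c p))"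
  shows "(\<lambda>y. transpose (derivative_matrix c y) **
    matrix_inv (derivative_matrix c y ** transpose (derivative_matrix c y))) differentiable (at p)"
proof -
  let ?A = "derivative_matrix c"
  have A: "?A differentiable (at p)" by (rule derivative_matrix_differentiable[OF c])
  then have At: "(\<lambda>y. transpose (?A y)) differentiable (at p)"
    using bounded_linear.has_derivative[OF bounded_linear_transpose] unfolding differentiable_def by blast
  have "(\<lambda>y. matrix_inv (?A y ** transpose (?A y))) differentiable (at p)"
    by (rule differentiable_compose[OF differentiable_matrix_inv], rule inv,
        intro differentiable_matrix_mult A At)
  then show ?thesis by (intro differentiable_matrix_mult At)
qed

lemma Proj_differentiable:
  fixes \<M> :: "(real^'n) set"
  assumes sub: "embedded_submanifold TYPE('d::finite) \<M>" and p: "p \<in> \<M>"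
  shows "Proj \<M> differentiable (at p within \<M>)"
proof -
  obtain U and c :: "real^'n \<Rightarrow> real^'d"
  where c: "open U" "p \<in> U" "C_diff_on 2 U c" "\<M> \<inter> U = {y \<in> U. c y = 0}"
    "\<And>y. y \<in> U \<Longrightarrow> c differentiable (at y)"
    "\<And>y. y \<in> \<M> \<inter> U \<Longrightarrow> surj (frechet_derivative c (at y))"
    "\<And>y. y \<in> \<M> \<inter> U \<Longrightarrow> tangent_space \<M> y = {w. frechet_derivative c (at y) w = 0}"
    by (rule submanifold_chart[OF sub p]) (rule that)
  let ?A = "derivative_matrix c"
  note PC = Proj_from_chart[OF c(7) c(5) c(6)]
  have "invertible (?A p ** transpose (?A p))" using PC(1) p c(2) by blast
  note S = right_inverse_matrix_differentiable[OF c(3,2) this]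
  have "(\<lambda>y. mat 1 - transpose (?A y) ** matrix_inv (?A y ** transpose (?A y)) ** ?A y) differentiable (at p)"
    by (intro differentiable_diff differentiable_const differentiable_matrix_mult[OF S]
        derivative_matrix_differentiable[OF c(3,2)])
  then obtain D where "((\<lambda>y. mat 1 - transpose (?A y) ** matrix_inv (?A y ** transpose (?A y)) ** ?A y)
     has_derivative D) (at p within \<M>)"
    unfolding differentiable_def using has_derivative_at_withinI by blast
  moreover obtain d where "d > 0" "ball p d \<subseteq> U" using c(1,2) open_contains_ball by blast
  ultimately have "(Proj \<M> has_derivative D) (at p within \<M>)"
    by (elim has_derivative_transform_within[where d=d]) (use p PC in \<open>auto simp: dist_commute subset_iff\<close>)
  then show ?thesis unfolding differentiable_def by blast
qed

text \<open>
  The normal part of \<open>x - p\<close> is \<open>S (A (x - p))\<close> with \<open>S\<close> bounded near \<open>p\<close>, and \<open>A (x - p)\<close> is the Taylor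
  remainder of \<open>c\<close>, because \<open>c\<close> vanishes at both points.
\<close>

lemma secant_almost_tangent:
  fixes \<M> :: "(real^'n) set"
  assumes sub: "embedded_submanifold TYPE('d::finite) \<M>" and p: "p \<in> \<M>"
  obtains K where "K \<ge> 0"
    "\<forall>\<^sub>F x in nhds p. x \<in> \<M> \<longrightarrow> norm ((x - p) - Proj \<M> x *v (x - p)) \<le> K * (norm (x - p))\<^sup>2"
proof -
  obtain U and c :: "real^'n \<Rightarrow> real^'d"
  where c: "open U" "p \<in> U" "C_diff_on 2 U c" "\<M> \<inter> U = {y \<in> U. c y = 0}"
    "\<And>y. y \<in> U \<Longrightarrow> c differentiable (at y)"
    "\<And>y. y \<in> \<M> \<inter> U \<Longrightarrow> surj (frechet_derivative c (at y))"
    "\<And>y. y \<in> \<M> \<inter> U \<Longrightarrow> tangent_space \<M> y = {w. frechet_derivative c (at y) w = 0}"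
    by (rule submanifold_chart[OF sub p]) (rule that)
  let ?A = "derivative_matrix c"
  let ?S = "\<lambda>y. transpose (?A y) ** matrix_inv (?A y ** transpose (?A y))"
  note PC = Proj_from_chart[OF c(7) c(5) c(6)]
  have "invertible (?A p ** transpose (?A p))" using PC(1) p c(2) by blast
  then have "?S differentiable (at p)" by (rule right_inverse_matrix_differentiable[OF c(3,2)])
  then have "isCont ?S p" by (rule differentiable_imp_continuous_within)
  then have "(?S \<longlongrightarrow> ?S p) (nhds p)"
    by (rule isCont_tendsto_nhds)
  then have ev1: "\<forall>\<^sub>F y in nhds p. norm (?S y) < norm (?S p) + 1"
    by (intro order_tendstoD(2)[OF tendsto_norm]) auto
  obtain r K where rK: "r > 0" "K \<ge> 0" "cball p r \<subseteq> U"
    "\<And>x y. x \<in> cball p r \<Longrightarrow> y \<in> cball p r \<Longrightarrow>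
       norm (c y - c x - frechet_derivative c (at x) (y - x)) \<le> K * (norm (y - x))\<^sup>2"
    using C2_taylor[OF c(1,3,2)] by metis
  obtain Kb where Kb: "Kb > 0" "\<And>(X :: real^'d^'n) z. norm (X *v z) \<le> norm X * norm z * Kb"
    using bounded_bilinear.pos_bounded[OF bounded_bilinear_matrix_vector] by metis
  have ev2: "\<forall>\<^sub>F y in nhds p. y \<in> ball p r"
    using rK(1) by (intro eventually_nhds_in_open) auto
  have "\<forall>\<^sub>F x in nhds p. x \<in> \<M> \<longrightarrow>
     norm ((x - p) - Proj \<M> x *v (x - p)) \<le> ((norm (?S p) + 1) * K * Kb) * (norm (x - p))\<^sup>2"
    using ev1 ev2
  proof eventually_elim
    case (elim x)
    show ?case
    proof
      assume xM: "x \<in> \<M>"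
      have "x \<in> U" using elim(2) rK(3) ball_subset_cball by blast
      then have xU: "x \<in> \<M> \<inter> U" using xM by blast
      have pc: "c p = 0" "c x = 0" using xU c(2,4) p by blast+
      have "(x - p) - Proj \<M> x *v (x - p) = ?S x *v (?A x *v (x - p))"
        using PC(2)[of x] xU
        by (simp add: matrix_vector_mult_diff_rdistrib matrix_vector_mul_assoc)
      also have "?A x *v (x - p) = c p - c x - frechet_derivative c (at x) (p - x)"
        using pc linear_neg[OF linear_frechet_derivative[OF c(5)], of x "x - p"] xU
        by (simp add: derivative_matrix_works[OF c(5)])
      also have "norm (?S x *v (c p - c x - frechet_derivative c (at x) (p - x)))
        \<le> norm (?S x) * norm (c p - c x - frechet_derivative c (at x) (p - x)) * Kb" by (rule Kb)
      also have "\<dots> \<le> (norm (?S p) + 1) * (K * (norm (p - x))\<^sup>2) * Kb"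
        using elim rK(1) by (intro mult_mono rK(4)) (auto simp: Kb less_imp_le rK)
      finally show "norm ((x - p) - Proj \<M> x *v (x - p)) \<le> ((norm (?S p) + 1) * K * Kb) * (norm (x - p))\<^sup>2"
        by (simp add: norm_minus_commute mult_ac)
    qed
  qed
  then show ?thesis using that[of "(norm (?S p) + 1) * K * Kb"] rK Kb by simp
qed

text \<open>
  A derivative within \<open>\<M>\<close> is unique only on tangent vectors, where it is the derivative along a curve.
  Any convenient derivative of the projector therefore computes the Weingarten map.
\<close>

lemma Weingarten_eq:
  fixes \<M> :: "(real^'n) set"
  assumes D: "(Proj \<M> has_derivative D) (at x within \<M>)" and w: "w \<in> tangent_space \<M> x"
  shows "Weingarten \<M> x w u = D w *v u"
proof -
  obtain \<gamma> e where g: "0 < e" "\<And>s. s \<in> {-e<..<e} \<Longrightarrow> \<gamma> s \<in> \<M>" "\<gamma> 0 = x"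
    "(\<gamma> has_vector_derivative w) (at (0::real))"
    using w unfolding tangent_space_def by blast
  have *: "(Proj \<M> \<circ> \<gamma> has_vector_derivative E w) (at 0)"
    if E: "(Proj \<M> has_derivative E) (at x within \<M>)" for E
  proof -
    have "(Proj \<M> \<circ> \<gamma> has_vector_derivative E w) (at 0 within {-e<..<e})"
    proof (rule vector_derivative_diff_chain_within[where g = "Proj \<M>" and g' = E])
      show "(\<gamma> has_vector_derivative w) (at 0 within {-e<..<e})"
        using g(4) has_vector_derivative_at_within by blast
      show "(Proj \<M> has_derivative E) (at (\<gamma> 0) within \<gamma> ` {-e<..<e})"
        unfolding g(3) using E by (rule has_derivative_subset) (use g(2) in auto)
    qed
    then show ?thesis using at_within_open[of 0 "{-e<..<e}"] g(1) by simp
  qed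
  have "(Proj \<M> has_derivative frechet_derivative (Proj \<M>) (at x within \<M>)) (at x within \<M>)"
    using D frechet_derivative_works differentiableI by blast
  then show ?thesis unfolding Weingarten_def
    using vector_derivative_unique_at[OF * *[OF D]] by simp
qed

lemma orthonormal_frame_facts:
  fixes b :: "real^'d^'n"
  assumes T: "subspace (tangent_space \<M> x)" and b: "orthonormal_normal_frame \<M> x b"
  shows "transpose b ** b = mat 1"
    and "tangent_space \<M> x = {w. transpose b *v w = 0}"
    and "Proj \<M> x = mat 1 - b ** transpose b"
proof -
  show bb: "transpose b ** b = mat 1" using b unfolding orthonormal_normal_frame_def by blast
  have sp: "span (columns b) = normal_space \<M> x" using b unfolding orthonormal_normal_frame_def by blast
  have range: "b *v y \<in> normal_space \<M> x" for y
    using matrix_vector_mult_in_columnspace[of b y] sp by (simp add: span_vec_eq)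
  have "tangent_space \<M> x = (normal_space \<M> x)\<^sup>\<bottom>"
    unfolding normal_space_def by (rule orthogonal_comp_self[OF T, symmetric])
  also have "\<dots> = {w. transpose b *v w = 0}"
  proof (intro equalityI subsetI CollectI)
    fix w assume "w \<in> (normal_space \<M> x)\<^sup>\<bottom>"
    then have "(b *v (transpose b *v w)) \<bullet> w = 0"
      using range by (auto simp: orthogonal_comp_def orthogonal_def)
    then have "(transpose b *v w) \<bullet> (transpose b *v w) = 0" by (simp add: inner_transpose)
    then show "transpose b *v w = 0" by simp
  next
    fix w assume w: "w \<in> {w. transpose b *v w = 0}"
    have "orthogonal w u" if "u \<in> span (columns b)" for u
    proof (rule orthogonal_to_span[OF that])
      fix a assume "a \<in> columns b"
      then obtain i where "a = b *v axis i 1"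
        by (auto simp: columns_def matrix_vector_mult_basis)
      then show "orthogonal w a"
        using w by (simp add: orthogonal_def inner_commute[of w] inner_transpose)
    qed
    then show "w \<in> (normal_space \<M> x)\<^sup>\<bottom>"
      unfolding orthogonal_comp_def sp[symmetric] by (simp add: orthogonal_commute)
  qed
  finally show TK: "tangent_space \<M> x = {w. transpose b *v w = 0}" .
  show "Proj \<M> x = mat 1 - b ** transpose b"
  proof (rule Proj_eqI[OF T])
    fix z
    show "(mat 1 - b ** transpose b) *v z \<in> tangent_space \<M> x"
      unfolding TK by (simp add: matrix_vector_mult_diff_rdistrib matrix_vector_mult_diff_distrib
          matrix_vector_mul_assoc matrix_mul_assoc bb)
    show "z - (mat 1 - b ** transpose b) *v z \<in> normal_space \<M> x"
      using range by (simp add: matrix_vector_mult_diff_rdistrib matrix_vector_mul_assoc[symmetric])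
  qed
qed

lemma Proj_facts:
  fixes \<M> :: "(real^'n) set"
  assumes "embedded_submanifold TYPE('d::finite) \<M>" "x \<in> \<M>"
  shows "Proj \<M> x *v z \<in> tangent_space \<M> x"
    and "w \<in> tangent_space \<M> x \<Longrightarrow> Proj \<M> x *v w = w"
proof -
  obtain U and c :: "real^'n \<Rightarrow> real^'d"
  where c: "open U" "x \<in> U" "C_diff_on 2 U c" "\<M> \<inter> U = {y \<in> U. c y = 0}"
    "\<And>y. y \<in> U \<Longrightarrow> c differentiable (at y)"
    "\<And>y. y \<in> \<M> \<inter> U \<Longrightarrow> surj (frechet_derivative c (at y))"
    "\<And>y. y \<in> \<M> \<inter> U \<Longrightarrow> tangent_space \<M> y = {w. frechet_derivative c (at y) w = 0}"
    by (rule submanifold_chart[OF assms]) (rule that)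
  have x: "x \<in> \<M> \<inter> U" using c(2) assms(2) by blast
  note PC = Proj_from_chart[OF c(7)[OF x] c(5)[OF c(2)] c(6)[OF x]]
  let ?A = "derivative_matrix c x"
  have A: "tangent_space \<M> x = {w. ?A *v w = 0}"
    unfolding c(7)[OF x] by (simp add: derivative_matrix_works[OF c(5)[OF c(2)]])
  show "w \<in> tangent_space \<M> x \<Longrightarrow> Proj \<M> x *v w = w"
    unfolding PC(2) A by (simp add: matrix_vector_mult_diff_rdistrib matrix_vector_mul_assoc[symmetric])
  have "?A ** (transpose ?A ** matrix_inv (?A ** transpose ?A) ** ?A) = ?A"
    by (simp add: matrix_mul_assoc matrix_inv_inverse(2)[OF PC(1)])
  then show "Proj \<M> x *v z \<in> tangent_space \<M> x"
    unfolding PC(2) A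
    by (simp add: matrix_vector_mult_diff_rdistrib matrix_vector_mult_diff_distrib)
      (simp add: matrix_vector_mul_assoc)
qed


section \<open>Retractions\<close>

text \<open>
  Near \<open>(p, 0)\<close> the retraction is the restriction of a smooth map \<open>g\<close> on the ambient space. Its derivative at
  \<open>(x, 0)\<close> in a tangent direction \<open>(0, u)\<close> can be read off along the line \<open>s *\<^sub>R u\<close>, which stays in the
  tangent space, so it equals \<open>u\<close>; Taylor's formula for \<open>g\<close> then has constants uniform in \<open>x\<close>.
\<close>

lemma retraction_second_order:
  fixes \<M> :: "(real^'n) set"
  assumes R: "global_retraction \<M> R" and p: "p \<in> \<M>"
    and T: "\<And>x. x \<in> \<M> \<Longrightarrow> subspace (tangent_space \<M> x)"
  obtains r K where "r > 0" "K \<ge> 0"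
    "\<And>x u. x \<in> \<M> \<Longrightarrow> u \<in> tangent_space \<M> x \<Longrightarrow> norm (x - p) < r \<Longrightarrow> norm u < r \<Longrightarrow>
       norm (R x u - x - u) \<le> K * (norm u)\<^sup>2"
proof -
  have "(p, 0) \<in> tangent_bundle \<M>"
    using p T[OF p] subspace_0 by (auto simp: tangent_bundle_def)
  then obtain W g where W: "(p, 0) \<in> W" "smooth_on_open W g"
    "\<And>z. z \<in> W \<inter> tangent_bundle \<M> \<Longrightarrow> g z = (\<lambda>(x, w). R x w) z"
    using R unfolding global_retraction_def smooth_map_on_def by blast
  have oW: "open W" and C2: "C_diff_on 2 W g" using W(2) unfolding smooth_on_open_def by blast+
  obtain r K where rK: "r > 0" "K \<ge> 0" "cball (p, 0) r \<subseteq> W"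
    "\<And>x y. x \<in> cball (p, 0) r \<Longrightarrow> y \<in> cball (p, 0) r \<Longrightarrow>
       norm (g y - g x - frechet_derivative g (at x) (y - x)) \<le> K * (norm (y - x))\<^sup>2"
    using C2_taylor[OF oW C2 W(1)] by metis
  have "norm (R x u - x - u) \<le> K * (norm u)\<^sup>2"
    if x: "x \<in> \<M>" and u: "u \<in> tangent_space \<M> x" and nx: "norm (x - p) < r / 2" and nu: "norm u < r / 2"
    for x u
  proof -
    have inball: "(x, s *\<^sub>R u) \<in> cball (p, 0) r" if "\<bar>s\<bar> \<le> 1" for s
    proof -
      have "norm (s *\<^sub>R u) \<le> norm u" using that by (simp add: mult_left_le_one_le)
      moreover have "norm ((x, s *\<^sub>R u) - (p, 0)) \<le> norm (x - p) + norm (s *\<^sub>R u)"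
        by (simp add: norm_Pair sqrt_sum_squares_le_sum)
      ultimately have "norm ((x, s *\<^sub>R u) - (p, 0)) \<le> r" using nx nu by linarith
      then show ?thesis by (simp only: mem_cball dist_norm norm_minus_commute)
    qed
    have gR: "g (x, s *\<^sub>R u) = R x (s *\<^sub>R u)" if "\<bar>s\<bar> \<le> 1" for s
      using W(3)[of "(x, s *\<^sub>R u)"] inball[OF that] rK(3) x subspace_scale[OF T[OF x] u]
      by (auto simp: tangent_bundle_def)
    have R0: "R x 0 = x" and dR: "(R x has_derivative (\<lambda>w. w)) (at 0 within tangent_space \<M> x)"
      using R x unfolding global_retraction_def by blast+
    have line: "((\<lambda>s::real. s *\<^sub>R u) has_vector_derivative u) (at 0)"
      by (auto intro!: derivative_eq_intros)
    have "(R x \<circ> (\<lambda>s. s *\<^sub>R u) has_vector_derivative u) (at 0)"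
    proof (rule vector_derivative_diff_chain_within[OF line, where g = "R x" and g' = "\<lambda>w. w"])
      show "(R x has_derivative (\<lambda>w. w)) (at (0 *\<^sub>R u) within range (\<lambda>s::real. s *\<^sub>R u))"
        by simp (rule has_derivative_subset[OF dR], use subspace_scale[OF T[OF x] u] in auto)
    qed
    then have 1: "(g \<circ> (\<lambda>s. (x, s *\<^sub>R u)) has_vector_derivative u) (at 0)"
      by (rule has_vector_derivative_transform_within_open[where S = "{-1<..<1}"]) (auto simp: gR abs_le_iff)
    have "(x, 0) \<in> W" using inball[of 0] rK(3) by auto
    then have dg: "(g has_derivative frechet_derivative g (at (x, 0))) (at (x, 0))"
      using C2 by (simp add: numeral_2_eq_2 frechet_derivative_works)
    have line2: "((\<lambda>s::real. (x, s *\<^sub>R u)) has_vector_derivative (0, u)) (at 0)"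
      by (intro has_vector_derivative_Pair has_vector_derivative_const line)
    have "(g \<circ> (\<lambda>s. (x, s *\<^sub>R u)) has_vector_derivative frechet_derivative g (at (x, 0)) (0, u)) (at 0)"
      by (rule vector_derivative_diff_chain_within[OF line2, where g = g and
            g' = "frechet_derivative g (at (x, 0))"]) (simp add: has_derivative_at_withinI[OF dg])
    then have eq: "frechet_derivative g (at (x, 0)) (0, u) = u"
      using 1 by (rule vector_derivative_unique_at)
    have "norm (g (x, u) - g (x, 0) - frechet_derivative g (at (x, 0)) ((x, u) - (x, 0)))
        \<le> K * (norm ((x, u) - (x, 0)))\<^sup>2"
      using inball[of 0] inball[of 1] by (intro rK(4)) auto
    then show ?thesis using gR[of 0] gR[of 1] R0 eq by simp
  qed
  then show ?thesis using that[of "r / 2" K] rK by auto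
qed


section \<open>The proximal direction\<close>

lemma l1_norm_lipschitz: "\<bar>l1_norm x - l1_norm y\<bar> \<le> CARD('n) * norm (x - y)" for x y :: "real^'n"
proof -
  have "\<bar>l1_norm x - l1_norm y\<bar> \<le> (\<Sum>i\<in>UNIV. \<bar>\<bar>x $ i\<bar> - \<bar>y $ i\<bar>\<bar>)"
    unfolding l1_norm_def sum_subtractf[symmetric] by (rule sum_abs)
  also have "\<dots> \<le> (\<Sum>i\<in>(UNIV :: 'n set). norm (x - y))"
  proof (rule sum_mono)
    fix i
    have "\<bar>\<bar>x $ i\<bar> - \<bar>y $ i\<bar>\<bar> \<le> \<bar>(x - y) $ i\<bar>" by (simp add: abs_triangle_ineq3)
    also have "\<dots> \<le> norm (x - y)" by (rule component_le_norm_cart)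
    finally show "\<bar>\<bar>x $ i\<bar> - \<bar>y $ i\<bar>\<bar> \<le> norm (x - y)" .
  qed
  finally show ?thesis by simp
qed

lemma l1_norm_convex:
  assumes "0 \<le> s" "s \<le> 1"
  shows "l1_norm ((1 - s) *\<^sub>R x + s *\<^sub>R y) \<le> (1 - s) * l1_norm x + s * l1_norm y"
proof -
  have "\<bar>(1 - s) * a + s * b\<bar> \<le> (1 - s) * \<bar>a\<bar> + s * \<bar>b\<bar>" for a b :: real
    using abs_triangle_ineq[of "(1 - s) * a" "s * b"] assms by (simp add: abs_mult)
  then show ?thesis
    unfolding l1_norm_def by (simp add: sum_distrib_left sum.distrib[symmetric] sum_mono)
qed

lemma continuous_on_l1_norm [continuous_intros]:
  "continuous_on S g \<Longrightarrow> continuous_on S (\<lambda>z. l1_norm (g z))"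
  unfolding l1_norm_def by (intro continuous_intros)

lemma tendsto_l1_norm [tendsto_intros]: "(g \<longlongrightarrow> a) F \<Longrightarrow> ((\<lambda>z. l1_norm (g z)) \<longlongrightarrow> l1_norm a) F"
  unfolding l1_norm_def by (intro tendsto_intros)

definition prox_model :: "(real^'n \<Rightarrow> real) \<Rightarrow> real \<Rightarrow> real \<Rightarrow> real^'n \<Rightarrow> real^'n \<Rightarrow> real" where
  "prox_model f \<mu> t x v = f x + grad f x \<bullet> v + 1 / (2 * t) * (norm v)\<^sup>2 + \<mu> * l1_norm (x + v)"

lemma prox_model_attains_min:
  fixes x :: "real^'n"
  assumes T: "subspace T" and t: "t > 0" and \<mu>: "\<mu> > 0"
  shows "\<exists>v\<in>T. \<forall>w\<in>T. prox_model f \<mu> t x v \<le> prox_model f \<mu> t x w"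
proof -
  let ?q = "prox_model f \<mu> t x"
  \<comment> \<open>Beyond this radius the quadratic term outweighs the others, so that the model is at least its value at \<open>0\<close>.\<close>
  define r where "r = 2 * t * (norm (grad f x) + \<mu> * CARD('n))"
  have r: "r \<ge> 0" using t \<mu> by (simp add: r_def)
  have "compact (T \<inter> cball 0 r)"
    using closed_subspace[OF T] by (simp add: closed_Int_compact)
  moreover have "continuous_on (T \<inter> cball 0 r) ?q"
    unfolding prox_model_def by (intro continuous_intros)
  moreover have "0 \<in> T \<inter> cball 0 r" using r subspace_0[OF T] by simp
  ultimately obtain v where v: "v \<in> T \<inter> cball 0 r" "\<And>w. w \<in> T \<inter> cball 0 r \<Longrightarrow> ?q v \<le> ?q w"
    using continuous_attains_inf[of "T \<inter> cball 0 r" ?q] by blast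
  have "?q v \<le> ?q w" if w: "w \<in> T" for w
  proof (cases "norm w \<le> r")
    case True
    then show ?thesis using v(2) w by simp
  next
    case False
    then have "r * norm w \<le> norm w * norm w" by (intro mult_right_mono) auto
    then have "(norm (grad f x) + \<mu> * CARD('n)) * norm w \<le> 1 / (2 * t) * (norm w)\<^sup>2"
      using t unfolding r_def by (simp add: field_simps power2_eq_square)
    moreover have "- (grad f x \<bullet> w) \<le> norm (grad f x) * norm w"
      using Cauchy_Schwarz_ineq2[of "grad f x" w] by linarith
    moreover have "\<mu> * (l1_norm x - l1_norm (x + w)) \<le> \<mu> * (CARD('n) * norm w)"
      using l1_norm_lipschitz[of x "x + w"] \<mu> by (intro mult_left_mono) auto
    ultimately have "?q 0 \<le> ?q w" by (simp add: prox_model_def algebra_simps)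
    moreover have "?q v \<le> ?q 0" using v(2) r subspace_0[OF T] by simp
    ultimately show ?thesis by simp
  qed
  then show ?thesis using v(1) by blast
qed

lemma prox_model_strongly_convex:
  assumes s: "0 \<le> s" "s \<le> 1" and t: "t > 0" and \<mu>: "\<mu> > 0"
  shows "prox_model f \<mu> t x ((1 - s) *\<^sub>R v + s *\<^sub>R w)
     \<le> (1 - s) * prox_model f \<mu> t x v + s * prox_model f \<mu> t x w - s * (1 - s) / (2 * t) * (norm (w - v))\<^sup>2"
proof -
  have l1: "\<mu> * l1_norm (x + ((1 - s) *\<^sub>R v + s *\<^sub>R w))
      \<le> \<mu> * ((1 - s) * l1_norm (x + v) + s * l1_norm (x + w))"
    using l1_norm_convex[OF s, of "x + v" "x + w"] \<mu>
    by (intro mult_left_mono) (auto simp: algebra_simps)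
  have sq: "(norm ((1 - s) *\<^sub>R v + s *\<^sub>R w))\<^sup>2 = (1 - s) * (norm v)\<^sup>2 + s * (norm w)\<^sup>2 - s * (1 - s) * (norm (w - v))\<^sup>2"
    unfolding power2_norm_eq_inner
    by (simp add: inner_add_left inner_add_right inner_diff_left inner_diff_right inner_commute algebra_simps)
  show ?thesis
    using l1 unfolding prox_model_def sq
    by (simp add: inner_add_right algebra_simps add_divide_distrib diff_divide_distrib)
qed

context
  fixes \<M> :: "(real^'n) set" and f :: "real^'n \<Rightarrow> real" and \<mu> t :: real and x :: "real^'n"
  assumes T: "subspace (tangent_space \<M> x)" and t: "t > 0" and \<mu>: "\<mu> > 0"
begin

lemma prox_dir_minimizes:
  shows "prox_dir \<M> f \<mu> t x \<in> tangent_space \<M> x"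
    and "w \<in> tangent_space \<M> x \<Longrightarrow> prox_model f \<mu> t x (prox_dir \<M> f \<mu> t x) \<le> prox_model f \<mu> t x w"
proof -
  let ?P = "\<lambda>v. v \<in> tangent_space \<M> x"
  have "\<exists>v. is_arg_min (prox_model f \<mu> t x) ?P v"
    using prox_model_attains_min[OF T t \<mu>, of f x] unfolding is_arg_min_linorder by blast
  then have "is_arg_min (prox_model f \<mu> t x) ?P (arg_min (prox_model f \<mu> t x) ?P)"
    unfolding arg_min_def by (rule someI_ex)
  then have *: "is_arg_min (prox_model f \<mu> t x) ?P (prox_dir \<M> f \<mu> t x)"
    unfolding prox_dir_def prox_model_def .
  then show "prox_dir \<M> f \<mu> t x \<in> tangent_space \<M> x"
    "w \<in> tangent_space \<M> x \<Longrightarrow> prox_model f \<mu> t x (prox_dir \<M> f \<mu> t x) \<le> prox_model f \<mu> t x w"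
    unfolding is_arg_min_linorder by blast+
qed

text \<open>
  Strong convexity on the segment from the minimizer \<open>v\<close> to \<open>w\<close> gives the bound with an extra factor \<open>z < 1\<close>,
  where \<open>1 - z\<close> is the position on the segment; let \<open>z\<close> tend to \<open>1\<close>.
\<close>

lemma prox_dir_quadratic_growth:
  assumes w: "w \<in> tangent_space \<M> x"
  defines "v \<equiv> prox_dir \<M> f \<mu> t x"
  shows "prox_model f \<mu> t x v + 1 / (2 * t) * (norm (w - v))\<^sup>2 \<le> prox_model f \<mu> t x w"
proof -
  have v: "v \<in> tangent_space \<M> x" unfolding v_def by (rule prox_dir_minimizes)
  let ?q = "prox_model f \<mu> t x"
  have "z * (1 / (2 * t) * (norm (w - v))\<^sup>2) \<le> ?q w - ?q v" if z: "0 < z" "z < 1" for z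
  proof -
    let ?s = "1 - z"
    have "(1 - ?s) *\<^sub>R v + ?s *\<^sub>R w \<in> tangent_space \<M> x"
      by (intro subspace_add[OF T] subspace_scale[OF T] v w)
    then have "?q v \<le> ?q ((1 - ?s) *\<^sub>R v + ?s *\<^sub>R w)"
      unfolding v_def by (rule prox_dir_minimizes)
    also have "\<dots> \<le> (1 - ?s) * ?q v + ?s * ?q w - ?s * (1 - ?s) / (2 * t) * (norm (w - v))\<^sup>2"
      using z by (intro prox_model_strongly_convex t \<mu>) auto
    finally have "0 \<le> ?s * (?q w - ?q v - z * (1 / (2 * t) * (norm (w - v))\<^sup>2))"
      by (simp add: algebra_simps)
    then show ?thesis using z by (simp add: zero_le_mult_iff)
  qed
  then have "1 / (2 * t) * (norm (w - v))\<^sup>2 \<le> ?q w - ?q v" by (rule field_le_mult_one_interval)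
  then show ?thesis by simp
qed

text \<open>
  Quadratic growth towards the competitor \<open>0\<close> contributes a second \<open>1 / (2 * t)\<close> to the one already in the model.
\<close>

lemma prox_dir_descent:
  defines "v \<equiv> prox_dir \<M> f \<mu> t x"
  shows "grad f x \<bullet> v + \<mu> * (l1_norm (x + v) - l1_norm x) \<le> - (norm v)\<^sup>2 / t"
  using prox_dir_quadratic_growth[OF subspace_0[OF T], folded v_def] t
  by (simp add: prox_model_def algebra_simps add_divide_distrib)

lemma prox_dir_bound: "norm (prox_dir \<M> f \<mu> t x) \<le> t * (norm (grad f x) + \<mu> * CARD('n))"
proof -
  let ?v = "prox_dir \<M> f \<mu> t x"
  have "(norm ?v)\<^sup>2 / t \<le> - (grad f x \<bullet> ?v) + \<mu> * (l1_norm x - l1_norm (x + ?v))"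
    using prox_dir_descent by (simp add: algebra_simps)
  also have "\<dots> \<le> norm (grad f x) * norm ?v + \<mu> * (CARD('n) * norm ?v)"
    using Cauchy_Schwarz_ineq2[of "grad f x" ?v] l1_norm_lipschitz[of x "x + ?v"] \<mu>
    by (intro add_mono mult_left_mono) auto
  finally have "norm ?v * norm ?v \<le> (t * (norm (grad f x) + \<mu> * CARD('n))) * norm ?v"
    using t by (simp add: field_simps power2_eq_square)
  then show ?thesis
    using t \<mu> by (cases "norm ?v = 0") (auto simp: mult_le_cancel_right)
qed

end

text \<open>
  The minimizers live in different tangent spaces, so each is projected into the other space and used as a
  competitor there. Adding the quadratic growth at \<open>x\<close> to the minimality at \<open>p\<close>, the two model values
  cancel up to terms that tend to \<open>0\<close>.
\<close>

lemma prox_dir_continuous: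
  fixes \<M> :: "(real^'n) set"
  assumes sub: "embedded_submanifold TYPE('d::finite) \<M>" and p: "p \<in> \<M>"
    and t: "t > 0" and \<mu>: "\<mu> > 0" and cf: "isCont f p" and cg: "isCont (grad f) p"
  shows "(prox_dir \<M> f \<mu> t \<longlongrightarrow> prox_dir \<M> f \<mu> t p) (nhds_in \<M> p)"
proof -
  let ?F = "nhds_in \<M> p" and ?v = "prox_dir \<M> f \<mu> t" and ?q = "prox_model f \<mu> t" and ?n = "real CARD('n)"
  note T = subspace_tangent_space[OF sub]
  note PF = Proj_facts[OF sub]
  note vT = prox_dir_minimizes(1)[OF T t \<mu>]
  have F_le: "?F \<le> nhds p" by simp
  have inM: "\<forall>\<^sub>F x in ?F. x \<in> \<M>" by (simp add: eventually_inf_principal)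
  have lx: "((\<lambda>x. x) \<longlongrightarrow> p) ?F" using F_le by (simp add: filterlim_def)
  have lP: "(Proj \<M> \<longlongrightarrow> Proj \<M> p) ?F"
    by (intro tendsto_nhds_in differentiable_imp_continuous_within Proj_differentiable[OF sub p])
  have lf: "(f \<longlongrightarrow> f p) ?F" and lg: "(grad f \<longlongrightarrow> grad f p) ?F"
    using isCont_tendsto_nhds[OF cf] isCont_tendsto_nhds[OF cg] F_le tendsto_mono by blast+
  define Cg where "Cg = norm (grad f p) + 1"
  have gb: "\<forall>\<^sub>F x in ?F. norm (grad f x) < Cg"
    unfolding Cg_def by (intro order_tendstoD(2)[OF tendsto_norm[OF lg]]) simp
  define C where "C = t * (Cg + \<mu> * ?n)"
  have vb: "\<forall>\<^sub>F x in ?F. norm (?v x) \<le> C"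
    using gb inM
  proof eventually_elim
    case (elim x)
    have "norm (?v x) \<le> t * (norm (grad f x) + \<mu> * ?n)"
      using elim by (intro prox_dir_bound T t \<mu>)
    also have "\<dots> \<le> C" unfolding C_def using elim t by (intro mult_left_mono) auto
    finally show ?case .
  qed
  obtain Kb where Kb: "Kb > 0" "\<And>(X :: real^'n^'n) z. norm (X *v z) \<le> norm X * norm z * Kb"
    using bounded_bilinear.pos_bounded[OF bounded_bilinear_matrix_vector] by metis
  have C0: "C \<ge> 0" using t \<mu> by (simp add: C_def Cg_def)
  define \<delta> where "\<delta> x = norm (Proj \<M> p - Proj \<M> x) * C * Kb" for x
  define w' where "w' x = Proj \<M> p *v ?v x" for x
  have w'v: "\<forall>\<^sub>F x in ?F. norm (w' x - ?v x) \<le> \<delta> x"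
    using vb inM
  proof eventually_elim
    case (elim x)
    have "w' x - ?v x = (Proj \<M> p - Proj \<M> x) *v ?v x"
      using PF(2)[OF elim(2) vT[OF elim(2)]] by (simp add: w'_def matrix_vector_mult_diff_rdistrib)
    then have "norm (w' x - ?v x) \<le> norm (Proj \<M> p - Proj \<M> x) * norm (?v x) * Kb"
      using Kb(2) by simp
    also have "\<dots> \<le> \<delta> x" unfolding \<delta>_def
      using elim Kb(1) by (intro mult_right_mono mult_left_mono) auto
    finally show ?case .
  qed
  have l\<delta>: "(\<delta> \<longlongrightarrow> 0) ?F"
  proof -
    have "(\<delta> \<longlongrightarrow> norm (Proj \<M> p - Proj \<M> p) * C * Kb) ?F"
      unfolding \<delta>_def by (intro tendsto_intros lP)
    then show ?thesis by simp
  qed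
  define a where "a x = ?q x (Proj \<M> x *v ?v p) - ?q p (?v p)" for x
  have la: "(a \<longlongrightarrow> 0) ?F"
  proof -
    have "((\<lambda>x. Proj \<M> x *v ?v p) \<longlongrightarrow> Proj \<M> p *v ?v p) ?F"
      by (intro bounded_bilinear.tendsto[OF bounded_bilinear_matrix_vector] lP tendsto_const)
    then have "((\<lambda>x. Proj \<M> x *v ?v p) \<longlongrightarrow> ?v p) ?F" using PF(2)[OF p vT[OF p]] by simp
    then have "(a \<longlongrightarrow> ?q p (?v p) - ?q p (?v p)) ?F"
      unfolding a_def prox_model_def by (intro tendsto_intros lf lg lx)
    then show ?thesis by simp
  qed
  define b where "b x = \<bar>f p - f x\<bar> + (norm (grad f p) * \<delta> x + norm (grad f p - grad f x) * C)
     + 1 / (2 * t) * (\<delta> x * (2 * C + \<delta> x)) + \<mu> * (?n * (norm (p - x) + \<delta> x))" for x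
  have lb: "(b \<longlongrightarrow> 0) ?F"
  proof -
    have "(b \<longlongrightarrow> \<bar>f p - f p\<bar> + (norm (grad f p) * 0 + norm (grad f p - grad f p) * C)
     + 1 / (2 * t) * (0 * (2 * C + 0)) + \<mu> * (?n * (norm (p - p) + 0))) ?F"
      unfolding b_def by (intro tendsto_intros lf lg lx l\<delta>) (use t in auto)
    then show ?thesis by simp
  qed
  have close: "\<forall>\<^sub>F x in ?F. (norm (Proj \<M> x *v ?v p - ?v x))\<^sup>2 \<le> 2 * t * (a x + b x)"
    using vb w'v inM
  proof eventually_elim
    case (elim x)
    have "?q x (?v x) + 1 / (2 * t) * (norm (Proj \<M> x *v ?v p - ?v x))\<^sup>2 \<le> ?q x (Proj \<M> x *v ?v p)"
      using elim by (intro prox_dir_quadratic_growth T t \<mu> PF)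
    moreover have "?q p (?v p) \<le> ?q p (w' x)"
      unfolding w'_def using p by (intro prox_dir_minimizes(2) T t \<mu> PF)
    moreover have "?q p (w' x) - ?q x (?v x) \<le> b x"
    proof -
      have "f p - f x \<le> \<bar>f p - f x\<bar>" by simp
      moreover have "grad f p \<bullet> w' x - grad f x \<bullet> ?v x \<le> norm (grad f p) * \<delta> x + norm (grad f p - grad f x) * C"
      proof -
        have "grad f p \<bullet> w' x - grad f x \<bullet> ?v x = grad f p \<bullet> (w' x - ?v x) + (grad f p - grad f x) \<bullet> ?v x"
          by (simp add: inner_diff_left inner_diff_right)
        also have "\<dots> \<le> norm (grad f p) * norm (w' x - ?v x) + norm (grad f p - grad f x) * norm (?v x)"
          by (intro add_mono norm_cauchy_schwarz)
        also have "\<dots> \<le> norm (grad f p) * \<delta> x + norm (grad f p - grad f x) * C"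
          using elim by (intro add_mono mult_left_mono) auto
        finally show ?thesis .
      qed
      moreover have "1 / (2 * t) * ((norm (w' x))\<^sup>2 - (norm (?v x))\<^sup>2) \<le> 1 / (2 * t) * (\<delta> x * (2 * C + \<delta> x))"
      proof (intro mult_left_mono)
        have w: "norm (w' x) \<le> norm (?v x) + \<delta> x"
          using elim norm_triangle_sub[of "w' x" "?v x"] by linarith
        have "(norm (w' x))\<^sup>2 - (norm (?v x))\<^sup>2 = (norm (w' x) - norm (?v x)) * (norm (w' x) + norm (?v x))"
          by (simp add: power2_eq_square algebra_simps)
        also have "\<dots> \<le> \<delta> x * (2 * C + \<delta> x)"
        proof (rule mult_mono)
          show "0 \<le> \<delta> x" using elim norm_ge_zero order_trans by blast
        qed (use w elim in auto)
        finally show "(norm (w' x))\<^sup>2 - (norm (?v x))\<^sup>2 \<le> \<delta> x * (2 * C + \<delta> x)" .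
      qed (use t in auto)
      moreover have "\<mu> * (l1_norm (p + w' x) - l1_norm (x + ?v x)) \<le> \<mu> * (?n * (norm (p - x) + \<delta> x))"
      proof (intro mult_left_mono)
        have "l1_norm (p + w' x) - l1_norm (x + ?v x) \<le> ?n * norm ((p + w' x) - (x + ?v x))"
          using l1_norm_lipschitz[of "p + w' x" "x + ?v x"] by linarith
        also have "\<dots> \<le> ?n * (norm (p - x) + \<delta> x)"
        proof (intro mult_left_mono)
          have "norm ((p - x) + (w' x - ?v x)) \<le> norm (p - x) + norm (w' x - ?v x)"
            by (rule norm_triangle_ineq)
          then show "norm ((p + w' x) - (x + ?v x)) \<le> norm (p - x) + \<delta> x"
            using elim by (simp add: algebra_simps)
        qed simp
        finally show "l1_norm (p + w' x) - l1_norm (x + ?v x) \<le> ?n * (norm (p - x) + \<delta> x)" .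
      qed (use \<mu> in auto)
      ultimately show ?thesis
        unfolding prox_model_def b_def right_diff_distrib by linarith
    qed
    ultimately have "1 / (2 * t) * (norm (Proj \<M> x *v ?v p - ?v x))\<^sup>2 \<le> a x + b x"
      unfolding a_def by linarith
    then show ?case using t by (simp add: field_simps)
  qed
  have "((\<lambda>x. 2 * t * (a x + b x)) \<longlongrightarrow> 0) ?F"
    using tendsto_mult_left[OF tendsto_add[OF la lb], of "2 * t"] by simp
  then have "((\<lambda>x. (norm (Proj \<M> x *v ?v p - ?v x))\<^sup>2) \<longlongrightarrow> 0) ?F"
    by (rule tendsto_sandwich[OF always_eventually close tendsto_const, rotated]) simp
  then have "((\<lambda>x. norm (Proj \<M> x *v ?v p - ?v x)) \<longlongrightarrow> 0) ?F"
    using tendsto_real_sqrt[of "\<lambda>x. (norm (Proj \<M> x *v ?v p - ?v x))\<^sup>2" 0] by simp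
  then have "((\<lambda>x. Proj \<M> x *v ?v p - ?v x) \<longlongrightarrow> 0) ?F" by (rule tendsto_norm_zero_cancel)
  moreover have "((\<lambda>x. Proj \<M> x *v ?v p) \<longlongrightarrow> Proj \<M> p *v ?v p) ?F"
    by (intro bounded_bilinear.tendsto[OF bounded_bilinear_matrix_vector] lP tendsto_const)
  ultimately have "((\<lambda>x. Proj \<M> x *v ?v p - (Proj \<M> x *v ?v p - ?v x)) \<longlongrightarrow> Proj \<M> p *v ?v p - 0) ?F"
    by (rule tendsto_diff[rotated])
  then show ?thesis using PF(2)[OF p vT[OF p]] by simp
qed


section \<open>The line search of Phase 1\<close>

locale rpn_setting =
  fixes \<M> :: "(real^'n) set"
    and f :: "real^'n \<Rightarrow> real"
    and R :: "real^'n \<Rightarrow> real^'n \<Rightarrow> real^'n"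
    and B :: "real^'n \<Rightarrow> real^'d^'n"
    and lam :: "real^'n \<Rightarrow> real^'d"
    and \<mu> t \<rho> :: real
  assumes submanifold: "embedded_submanifold TYPE('d) \<M>"
    and f_smooth: "C_diff_on 3 UNIV f"
    and mu_pos: "\<mu> > 0"
    and t_pos: "t > 0"
    and rho: "0 < \<rho>" "\<rho> \<le> 1 / 2"
    and frame: "\<And>x. x \<in> \<M> \<Longrightarrow> orthonormal_normal_frame \<M> x (B x)"
    and multiplier: "\<And>x. x \<in> \<M> \<Longrightarrow> is_multiplier \<M> f \<mu> t (B x) x (lam x)"
    and compact: "compact \<M>"
    and retraction: "global_retraction \<M> R"
begin

abbreviation v where "v \<equiv> prox_dir \<M> f \<mu> t"
abbreviation Obj where "Obj \<equiv> F_obj f \<mu>"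
abbreviation T where "T \<equiv> tangent_space \<M>"

lemmas T_subspace = subspace_tangent_space[OF submanifold]
lemmas v_tangent = prox_dir_minimizes(1)[OF T_subspace t_pos mu_pos]

lemma f_differentiable: "f differentiable (at x)"
  using f_smooth by (simp add: numeral_3_eq_3)

lemma f_continuous: "isCont f x"
  using f_differentiable by (rule differentiable_imp_continuous_within)

lemma grad_differentiable: "grad f differentiable (at x)"
  using grad_C2[OF f_smooth] by (simp add: numeral_2_eq_2)

lemma grad_continuous: "isCont (grad f) x"
  using grad_differentiable by (rule differentiable_imp_continuous_within)

lemma v_tendsto: "p \<in> \<M> \<Longrightarrow> (v \<longlongrightarrow> v p) (nhds_in \<M> p)"
  by (intro prox_dir_continuous[OF submanifold] t_pos mu_pos f_continuous grad_continuous)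

lemma Obj_continuous: "continuous_on S Obj"
  unfolding F_obj_def
  by (intro continuous_intros continuous_at_imp_continuous_on ballI f_continuous)

lemma retraction_zero: "x \<in> \<M> \<Longrightarrow> R x 0 = x"
  using retraction unfolding global_retraction_def by blast

lemma retraction_in: "x \<in> \<M> \<Longrightarrow> u \<in> T x \<Longrightarrow> R x u \<in> \<M>"
  using retraction unfolding global_retraction_def tangent_bundle_def by blast

text \<open>
  To first order in \<open>\<beta>\<close> the objective changes by \<open>\<beta>\<close> times the quantity bounded in \<open>prox_dir_descent\<close>: the smooth part
  by linearization, the nonsmooth part by convexity along the segment from \<open>x\<close> to \<open>x + v x\<close>. The constants do
  not depend on \<open>x\<close>, since the step lengths will shrink while the base point moves.
\<close>

lemma line_search_decrease:
  assumes p: "p \<in> \<M>"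
  obtains \<beta>0 K where "\<beta>0 > 0"
    "\<forall>\<^sub>F x in nhds_in \<M> p. \<forall>\<beta>. 0 \<le> \<beta> \<and> \<beta> \<le> \<beta>0 \<longrightarrow>
       Obj (R x (\<beta> *\<^sub>R v x)) \<le> Obj x - \<beta> / t * (norm (v x))\<^sup>2 + K * \<beta>\<^sup>2"
proof -
  obtain rR KR where R: "rR > 0" "KR \<ge> 0"
    "\<And>x u. x \<in> \<M> \<Longrightarrow> u \<in> T x \<Longrightarrow> norm (x - p) < rR \<Longrightarrow> norm u < rR \<Longrightarrow>
       norm (R x u - x - u) \<le> KR * (norm u)\<^sup>2"
    using retraction_second_order[OF retraction p T_subspace] by metis
  have "C_diff_on 2 UNIV f"
    using f_smooth C_diff_on_SucD[of 2 UNIV f] by (simp add: numeral_3_eq_3 numeral_2_eq_2)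
  then obtain rf Kf where f: "rf > 0" "Kf \<ge> 0"
    "\<And>x y. x \<in> cball p rf \<Longrightarrow> y \<in> cball p rf \<Longrightarrow>
       norm (f y - f x - frechet_derivative f (at x) (y - x)) \<le> Kf * (norm (y - x))\<^sup>2"
    using C2_taylor[OF open_UNIV _ UNIV_I, of f p] by metis
  define C where "C = norm (v p) + 1"
  define G where "G = norm (grad f p) + 1"
  define D where "D = C + KR * C\<^sup>2"
  have C: "C > 0" unfolding C_def by (simp add: add_nonneg_pos)
  have D: "D > 0" unfolding D_def using C R(2) by (simp add: add_pos_nonneg)
  \<comment> \<open>The bounds keep \<open>\<beta> *\<^sub>R v x\<close> where the retraction estimate holds and the new point where Taylor's formula for \<open>f\<close> holds.\<close>
  define \<beta>0 where "\<beta>0 = min 1 (min (rR / (2 * C)) (rf / (2 * D)))"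
  have \<beta>0: "\<beta>0 > 0" "\<beta>0 \<le> 1" "\<beta>0 * C < rR" "\<beta>0 * D \<le> rf / 2"
  proof -
    show "\<beta>0 > 0" "\<beta>0 \<le> 1" unfolding \<beta>0_def using R f C D by auto
    have "\<beta>0 * C \<le> rR / (2 * C) * C" unfolding \<beta>0_def using C by (intro mult_right_mono) auto
    also have "\<dots> < rR" using C R(1) by simp
    finally show "\<beta>0 * C < rR" .
    have "\<beta>0 * D \<le> rf / (2 * D) * D" unfolding \<beta>0_def using D by (intro mult_right_mono) auto
    also have "\<dots> = rf / 2" using D by simp
    finally show "\<beta>0 * D \<le> rf / 2" .
  qed
  define K where "K = Kf * D\<^sup>2 + G * (KR * C\<^sup>2) + \<mu> * (CARD('n) * (KR * C\<^sup>2))"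
  have F_le: "nhds_in \<M> p \<le> nhds p" by simp
  have ev1: "\<forall>\<^sub>F x in nhds_in \<M> p. norm (v x) < C"
    unfolding C_def by (intro order_tendstoD(2)[OF tendsto_norm[OF v_tendsto[OF p]]]) simp
  have "(grad f \<longlongrightarrow> grad f p) (nhds_in \<M> p)"
    using isCont_tendsto_nhds[OF grad_continuous] F_le tendsto_mono by blast
  then have ev2: "\<forall>\<^sub>F x in nhds_in \<M> p. norm (grad f x) < G"
    unfolding G_def by (intro order_tendstoD(2)[OF tendsto_norm]) auto
  have "\<forall>\<^sub>F x in nhds p. x \<in> ball p (min rR (rf / 2))"
    using R f by (intro eventually_nhds_in_open) auto
  then have ev3: "\<forall>\<^sub>F x in nhds_in \<M> p. x \<in> \<M> \<and> x \<in> ball p (min rR (rf / 2))"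
    unfolding eventually_inf_principal by (rule eventually_mono) simp
  have "\<forall>\<^sub>F x in nhds_in \<M> p. \<forall>\<beta>. 0 \<le> \<beta> \<and> \<beta> \<le> \<beta>0 \<longrightarrow>
       Obj (R x (\<beta> *\<^sub>R v x)) \<le> Obj x - \<beta> / t * (norm (v x))\<^sup>2 + K * \<beta>\<^sup>2"
    using ev1 ev2 ev3
  proof eventually_elim
    case (elim x)
    then have xM: "x \<in> \<M>" and xp: "norm (x - p) < rR" "norm (x - p) < rf / 2"
      by (auto simp: dist_norm norm_minus_commute)
    show ?case
    proof (intro allI impI)
      fix \<beta> assume \<beta>: "0 \<le> \<beta> \<and> \<beta> \<le> \<beta>0"
      let ?y = "R x (\<beta> *\<^sub>R v x)" and ?g = "grad f x"
      define e where "e = ?y - x - \<beta> *\<^sub>R v x"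
      have nb: "norm (\<beta> *\<^sub>R v x) \<le> \<beta> * C" using elim(1) \<beta> by (simp add: mult_left_mono)
      have "\<beta> * C \<le> \<beta>0 * C" using \<beta> C by (intro mult_right_mono) auto
      then have "norm (\<beta> *\<^sub>R v x) < rR" using nb \<beta>0(3) by linarith
      then have "norm e \<le> KR * (norm (\<beta> *\<^sub>R v x))\<^sup>2"
        unfolding e_def by (intro R(3) xM subspace_scale[OF T_subspace[OF xM]] v_tangent xp)
      also have "\<dots> \<le> KR * (\<beta> * C)\<^sup>2" using nb R(2) by (intro mult_left_mono power_mono) auto
      finally have e: "norm e \<le> \<beta>\<^sup>2 * (KR * C\<^sup>2)" by (simp add: power_mult_distrib mult_ac)
      have yx: "?y - x = \<beta> *\<^sub>R v x + e" unfolding e_def by simp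
      have "\<beta>\<^sup>2 \<le> \<beta>" using \<beta> \<beta>0(2) by (simp add: power2_eq_square mult_left_le)
      then have "\<beta>\<^sup>2 * (KR * C\<^sup>2) \<le> \<beta> * (KR * C\<^sup>2)" using R(2) by (intro mult_right_mono) auto
      then have nyx: "norm (?y - x) \<le> \<beta> * D"
        unfolding yx D_def using norm_triangle_ineq[of "\<beta> *\<^sub>R v x" e] nb e by (simp add: distrib_left)
      have "\<beta> * D \<le> \<beta>0 * D" using \<beta> D by (intro mult_right_mono) auto
      then have "norm (?y - p) \<le> rf"
        using norm_triangle_ineq[of "?y - x" "x - p"] nyx \<beta>0(4) xp(2) by simp
      then have "norm (f ?y - f x - frechet_derivative f (at x) (?y - x)) \<le> Kf * (norm (?y - x))\<^sup>2"
        using xp(2) f(1) by (intro f(3)) (auto simp: dist_norm norm_minus_commute)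
      also have "\<dots> \<le> Kf * (\<beta> * D)\<^sup>2" using nyx f(2) by (intro mult_left_mono power_mono) auto
      finally have "f ?y \<le> f x + ?g \<bullet> (?y - x) + Kf * (\<beta> * D)\<^sup>2"
        by (simp add: frechet_derivative_eq_grad[OF f_differentiable] abs_le_iff)
      moreover have "?g \<bullet> (?y - x) \<le> \<beta> * (?g \<bullet> v x) + G * (\<beta>\<^sup>2 * (KR * C\<^sup>2))"
      proof -
        have "?g \<bullet> e \<le> norm ?g * norm e" by (rule norm_cauchy_schwarz)
        also have "\<dots> \<le> G * (\<beta>\<^sup>2 * (KR * C\<^sup>2))" using elim(2) e by (intro mult_mono) (auto simp: G_def)
        finally show ?thesis unfolding yx by (simp add: inner_add_right)
      qed
      moreover have "\<mu> * l1_norm ?y \<le> \<mu> * ((1 - \<beta>) * l1_norm x + \<beta> * l1_norm (x + v x) + CARD('n) * (\<beta>\<^sup>2 * (KR * C\<^sup>2)))"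
      proof (intro mult_left_mono)
        have "l1_norm ?y - l1_norm (x + \<beta> *\<^sub>R v x) \<le> CARD('n) * norm e"
          using l1_norm_lipschitz[of ?y "x + \<beta> *\<^sub>R v x"] unfolding e_def by (simp add: algebra_simps)
        also have "\<dots> \<le> CARD('n) * (\<beta>\<^sup>2 * (KR * C\<^sup>2))" using e by (intro mult_left_mono) auto
        finally have "l1_norm ?y \<le> l1_norm (x + \<beta> *\<^sub>R v x) + CARD('n) * (\<beta>\<^sup>2 * (KR * C\<^sup>2))" by simp
        moreover have "l1_norm (x + \<beta> *\<^sub>R v x) \<le> (1 - \<beta>) * l1_norm x + \<beta> * l1_norm (x + v x)"
          using l1_norm_convex[of \<beta> x "x + v x"] \<beta> \<beta>0(2) by (simp add: algebra_simps)
        ultimately show "l1_norm ?y \<le> (1 - \<beta>) * l1_norm x + \<beta> * l1_norm (x + v x) + CARD('n) * (\<beta>\<^sup>2 * (KR * C\<^sup>2))"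
          by simp
      qed (use mu_pos in simp)
      moreover have "\<beta> * (?g \<bullet> v x + \<mu> * (l1_norm (x + v x) - l1_norm x)) \<le> \<beta> * (- (norm (v x))\<^sup>2 / t)"
        using \<beta> by (intro mult_left_mono prox_dir_descent T_subspace t_pos mu_pos xM) auto
      ultimately show "Obj ?y \<le> Obj x - \<beta> / t * (norm (v x))\<^sup>2 + K * \<beta>\<^sup>2"
        unfolding F_obj_def K_def by (simp add: algebra_simps power_mult_distrib)
    qed
  qed
  then show ?thesis using that \<beta>0(1) by blast
qed

lemma short_retraction_step:
  assumes p: "p \<in> \<M>" and \<eta>: "\<eta> > 0"
  obtains \<delta> where "\<delta> > 0"
    "\<And>x u. x \<in> \<M> \<Longrightarrow> u \<in> T x \<Longrightarrow> norm (x - p) < \<delta> \<Longrightarrow> norm u < \<delta> \<Longrightarrow> norm (R x u - x) < \<eta>"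
proof -
  obtain r K where R: "r > 0" "K \<ge> 0"
    "\<And>x u. x \<in> \<M> \<Longrightarrow> u \<in> T x \<Longrightarrow> norm (x - p) < r \<Longrightarrow> norm u < r \<Longrightarrow>
       norm (R x u - x - u) \<le> K * (norm u)\<^sup>2"
    using retraction_second_order[OF retraction p T_subspace] by metis
  define \<delta> where "\<delta> = min r (min 1 (\<eta> / (1 + K)))"
  show ?thesis
  proof (rule that[of \<delta>])
    show "\<delta> > 0" using R \<eta> by (simp add: \<delta>_def)
    fix x u assume xu: "x \<in> \<M>" "u \<in> T x" "norm (x - p) < \<delta>" "norm u < \<delta>"
    then have u: "norm u < r" "norm u < 1" "norm u < \<eta> / (1 + K)" by (auto simp: \<delta>_def)
    have "norm (R x u - x) \<le> norm u + norm (R x u - x - u)"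
      by (metis norm_triangle_sub norm_minus_commute)
    also have "\<dots> \<le> norm u + K * (norm u)\<^sup>2" using R(3)[of x u] xu u(1) by (simp add: \<delta>_def)
    also have "\<dots> \<le> norm u + K * norm u"
      using R(2) u(2) by (intro add_left_mono mult_left_mono) (auto simp: power2_eq_square mult_left_le)
    also have "\<dots> < \<eta>" using u(3) R(2) by (simp add: field_simps)
    finally show "norm (R x u - x) < \<eta>" .
  qed
qed

text \<open>
  The last clause records that the previous trial length \<open>\<alpha> / \<rho>\<close> was rejected; this is what contradicts
  \<open>line_search_decrease\<close> if step lengths become small.
\<close>

lemma phase1_stepE:
  assumes "phase1_step \<M> R f \<mu> t \<rho> x x'"
  obtains \<alpha> where "0 < \<alpha>" "\<alpha> \<le> 1" "x' = R x (\<alpha> *\<^sub>R v x)" "Obj x' \<le> Obj x - 1 / 2 * \<alpha> * (norm (v x))\<^sup>2"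
    "\<alpha> < 1 \<Longrightarrow> Obj (R x ((\<alpha> / \<rho>) *\<^sub>R v x)) > Obj x - 1 / 2 * (\<alpha> / \<rho>) * (norm (v x))\<^sup>2"
proof -
  obtain m where m: "sufficient_decrease \<M> R f \<mu> t x (\<rho> ^ m)"
    "\<And>i. i < m \<Longrightarrow> \<not> sufficient_decrease \<M> R f \<mu> t x (\<rho> ^ i)" "x' = R x (\<rho> ^ m *\<^sub>R v x)"
    using assms unfolding phase1_step_def by blast
  show ?thesis
  proof (rule that[of "\<rho> ^ m"])
    show "0 < \<rho> ^ m" "\<rho> ^ m \<le> 1" using rho by (auto intro: power_le_one)
    show "x' = R x (\<rho> ^ m *\<^sub>R v x)" by (rule m(3))
    show "Obj x' \<le> Obj x - 1 / 2 * \<rho> ^ m * (norm (v x))\<^sup>2"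
      using m(1,3) unfolding sufficient_decrease_def Let_def by simp
    assume "\<rho> ^ m < 1"
    then obtain i where i: "m = Suc i" by (cases m) auto
    have "\<rho> ^ m / \<rho> = \<rho> ^ i" unfolding i using rho by simp
    then show "Obj (R x ((\<rho> ^ m / \<rho>) *\<^sub>R v x)) > Obj x - 1 / 2 * (\<rho> ^ m / \<rho>) * (norm (v x))\<^sup>2"
      using m(2)[of i] i unfolding sufficient_decrease_def Let_def by simp
  qed
qed

lemma phase1_step_unique:
  assumes "phase1_step \<M> R f \<mu> t \<rho> x y" "phase1_step \<M> R f \<mu> t \<rho> x z"
  shows "y = z"
  using assms unfolding phase1_step_def by (metis linorder_neqE_nat)

lemma phase1_step_in:
  assumes "phase1_step \<M> R f \<mu> t \<rho> x y" "x \<in> \<M>"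
  shows "y \<in> \<M>"
  using assms unfolding phase1_step_def
  by (auto intro!: retraction_in subspace_scale[OF T_subspace] v_tangent)

lemma phase1_sequence:
  assumes xM: "\<And>k. x k \<in> \<M>" and step: "\<And>k. phase1_step \<M> R f \<mu> t \<rho> (x k) (x (Suc k))"
  obtains \<alpha> l where "\<And>k. 0 < \<alpha> k" "\<And>k. \<alpha> k \<le> 1" "\<And>k. x (Suc k) = R (x k) (\<alpha> k *\<^sub>R v (x k))"
    "\<And>k. \<alpha> k < 1 \<Longrightarrow>
       Obj (R (x k) ((\<alpha> k / \<rho>) *\<^sub>R v (x k))) > Obj (x k) - 1 / 2 * (\<alpha> k / \<rho>) * (norm (v (x k)))\<^sup>2"
    "(\<lambda>k. \<alpha> k * (norm (v (x k)))\<^sup>2) \<longlonglongrightarrow> 0" "(\<lambda>k. Obj (x k)) \<longlonglongrightarrow> l"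
proof -
  have "\<forall>k. \<exists>\<alpha>. 0 < \<alpha> \<and> \<alpha> \<le> 1 \<and> x (Suc k) = R (x k) (\<alpha> *\<^sub>R v (x k)) \<and>
     Obj (x (Suc k)) \<le> Obj (x k) - 1 / 2 * \<alpha> * (norm (v (x k)))\<^sup>2 \<and>
     (\<alpha> < 1 \<longrightarrow> Obj (R (x k) ((\<alpha> / \<rho>) *\<^sub>R v (x k))) > Obj (x k) - 1 / 2 * (\<alpha> / \<rho>) * (norm (v (x k)))\<^sup>2)"
    using phase1_stepE[OF step] by metis
  then obtain \<alpha> where \<alpha>: "\<And>k. 0 < \<alpha> k" "\<And>k. \<alpha> k \<le> 1" "\<And>k. x (Suc k) = R (x k) (\<alpha> k *\<^sub>R v (x k))"
    "\<And>k. Obj (x (Suc k)) \<le> Obj (x k) - 1 / 2 * \<alpha> k * (norm (v (x k)))\<^sup>2"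
    "\<And>k. \<alpha> k < 1 \<Longrightarrow>
       Obj (R (x k) ((\<alpha> k / \<rho>) *\<^sub>R v (x k))) > Obj (x k) - 1 / 2 * (\<alpha> k / \<rho>) * (norm (v (x k)))\<^sup>2"
    by metis
  have dec: "decseq (\<lambda>k. Obj (x k))"
  proof (rule decseq_SucI)
    fix k
    have "0 \<le> \<alpha> k * (norm (v (x k)))\<^sup>2" using \<alpha>(1)[of k] by simp
    then show "Obj (x (Suc k)) \<le> Obj (x k)" using \<alpha>(4)[of k] by simp
  qed
  obtain m where m: "\<And>y. y \<in> \<M> \<Longrightarrow> Obj m \<le> Obj y"
    using continuous_attains_inf[OF compact _ Obj_continuous] xM by blast
  obtain l where l: "(\<lambda>k. Obj (x k)) \<longlonglongrightarrow> l"
    using decseq_convergent[OF dec, of "Obj m"] m xM by blast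
  have "(\<lambda>k. 2 * (Obj (x k) - Obj (x (Suc k)))) \<longlonglongrightarrow> 2 * (l - l)"
    by (intro tendsto_intros l LIMSEQ_Suc)
  then have lim0: "(\<lambda>k. 2 * (Obj (x k) - Obj (x (Suc k)))) \<longlonglongrightarrow> 0" by simp
  have "(\<lambda>k. \<alpha> k * (norm (v (x k)))\<^sup>2) \<longlonglongrightarrow> 0"
  proof (rule tendsto_sandwich[OF _ _ tendsto_const lim0])
    show "\<forall>\<^sub>F k in sequentially. 0 \<le> \<alpha> k * (norm (v (x k)))\<^sup>2"
      using \<alpha>(1) by (simp add: less_imp_le)
    show "\<forall>\<^sub>F k in sequentially. \<alpha> k * (norm (v (x k)))\<^sup>2 \<le> 2 * (Obj (x k) - Obj (x (Suc k)))"
    proof (rule always_eventually, rule allI)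
      fix k show "\<alpha> k * (norm (v (x k)))\<^sup>2 \<le> 2 * (Obj (x k) - Obj (x (Suc k)))"
        using \<alpha>(4)[of k] by simp
    qed
  qed
  then show ?thesis using that[of \<alpha> l] \<alpha> l by blast
qed

text \<open>
  If \<open>v p \<noteq> 0\<close>, then \<open>v\<close> is bounded away from \<open>0\<close> along the subsequence, so the step lengths tend to \<open>0\<close> and the
  rejected lengths \<open>\<alpha> / \<rho>\<close> eventually enter the range where a decrease with factor \<open>1/t > 1/2\<close> holds up to a
  quadratic term. Dividing by the length leaves \<open>(1/t - 1/2) * (norm (v p))\<^sup>2 \<le> 0\<close>.
\<close>

lemma phase1_accumulation_stationary:
  assumes t2: "t < 2"
    and xM: "\<And>k. x k \<in> \<M>" and step: "\<And>k. phase1_step \<M> R f \<mu> t \<rho> (x k) (x (Suc k))"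
    and r: "strict_mono r" "(x \<circ> r) \<longlonglongrightarrow> p" and p: "p \<in> \<M>"
  shows "v p = 0"
proof (rule ccontr)
  assume vp: "v p \<noteq> 0"
  obtain \<alpha> l where \<alpha>: "\<And>k. 0 < \<alpha> k" "\<And>k. \<alpha> k \<le> 1" "\<And>k. x (Suc k) = R (x k) (\<alpha> k *\<^sub>R v (x k))"
    "\<And>k. \<alpha> k < 1 \<Longrightarrow>
       Obj (R (x k) ((\<alpha> k / \<rho>) *\<^sub>R v (x k))) > Obj (x k) - 1 / 2 * (\<alpha> k / \<rho>) * (norm (v (x k)))\<^sup>2"
    "(\<lambda>k. \<alpha> k * (norm (v (x k)))\<^sup>2) \<longlonglongrightarrow> 0" "(\<lambda>k. Obj (x k)) \<longlonglongrightarrow> l"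
    by (rule phase1_sequence[of x, OF xM step]) (rule that)
  define y where "y k = x (r k)" for k
  define a where "a k = \<alpha> (r k)" for k
  have fl: "filterlim y (nhds_in \<M> p) sequentially"
    using r(2) xM by (intro filterlim_nhds_in) (simp_all add: y_def[abs_def] comp_def)
  have lv: "(\<lambda>k. (norm (v (y k)))\<^sup>2) \<longlonglongrightarrow> (norm (v p))\<^sup>2"
    by (intro tendsto_intros filterlim_compose[OF v_tendsto[OF p] fl])
  have "(\<lambda>k. a k * (norm (v (y k)))\<^sup>2) \<longlonglongrightarrow> 0"
    using LIMSEQ_subseq_LIMSEQ[OF \<alpha>(5) r(1)] by (simp add: a_def y_def comp_def)
  then have "(\<lambda>k. a k * (norm (v (y k)))\<^sup>2 / (norm (v (y k)))\<^sup>2) \<longlonglongrightarrow> 0 / (norm (v p))\<^sup>2"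
    using vp by (intro tendsto_divide lv) auto
  moreover have "\<forall>\<^sub>F k in sequentially. (norm (v (y k)))\<^sup>2 > 0"
    using vp by (intro order_tendstoD(1)[OF lv]) simp
  then have "\<forall>\<^sub>F k in sequentially. a k * (norm (v (y k)))\<^sup>2 / (norm (v (y k)))\<^sup>2 = a k"
    by (rule eventually_mono) auto
  ultimately have la: "a \<longlonglongrightarrow> 0" using Lim_transform_eventually by fastforce
  then have l\<beta>: "(\<lambda>k. a k / \<rho>) \<longlonglongrightarrow> 0" using tendsto_divide_zero by blast
  obtain \<beta>0 K where K: "\<beta>0 > 0" "\<forall>\<^sub>F x in nhds_in \<M> p. \<forall>\<beta>. 0 \<le> \<beta> \<and> \<beta> \<le> \<beta>0 \<longrightarrow>
       Obj (R x (\<beta> *\<^sub>R v x)) \<le> Obj x - \<beta> / t * (norm (v x))\<^sup>2 + K * \<beta>\<^sup>2"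
    by (rule line_search_decrease[OF p])
  have e1: "\<forall>\<^sub>F k in sequentially. \<forall>\<beta>. 0 \<le> \<beta> \<and> \<beta> \<le> \<beta>0 \<longrightarrow>
       Obj (R (y k) (\<beta> *\<^sub>R v (y k))) \<le> Obj (y k) - \<beta> / t * (norm (v (y k)))\<^sup>2 + K * \<beta>\<^sup>2"
    using fl K(2) unfolding filterlim_iff by blast
  have e2: "\<forall>\<^sub>F k in sequentially. a k < 1" by (rule order_tendstoD(2)[OF la]) simp
  have e3: "\<forall>\<^sub>F k in sequentially. a k / \<rho> < \<beta>0" by (rule order_tendstoD(2)[OF l\<beta> K(1)])
  have "\<forall>\<^sub>F k in sequentially. (1 / t - 1 / 2) * (norm (v (y k)))\<^sup>2 \<le> K * (a k / \<rho>)"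
    using e1 e2 e3
  proof eventually_elim
    case (elim k)
    let ?b = "a k / \<rho>"
    have b: "?b > 0" using \<alpha>(1) rho by (simp add: a_def)
    have "Obj (y k) - 1 / 2 * ?b * (norm (v (y k)))\<^sup>2 < Obj (R (y k) (?b *\<^sub>R v (y k)))"
      using \<alpha>(4)[of "r k"] elim(2) by (simp add: a_def y_def)
    also have "\<dots> \<le> Obj (y k) - ?b / t * (norm (v (y k)))\<^sup>2 + K * ?b\<^sup>2"
      using elim(1)[rule_format, of ?b] elim(3) b by linarith
    finally have "?b * ((1 / t - 1 / 2) * (norm (v (y k)))\<^sup>2) < ?b * (K * ?b)"
      by (simp add: algebra_simps power2_eq_square)
    then show ?case by (rule mult_left_le_imp_le[OF less_imp_le b])
  qed
  moreover have "(\<lambda>k. K * (a k / \<rho>)) \<longlonglongrightarrow> 0" using tendsto_mult_left[OF l\<beta>, of K] by simp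
  moreover have "(\<lambda>k. (1 / t - 1 / 2) * (norm (v (y k)))\<^sup>2) \<longlonglongrightarrow> (1 / t - 1 / 2) * (norm (v p))\<^sup>2"
    by (intro tendsto_intros lv)
  ultimately have "(1 / t - 1 / 2) * (norm (v p))\<^sup>2 \<le> 0"
    by (intro tendsto_le[OF sequentially_bot])
  moreover have "1 / t - 1 / 2 > 0" using t2 t_pos by (simp add: field_simps)
  ultimately show False using vp by (simp add: mult_le_0_iff)
qed

lemma phase1_converges_to_strict_minimum:
  assumes xM: "\<And>k. x k \<in> \<M>" and step: "\<And>k. phase1_step \<M> R f \<mu> t \<rho> (x k) (x (Suc k))"
    and r: "strict_mono r" "(x \<circ> r) \<longlonglongrightarrow> p" and p: "p \<in> \<M>"
    and U: "open U" "p \<in> U" "\<And>y. y \<in> \<M> \<inter> U \<Longrightarrow> y \<noteq> p \<Longrightarrow> Obj y > Obj p"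
  shows "x \<longlonglongrightarrow> p"
proof (rule LIMSEQ_I)
  obtain \<alpha> l where \<alpha>: "\<And>k. 0 < \<alpha> k" "\<And>k. \<alpha> k \<le> 1" "\<And>k. x (Suc k) = R (x k) (\<alpha> k *\<^sub>R v (x k))"
    "\<And>k. \<alpha> k < 1 \<Longrightarrow>
       Obj (R (x k) ((\<alpha> k / \<rho>) *\<^sub>R v (x k))) > Obj (x k) - 1 / 2 * (\<alpha> k / \<rho>) * (norm (v (x k)))\<^sup>2"
    "(\<lambda>k. \<alpha> k * (norm (v (x k)))\<^sup>2) \<longlonglongrightarrow> 0" "(\<lambda>k. Obj (x k)) \<longlonglongrightarrow> l"
    by (rule phase1_sequence[of x, OF xM step]) (rule that)
  have "(\<lambda>k. Obj (x (r k))) \<longlonglongrightarrow> Obj p"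
    using continuous_on_tendsto_compose[OF Obj_continuous[of UNIV], of "x \<circ> r" p] r(2) by (simp add: comp_def)
  moreover have "(\<lambda>k. Obj (x (r k))) \<longlonglongrightarrow> l"
    using LIMSEQ_subseq_LIMSEQ[OF \<alpha>(6) r(1)] by (simp add: comp_def)
  ultimately have l: "l = Obj p" using LIMSEQ_unique by blast
  have "(\<lambda>k. sqrt (\<alpha> k * (norm (v (x k)))\<^sup>2)) \<longlonglongrightarrow> 0"
    using tendsto_real_sqrt[OF \<alpha>(5)] by simp
  then have lstep: "(\<lambda>k. norm (\<alpha> k *\<^sub>R v (x k))) \<longlonglongrightarrow> 0"
  proof (rule tendsto_sandwich[OF _ _ tendsto_const, rotated 2])
    show "\<forall>\<^sub>F k in sequentially. norm (\<alpha> k *\<^sub>R v (x k)) \<le> sqrt (\<alpha> k * (norm (v (x k)))\<^sup>2)"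
    proof (rule always_eventually, rule allI, rule real_le_rsqrt)
      fix k
      have "(\<alpha> k)\<^sup>2 \<le> \<alpha> k" using \<alpha>(1,2)[of k] by (simp add: power2_eq_square mult_left_le)
      then show "(norm (\<alpha> k *\<^sub>R v (x k)))\<^sup>2 \<le> \<alpha> k * (norm (v (x k)))\<^sup>2"
        by (simp add: power_mult_distrib mult_right_mono)
    qed
  qed simp
  fix \<epsilon> :: real assume "\<epsilon> > 0"
  moreover obtain d where d: "d > 0" "cball p d \<subseteq> U" using U open_contains_cball by blast
  ultimately have e1: "min (\<epsilon> / 2) d > 0" by simp
  define \<epsilon>1 where "\<epsilon>1 = min (\<epsilon> / 2) d"
  have \<epsilon>1: "\<epsilon>1 > 0" "\<epsilon>1 < \<epsilon>" "cball p \<epsilon>1 \<subseteq> U" using e1 d by (auto simp: \<epsilon>1_def)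
  obtain \<delta> where \<delta>: "\<delta> > 0"
    "\<And>x u. x \<in> \<M> \<Longrightarrow> u \<in> T x \<Longrightarrow> norm (x - p) < \<delta> \<Longrightarrow> norm u < \<delta> \<Longrightarrow> norm (R x u - x) < \<epsilon>1 / 2"
    using short_retraction_step[OF p, of "\<epsilon>1 / 2"] \<epsilon>1(1) by auto
  define \<delta>1 where "\<delta>1 = min \<delta> (\<epsilon>1 / 2)"
  have \<delta>1: "\<delta>1 > 0" "\<delta>1 \<le> \<delta>" "\<delta>1 \<le> \<epsilon>1 / 2" using \<delta>(1) \<epsilon>1(1) by (auto simp: \<delta>1_def)
  \<comment> \<open>From inside \<open>ball p \<delta>1\<close> a step is shorter than \<open>\<epsilon>1 / 2\<close>, so it ends in \<open>cball p \<epsilon>1\<close>; the annulus is excluded by its values.\<close>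
  define A where "A = \<M> \<inter> (cball p \<epsilon>1 - ball p \<delta>1)"
  have "compact A" unfolding A_def
    by (intro compact_Int_closed compact closed_Diff) auto
  have "\<exists>m. m > Obj p \<and> (\<forall>y\<in>A. m \<le> Obj y)"
  proof (cases "A = {}")
    case False
    then obtain a where a: "a \<in> A" "\<And>y. y \<in> A \<Longrightarrow> Obj a \<le> Obj y"
      using continuous_attains_inf[OF \<open>compact A\<close> _ Obj_continuous] by blast
    have "Obj a > Obj p" using a(1) \<epsilon>1(3) \<delta>1(1) by (intro U(3)) (auto simp: A_def)
    then show ?thesis using a(2) by blast
  qed (auto intro: exI[of _ "Obj p + 1"])
  then obtain m where m: "m > Obj p" "\<And>y. y \<in> A \<Longrightarrow> m \<le> Obj y" by blast
  have "\<forall>\<^sub>F k in sequentially. Obj (x k) < m"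
    using order_tendstoD(2)[OF \<alpha>(6)] m(1) l by blast
  moreover have "\<forall>\<^sub>F k in sequentially. norm (\<alpha> k *\<^sub>R v (x k)) < \<delta>"
    by (rule order_tendstoD(2)[OF lstep \<delta>(1)])
  ultimately have "\<forall>\<^sub>F k in sequentially. Obj (x k) < m \<and> norm (\<alpha> k *\<^sub>R v (x k)) < \<delta>"
    by (rule eventually_conj)
  then obtain N where N: "\<And>k. k \<ge> N \<Longrightarrow> Obj (x k) < m" "\<And>k. k \<ge> N \<Longrightarrow> norm (\<alpha> k *\<^sub>R v (x k)) < \<delta>"
    unfolding eventually_sequentially by blast
  obtain j0 where j0: "\<And>j. j \<ge> j0 \<Longrightarrow> norm ((x \<circ> r) j - p) < \<delta>1"
    using LIMSEQ_D[OF r(2) \<delta>1(1)] by blast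
  define k0 where "k0 = r (max j0 N)"
  have "N \<le> k0" unfolding k0_def using seq_suble[OF r(1), of "max j0 N"] by simp
  have "norm (x k - p) < \<delta>1" if "k \<ge> k0" for k
    using that
  proof (induction k rule: dec_induct)
    case base
    then show ?case using j0[of "max j0 N"] by (simp add: k0_def)
  next
    case (step k)
    have "norm (R (x k) (\<alpha> k *\<^sub>R v (x k)) - x k) < \<epsilon>1 / 2"
      using step \<delta>1(2) N(2)[of k] \<open>N \<le> k0\<close>
      by (intro \<delta>(2) xM subspace_scale[OF T_subspace] v_tangent) auto
    then have "norm (x (Suc k) - x k) < \<epsilon>1 / 2" unfolding \<alpha>(3) .
    then have "norm (x (Suc k) - p) \<le> \<epsilon>1"
      using norm_triangle_ineq[of "x (Suc k) - x k" "x k - p"] step \<delta>1(3) by simp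
    moreover have "x (Suc k) \<notin> A" using m(2)[of "x (Suc k)"] N(1)[of "Suc k"] step \<open>N \<le> k0\<close> by auto
    ultimately show ?case using xM by (auto simp: A_def dist_norm norm_minus_commute)
  qed
  then show "\<exists>no. \<forall>n\<ge>no. norm (x n - p) < \<epsilon>" using \<delta>1(3) \<epsilon>1 by (intro exI[of _ k0]) (fastforce)
qed

text \<open>
  At a stationary point the right-hand side of the linear system is \<open>0\<close>, and \<open>J\<close> is injective on tangent vectors
  and sends \<open>0\<close> to \<open>0\<close>. The last point rests on the differentiability of the projector, as
  \<open>frechet_derivative\<close> is an arbitrary function where no derivative exists.
\<close>

lemma phase2_step_at_stationary:
  assumes x: "x \<in> \<M>" and vx: "v x = 0" and step: "phase2_step \<M> R f \<mu> t B lam x x'"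
  shows "x' = x"
proof -
  let ?J = "J_op \<M> f \<mu> t (B x) (lam x) x"
  obtain u where u: "u \<in> T x" "?J u = - v x" "x' = R x u"
    using step unfolding phase2_step_def by blast
  have inj: "inj_on ?J (T x)"
    using step unfolding phase2_step_def J_nonsingular_def by (simp add: bij_betw_def)
  have "linear (frechet_derivative (Proj \<M>) (at x within \<M>))"
    by (rule linear_frechet_derivative[OF Proj_differentiable[OF submanifold x]])
  then have "?J 0 = 0"
    unfolding J_op_def Let_def Weingarten_def by (simp add: linear_0)
  then have "u = 0"
    using inj_onD[OF inj, of u 0] u(1,2) vx subspace_0[OF T_subspace[OF x]] by simp
  then show ?thesis using u(3) retraction_zero[OF x] by simp
qed

lemma phase2_step_in:
  assumes "phase2_step \<M> R f \<mu> t B lam x y" "x \<in> \<M>"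
  shows "y \<in> \<M>"
  using assms unfolding phase2_step_def by (auto intro: retraction_in)

lemma run_in_manifold:
  assumes run: "RPN_G_run \<M> R f \<mu> t B lam \<rho> x0 \<epsilon> x" and x0: "x0 \<in> \<M>"
  shows "x k \<in> \<M>"
proof (induction k)
  case 0
  then show ?case using run x0 unfolding RPN_G_run_def by simp
next
  case (Suc k)
  then show ?case
    using run phase1_step_in phase2_step_in unfolding RPN_G_run_def by metis
qed

lemma run_zero_cases:
  assumes run: "RPN_G_run \<M> R f \<mu> t B lam \<rho> x0 0 x" and x0: "x0 \<in> \<M>"
  obtains (infinite) "\<And>k. v (x k) \<noteq> 0" "\<And>k. phase1_step \<M> R f \<mu> t \<rho> (x k) (x (Suc k))"
    | (terminates) K where "v (x K) = 0" "\<And>i. i < K \<Longrightarrow> v (x i) \<noteq> 0" "\<And>k. k \<ge> K \<Longrightarrow> x k = x K"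
proof (cases "\<exists>k. v (x k) = 0")
  case False
  then show ?thesis using infinite run unfolding RPN_G_run_def by auto
next
  case True
  define K where "K = (LEAST k. v (x k) = 0)"
  have K: "v (x K) = 0" unfolding K_def using True by (rule LeastI_ex)
  have "x k = x K" if "k \<ge> K" for k
    using that
  proof (induction k rule: dec_induct)
    case (step k)
    have "\<not> (\<forall>i\<le>k. norm (v (x i)) > 0)" using K step by force
    then have "phase2_step \<M> R f \<mu> t B lam (x k) (x (Suc k))"
      using run unfolding RPN_G_run_def by meson
    moreover have "v (x k) = 0" using step.IH K by simp
    ultimately have "x (Suc k) = x k"
      using phase2_step_at_stationary[OF run_in_manifold[OF run x0]] by blast
    then show ?case using step.IH by (rule trans)
  qed simp
  moreover have "v (x i) \<noteq> 0" if "i < K" for i using not_less_Least that unfolding K_def by blast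
  ultimately show ?thesis using terminates K by blast
qed

end


section \<open>The Newton-type step of Phase 2\<close>

text \<open>
  \<open>g\<close> is a smooth extension of the normal frame to an open set of the ambient space, so that the frame can be
  differentiated in the ordinary sense.
\<close>

locale newton_setting = rpn_setting \<M> f R B lam \<mu> t \<rho>
  for \<M> :: "(real^'n) set" and f R and B :: "real^'n \<Rightarrow> real^'d^'n" and lam \<mu> t \<rho> +
  fixes xs :: "real^'n" and W :: "(real^'n) set" and g :: "real^'n \<Rightarrow> real^'d^'n"
  assumes xs: "xs \<in> \<M>" and v_xs: "v xs = 0"
    and W: "open W" "xs \<in> W" and g_smooth: "C_diff_on 2 W g"
    and B_eq: "\<And>x. x \<in> W \<inter> \<M> \<Longrightarrow> B x = g x"
    and asm_B: "assumption_B \<M> f \<mu> t xs"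
    and J_xs: "J_nonsingular \<M> f \<mu> t (B xs) (lam xs) xs"
begin

abbreviation F where "F \<equiv> nhds_in \<M> xs"
abbreviation ord where "ord \<equiv> vanishes F xs"
abbreviation E where "E x \<equiv> x - xs"
abbreviation P where "P \<equiv> Proj \<M>"

lemma F_le: "F \<le> nhds xs" by simp

lemma F_tendsto: "isCont h xs \<Longrightarrow> (h \<longlongrightarrow> h xs) F"
  using isCont_tendsto_nhds tendsto_mono[OF F_le] by blast

lemma F_in: "\<forall>\<^sub>F x in F. x \<in> W \<inter> \<M>"
proof -
  have "\<forall>\<^sub>F x in nhds xs. x \<in> W" using W by (rule eventually_nhds_in_open)
  then show ?thesis unfolding eventually_inf_principal by (rule eventually_mono) blast
qed

lemma g_diff: "x \<in> W \<Longrightarrow> g differentiable (at x)"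
  using g_smooth by (simp add: numeral_2_eq_2)

lemmas frame_facts = orthonormal_frame_facts[OF T_subspace frame]

lemma B_tendsto: "(B \<longlongrightarrow> B xs) F"
proof -
  have "(g \<longlongrightarrow> g xs) F"
    by (intro F_tendsto differentiable_imp_continuous_within g_diff W)
  moreover have "\<forall>\<^sub>F x in F. g x = B x" using F_in by (rule eventually_mono) (simp add: B_eq)
  ultimately show ?thesis using B_eq[of xs] W xs Lim_transform_eventually by force
qed

definition m :: "real^'n^'n" where
  "m = (\<chi> i k. if i = k \<and> xs $ i \<noteq> 0 then 1 else 0)"

definition \<sigma> :: "real^'n" where "\<sigma> = (\<chi> i. sgn (xs $ i))"

lemma m_mult: "(m *v z) $ i = (if xs $ i \<noteq> 0 then z $ i else 0)"
proof -
  have "(m *v z) $ i = (\<Sum>k\<in>UNIV. if k = i then (if xs $ i \<noteq> 0 then z $ i else 0) else 0)"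
    unfolding m_def matrix_vector_mult_def vec_lambda_beta by (rule sum.cong) auto
  then show ?thesis by simp
qed

lemma m_idem: "m ** m = m"
  by (simp add: matrix_eq matrix_vector_mul_assoc[symmetric] vec_eq_iff m_mult)

text \<open>
  Soft thresholding returns a nonzero entry exactly when its argument exceeds \<open>t * \<mu>\<close> in modulus, so
  \<open>assumption_B\<close> determines the active coordinates, and by continuity of \<open>v\<close> the signs of those entries are
  the signs at \<open>xs\<close>. On the active block the proximal equation is then smooth, on the rest it reads
  \<open>v x = - x\<close>; the latter is written with \<open>x - xs\<close>, as \<open>xs\<close> vanishes there.
\<close>

lemma active_set_identified:
  "\<forall>\<^sub>F x in F. M_mat f \<mu> t (B x) (lam x) x = m \<and>
     m *v v x = - (t *\<^sub>R (m *v (grad f x + B x *v lam x + \<mu> *\<^sub>R \<sigma>))) \<and>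
     v x - m *v v x = - (E x - m *v E x)"
proof -
  obtain U where U: "open U" "xs \<in> U"
    "\<And>x i. x \<in> \<M> \<inter> U \<Longrightarrow> (xs $ i \<noteq> 0 \<longrightarrow> (x + v x) $ i \<noteq> 0) \<and> (xs $ i = 0 \<longrightarrow> (x + v x) $ i = 0)"
    using asm_B unfolding assumption_B_def by blast
  have ev1: "\<forall>\<^sub>F x in F. x \<in> \<M> \<inter> U"
    using eventually_nhds_in_open[OF U(1,2)] unfolding eventually_inf_principal
    by (rule eventually_mono) blast
  have lxv: "((\<lambda>x. x + v x) \<longlongrightarrow> xs + v xs) F"
    by (intro tendsto_add v_tendsto[OF xs] F_tendsto[where h = "\<lambda>x. x"] continuous_ident)
  have "\<forall>\<^sub>F x in F. \<forall>i. xs $ i \<noteq> 0 \<longrightarrow> sgn ((x + v x) $ i) = sgn (xs $ i)"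
  proof (intro eventually_all_finite)
    fix i
    have l: "((\<lambda>x. (x + v x) $ i) \<longlongrightarrow> xs $ i) F"
      using tendsto_vec_nth[OF lxv, of i] v_xs by simp
    show "\<forall>\<^sub>F x in F. xs $ i \<noteq> 0 \<longrightarrow> sgn ((x + v x) $ i) = sgn (xs $ i)"
    proof (cases "xs $ i" "0 :: real" rule: linorder_cases)
      case less
      then show ?thesis using order_tendstoD(2)[OF l less] by (auto elim: eventually_mono)
    next
      case greater
      then show ?thesis using order_tendstoD(1)[OF l greater] by (auto elim: eventually_mono)
    qed simp
  qed
  with ev1 show ?thesis
  proof eventually_elim
    case (elim x)
    then have xM: "x \<in> \<M>" and supp: "\<And>i. ((x + v x) $ i \<noteq> 0) = (xs $ i \<noteq> 0)"
      using U(3)[of x] by blast+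
    let ?z = "prox_arg f t (B x) (lam x) x"
    have "v x = prox_l1 t \<mu> ?z - x" using multiplier[OF xM] unfolding is_multiplier_def by blast
    then have xv: "(x + v x) $ i = max (\<bar>?z $ i\<bar> - t * \<mu>) 0 * sgn (?z $ i)" for i
      by (simp add: prox_l1_def)
    have tmu: "t * \<mu> > 0" using t_pos mu_pos by simp
    have act: "(\<not> \<bar>?z $ i\<bar> \<le> t * \<mu>) = (xs $ i \<noteq> 0)" for i
      using supp[of i] tmu unfolding xv by (auto simp: max_def sgn_if split: if_splits)
    then have M: "M_mat f \<mu> t (B x) (lam x) x = m"
      unfolding M_mat_def m_def by simp
    have on: "v x $ i = - (t * (grad f x + B x *v lam x + \<mu> *\<^sub>R \<sigma>) $ i)" if i: "xs $ i \<noteq> 0" for i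
    proof -
      have z: "\<bar>?z $ i\<bar> > t * \<mu>" using act[of i] i by simp
      then have "sgn ((x + v x) $ i) = sgn (?z $ i)"
        unfolding xv using tmu by (auto simp: sgn_if max_def)
      then have "sgn (?z $ i) = \<sigma> $ i" using elim(2) i by (simp add: \<sigma>_def)
      moreover have "(x + v x) $ i = ?z $ i - t * \<mu> * sgn (?z $ i)"
        unfolding xv using z tmu by (auto simp: sgn_if max_def)
      ultimately show ?thesis by (simp add: prox_arg_def algebra_simps)
    qed
    have off: "v x $ i = - x $ i" if "xs $ i = 0" for i
      using supp[of i] that by simp
    show ?case
      using M on off by (auto simp: vec_eq_iff m_mult)
  qed
qed

definition A where "A x = transpose (B x) ** m ** B x"
definition H where "H x = matrix_inv (A x)"
definition \<Lambda> where "\<Lambda> x = m - m ** B x ** H x ** transpose (B x) ** m"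

lemmas tendsto_matrix = bounded_bilinear.tendsto[OF bounded_bilinear_matrix_matrix]
lemmas tendsto_matrix_vec = bounded_bilinear.tendsto[OF bounded_bilinear_matrix_vector]
lemmas tendsto_transpose = bounded_linear.tendsto[OF bounded_linear_transpose]

lemma A_tendsto: "(A \<longlongrightarrow> A xs) F"
  unfolding A_def by (intro tendsto_matrix tendsto_transpose tendsto_const B_tendsto)

lemma BMB_eq: "\<forall>\<^sub>F x in F. BMB f \<mu> t (B x) (lam x) x = A x"
  using active_set_identified by (rule eventually_mono) (simp add: BMB_def A_def)

lemma A_invertible_xs: "invertible (A xs)"
  using J_xs eventually_nhds_in[OF xs BMB_eq] unfolding J_nonsingular_def by simp

lemma A_invertible: "\<forall>\<^sub>F x in F. invertible (A x)"
  by (rule tendsto_matrix_inv(2)[OF A_tendsto A_invertible_xs])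

lemma H_tendsto: "(H \<longlongrightarrow> H xs) F"
  unfolding H_def by (rule tendsto_matrix_inv(1)[OF A_tendsto A_invertible_xs])

lemma \<Lambda>_tendsto: "(\<Lambda> \<longlongrightarrow> \<Lambda> xs) F"
  unfolding \<Lambda>_def
  by (intro tendsto_diff tendsto_matrix tendsto_transpose tendsto_const B_tendsto H_tendsto)

lemma \<Lambda>_algebra:
  assumes "invertible (A x)"
  shows "\<Lambda> x *v (B x *v y) = 0" "transpose (B x) *v (\<Lambda> x *v z) = 0" "\<Lambda> x *v (m *v z) = \<Lambda> x *v z"
  using reduced_projection_algebra[OF m_idem assms[unfolded A_def], folded A_def, folded H_def, folded \<Lambda>_def]
  by (simp_all add: matrix_vector_mul_assoc)

lemma H_cancel: "invertible (A x) \<Longrightarrow> H x *v (transpose (B x) *v (m *v (B x *v y))) = y"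
  using matrix_inv_inverse(1)[of "A x", folded H_def]
  by (simp add: matrix_vector_mul_assoc A_def matrix_mul_assoc)

lemma Lambda_mat_eq: "\<forall>\<^sub>F x in F. Lambda_mat f \<mu> t (B x) (lam x) x = \<Lambda> x"
  using active_set_identified BMB_eq
  by eventually_elim (simp add: Lambda_mat_def Let_def \<Lambda>_def H_def)

definition DB where "DB x w = frechet_derivative g (at x) w"

lemma DB_linear: "x \<in> W \<Longrightarrow> linear (DB x)"
  using linear_frechet_derivative[OF g_diff] unfolding DB_def[abs_def] .

text \<open>
  Differentiate \<open>mat 1 - g y ** transpose (g y)\<close>. The second term is a normal vector, which \<open>\<Lambda> x\<close> annihilates.
\<close>

lemma Weingarten_frame:
  assumes x: "x \<in> W \<inter> \<M>" and w: "w \<in> T x"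
  shows "Weingarten \<M> x w (B x *v y) = - (DB x w *v y) - B x *v (transpose (DB x w) *v (B x *v y))"
proof -
  have dg: "(g has_derivative DB x) (at x within \<M>)"
    using g_diff[of x] x unfolding DB_def[abs_def] frechet_derivative_works
    by (blast intro: has_derivative_at_withinI)
  have "((\<lambda>y. mat 1 - g y ** transpose (g y)) has_derivative
      (\<lambda>h. 0 - (g x ** transpose (DB x h) + DB x h ** transpose (g x)))) (at x within \<M>)"
    by (intro has_derivative_diff has_derivative_const
        bounded_bilinear.FDERIV[OF bounded_bilinear_matrix_matrix]
        bounded_linear.has_derivative[OF bounded_linear_transpose] dg)
  moreover obtain d where d: "d > 0" "ball x d \<subseteq> W" using W(1) x open_contains_ball by blast
  moreover have "P y = mat 1 - g y ** transpose (g y)" if "y \<in> W \<inter> \<M>" for y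
    using frame_facts(3)[of y] B_eq[OF that] that by simp
  ultimately have "(P has_derivative (\<lambda>h. 0 - (g x ** transpose (DB x h) + DB x h ** transpose (g x)))) (at x within \<M>)"
    using x by (elim has_derivative_transform_within[OF _ d(1)]) (auto simp: dist_commute subset_iff)
  from Weingarten_eq[OF this w, of "B x *v y"]
  have "Weingarten \<M> x w (B x *v y) = (0 - (B x ** transpose (DB x w) + DB x w ** transpose (B x))) *v (B x *v y)"
    using B_eq[OF x] by simp
  also have "\<dots> = - (B x *v (transpose (DB x w) *v (B x *v y))) - DB x w *v ((transpose (B x) ** B x) *v y)"
    by (simp only: matrix_vector_mult_diff_rdistrib matrix_vector_mult_add_rdistrib matrix_vector_mult_0)
      (simp add: matrix_vector_mul_assoc matrix_mul_assoc)
  finally show ?thesis using frame_facts(1)[of x] x by simp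
qed

text \<open>
  The part of the Weingarten term, up to sign, that survives multiplication by \<open>\<Lambda> x\<close>.
\<close>

definition Q :: "real^'n \<Rightarrow> real^'n^'n" where
  "Q x = matrix (\<lambda>w. DB x w *v lam x)"

lemma Q_mult: "x \<in> W \<Longrightarrow> Q x *v w = DB x w *v lam x"
proof -
  assume "x \<in> W"
  then have "linear (\<lambda>w. DB x w *v lam x)"
    by (intro linearI) (simp_all add: linear_add[OF DB_linear] linear_cmul[OF DB_linear]
        matrix_vector_mult_add_rdistrib scaleR_matrix_vector_assoc)
  then show ?thesis unfolding Q_def by simp
qed

text \<open>
  An extension of \<open>J(x)\<close> from the tangent space to the ambient space, in order to compare the operators at
  different points.
\<close>

definition Jm :: "real^'n \<Rightarrow> real^'n^'n" where
  "Jm x = - (mat 1 - \<Lambda> x + t *\<^sub>R (\<Lambda> x ** (hessian f x + Q x)))"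

lemma Jm_mult:
  "x \<in> W \<Longrightarrow> Jm x *v w = - (w - \<Lambda> x *v w + t *\<^sub>R (\<Lambda> x *v (hessian f x *v w + DB x w *v lam x)))"
proof -
  assume x: "x \<in> W"
  show ?thesis
    unfolding Jm_def matrix_vector_mult_minus
    by (simp add: matrix_vector_mult_add_rdistrib matrix_vector_mult_diff_rdistrib
        scaleR_matrix_vector_assoc[symmetric] matrix_vector_mul_assoc[symmetric] Q_mult[OF x])
qed

lemma J_op_eq: "\<forall>\<^sub>F x in F. \<forall>w\<in>T x. J_op \<M> f \<mu> t (B x) (lam x) x w = Jm x *v w"
  using Lambda_mat_eq A_invertible F_in
proof eventually_elim
  case (elim x)
  show ?case
  proof
    fix w assume w: "w \<in> T x"
    have "\<Lambda> x *v (hessian f x *v w - Weingarten \<M> x w (B x *v lam x))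
        = \<Lambda> x *v (hessian f x *v w + DB x w *v lam x)"
      unfolding Weingarten_frame[OF elim(3) w]
      by (simp add: matrix_vector_right_distrib matrix_vector_mult_diff_distrib \<Lambda>_algebra(1)[OF elim(2)])
    then show "J_op \<M> f \<mu> t (B x) (lam x) x w = Jm x *v w"
      using elim by (simp add: J_op_def Let_def Jm_mult)
  qed
qed

lemma lin_grad: "frechet_derivative (grad f) (at x) w = hessian f x *v w"
  unfolding hessian_def jacobian_def
  using linear_frechet_derivative[OF grad_differentiable] by simp

lemma hessian_tendsto: "(hessian f \<longlongrightarrow> hessian f xs) F"
proof (rule F_tendsto)
  have "derivative_matrix (grad f) differentiable (at xs)"
    by (rule derivative_matrix_differentiable[OF grad_C2[OF f_smooth] UNIV_I])
  then show "isCont (hessian f) xs"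
    unfolding hessian_def[abs_def] jacobian_def derivative_matrix_def[abs_def]
    by (rule differentiable_imp_continuous_within)
qed

lemma ord_B: "ord (Suc 0) (\<lambda>x. B x - B xs)"
proof (rule vanishes_cong)
  show "ord (Suc 0) (\<lambda>x. g x - g xs)"
    using C_diff_on_SucD[of "Suc 0" W g] g_smooth
    by (intro vanishes_C1[OF W(1) _ W(2) F_le]) (simp add: numeral_2_eq_2)
  show "\<forall>\<^sub>F x in F. B x - B xs = g x - g xs"
    using F_in by (rule eventually_mono) (use B_eq W(2) xs in auto)
qed

lemma ord_B2: "ord 2 (\<lambda>x. B x - B xs - DB x (E x))"
proof (rule vanishes_cong)
  show "ord 2 (\<lambda>x. g x - g xs - frechet_derivative g (at x) (E x))"
    by (rule vanishes_C2[OF W(1) g_smooth W(2) F_le])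
  show "\<forall>\<^sub>F x in F. B x - B xs - DB x (E x) = g x - g xs - frechet_derivative g (at x) (E x)"
    using F_in by (rule eventually_mono) (use B_eq W(2) xs in \<open>auto simp: DB_def\<close>)
qed

lemma ord_grad2: "ord 2 (\<lambda>x. grad f x - grad f xs - hessian f x *v E x)"
  using vanishes_C2[OF open_UNIV grad_C2[OF f_smooth] UNIV_I F_le] unfolding lin_grad .

lemma ord_grad: "ord (Suc 0) (\<lambda>x. grad f x - grad f xs)"
  using C_diff_on_SucD[of "Suc 0" UNIV "grad f"] grad_C2[OF f_smooth]
  by (intro vanishes_C1[OF open_UNIV _ UNIV_I F_le]) (simp add: numeral_2_eq_2)

text \<open>
  Apply \<open>\<Lambda> x\<close> to the active block of the proximal equation at \<open>x\<close>, which removes \<open>B x *v lam x\<close>, and subtract the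
  same equation at \<open>xs\<close>, where \<open>v xs = 0\<close>. Apart from the gradients, only the difference of the frames
  remains, applied to the multiplier at the limit.
\<close>

lemma \<Lambda>_v: "\<forall>\<^sub>F x in F. \<Lambda> x *v v x = - (t *\<^sub>R (\<Lambda> x *v ((grad f x - grad f xs) + (B x - B xs) *v lam xs)))"
  using active_set_identified A_invertible
proof eventually_elim
  case (elim x)
  have xs0: "m *v (grad f xs + B xs *v lam xs + \<mu> *\<^sub>R \<sigma>) = 0"
    using eventually_nhds_in[OF xs active_set_identified] v_xs t_pos by simp
  have "\<Lambda> x *v v x = \<Lambda> x *v (m *v v x)" by (simp add: \<Lambda>_algebra(3)[OF elim(2)])
  also have "\<dots> = - (t *\<^sub>R (\<Lambda> x *v (m *v (grad f x + B x *v lam x + \<mu> *\<^sub>R \<sigma>))))"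
    using elim(1) by (simp add: matrix_vector_mult_scaleR)
  also have "\<Lambda> x *v (m *v (grad f x + B x *v lam x + \<mu> *\<^sub>R \<sigma>)) = \<Lambda> x *v (grad f x + \<mu> *\<^sub>R \<sigma>)"
    by (simp add: \<Lambda>_algebra[OF elim(2)] matrix_vector_right_distrib)
  also have "\<dots> = \<Lambda> x *v (grad f x + \<mu> *\<^sub>R \<sigma>) - \<Lambda> x *v (m *v (grad f xs + B xs *v lam xs + \<mu> *\<^sub>R \<sigma>))"
    by (simp add: xs0)
  also have "\<dots> = \<Lambda> x *v ((grad f x - grad f xs) + (B x - B xs) *v lam xs)"
    by (simp add: \<Lambda>_algebra[OF elim(2)] matrix_vector_right_distrib matrix_vector_mult_diff_distrib
        matrix_vector_mult_diff_rdistrib)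
  finally show ?case .
qed

text \<open>
  What \<open>v x\<close> contains besides \<open>\<Lambda> x *v v x\<close>: the inactive entries of \<open>v x\<close> are those of \<open>- x\<close>, and tangency of
  \<open>v x\<close> forces a compensation in the active block.
\<close>

definition N0 where "N0 x = m ** B x ** H x ** transpose (B x) ** (mat 1 - m) - (mat 1 - m)"

lemma N0_tendsto: "(N0 \<longlongrightarrow> N0 xs) F"
  unfolding N0_def
  by (intro tendsto_diff tendsto_matrix tendsto_transpose tendsto_const B_tendsto H_tendsto)

lemma v_split: "\<forall>\<^sub>F x in F. v x = N0 x *v E x + \<Lambda> x *v v x"
  using active_set_identified F_in
proof eventually_elim
  case (elim x)
  have Bv: "transpose (B x) *v v x = 0" using v_tangent[of x] frame_facts(2)[of x] elim(2) by blast
  have off: "v x - m *v v x = - (E x - m *v E x)" using elim(1) by blast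
  have "m *v v x = v x - (v x - m *v v x)" by simp
  also have "\<dots> = v x + (E x - m *v E x)" unfolding off by simp
  finally have "transpose (B x) *v (m *v v x) = transpose (B x) *v (E x - m *v E x)"
    using Bv by (simp add: matrix_vector_right_distrib)
  then have "\<Lambda> x *v v x = m *v v x - m *v (B x *v (H x *v (transpose (B x) *v (E x - m *v E x))))"
    unfolding \<Lambda>_def by (simp add: matrix_vector_mult_diff_rdistrib matrix_vector_mul_assoc[symmetric])
  moreover have "N0 x *v E x = m *v (B x *v (H x *v (transpose (B x) *v (E x - m *v E x)))) - (E x - m *v E x)"
    unfolding N0_def by (simp add: matrix_vector_mult_diff_rdistrib matrix_vector_mul_assoc[symmetric])
  ultimately have "N0 x *v E x + \<Lambda> x *v v x = m *v v x + - (E x - m *v E x)" by simp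
  then show ?case unfolding off[symmetric] by simp
qed

lemma ord_E: "ord (Suc 0) (\<lambda>x. E x)" by (rule vanishes_self)

lemma ord_const: "ord 0 (\<lambda>x. c)" by (rule vanishes_0_of_tendsto[OF tendsto_const])

lemma ord_v: "ord (Suc 0) v"
proof (rule vanishes_cong)
  have "ord (0 + Suc 0) (\<lambda>x. N0 x *v E x)"
    by (intro vanishes_mult_vec vanishes_0_of_tendsto[OF N0_tendsto] ord_E)
  moreover have "ord (0 + (0 + Suc 0)) (\<lambda>x. t *\<^sub>R (\<Lambda> x *v ((grad f x - grad f xs) + (B x - B xs) *v lam xs)))"
    using vanishes_mult_vec[OF ord_B ord_const]
    by (intro vanishes_scaleR vanishes_mult_vec ord_const vanishes_0_of_tendsto[OF \<Lambda>_tendsto]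
        vanishes_add ord_grad) simp
  ultimately show "ord (Suc 0) (\<lambda>x. N0 x *v E x - t *\<^sub>R (\<Lambda> x *v ((grad f x - grad f xs) + (B x - B xs) *v lam xs)))"
    by (intro vanishes_diff) auto
  show "\<forall>\<^sub>F x in F. v x = N0 x *v E x - t *\<^sub>R (\<Lambda> x *v ((grad f x - grad f xs) + (B x - B xs) *v lam xs))"
    using v_split \<Lambda>_v by eventually_elim simp
qed

text \<open>
  The active block of the proximal equation determines \<open>m *v (B x *v lam x)\<close>, from which \<open>H_cancel\<close> recovers
  the multiplier. So it is Lipschitz at \<open>xs\<close> because \<open>v\<close>, the gradient and the frame are.
\<close>

lemma ord_lam: "ord (Suc 0) (\<lambda>x. lam x - lam xs)"
proof (rule vanishes_cong)
  let ?y = "\<lambda>x. - ((1 / t) *\<^sub>R (m *v v x)) - m *v (grad f x - grad f xs) - m *v ((B x - B xs) *v lam xs)"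
  have "ord (0 + (0 + Suc 0)) (\<lambda>x. (1 / t) *\<^sub>R (m *v v x))"
    by (intro vanishes_scaleR vanishes_mult_vec ord_const ord_v)
  moreover have "ord (0 + Suc 0) (\<lambda>x. m *v (grad f x - grad f xs))"
    by (intro vanishes_mult_vec ord_const ord_grad)
  moreover have "ord (0 + (Suc 0 + 0)) (\<lambda>x. m *v ((B x - B xs) *v lam xs))"
    by (intro vanishes_mult_vec ord_const ord_B)
  ultimately have "ord (Suc 0) ?y" by (intro vanishes_diff vanishes_minus) auto
  moreover have "((\<lambda>x. H x ** transpose (B x)) \<longlongrightarrow> H xs ** transpose (B xs)) F"
    by (intro tendsto_matrix tendsto_transpose H_tendsto B_tendsto)
  ultimately have "ord (0 + Suc 0) (\<lambda>x. (H x ** transpose (B x)) *v ?y x)"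
    by (intro vanishes_mult_vec vanishes_0_of_tendsto)
  then show "ord (Suc 0) (\<lambda>x. (H x ** transpose (B x)) *v ?y x)" by simp
  show "\<forall>\<^sub>F x in F. lam x - lam xs = (H x ** transpose (B x)) *v ?y x"
    using active_set_identified A_invertible
  proof eventually_elim
    case (elim x)
    have xs0: "m *v (grad f xs + B xs *v lam xs + \<mu> *\<^sub>R \<sigma>) = 0"
      using eventually_nhds_in[OF xs active_set_identified] v_xs t_pos by simp
    have "- ((1 / t) *\<^sub>R (m *v v x)) = m *v (grad f x + B x *v lam x + \<mu> *\<^sub>R \<sigma>)"
      using elim(1) t_pos by simp
    then have "- ((1 / t) *\<^sub>R (m *v v x)) = m *v (grad f x + B x *v lam x + \<mu> *\<^sub>R \<sigma>) - m *v (grad f xs + B xs *v lam xs + \<mu> *\<^sub>R \<sigma>)"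
      by (simp add: xs0)
    then have "?y x = m *v (B x *v (lam x - lam xs))"
      by (simp add: matrix_vector_right_distrib matrix_vector_mult_diff_distrib matrix_vector_mult_diff_rdistrib)
    then show ?case
      using H_cancel[OF elim(2), of "lam x - lam xs"] by (simp add: matrix_vector_mul_assoc[symmetric])
  qed
qed

lemma lam_tendsto: "(lam \<longlongrightarrow> lam xs) F"
  using vanishes_tendsto_0[OF F_le ord_lam] by (simp add: Lim_null[symmetric])

lemma Q_tendsto: "(Q \<longlongrightarrow> Q xs) F"
  unfolding Q_def matrix_def
proof (intro tendsto_vec_lambda tendsto_vec_nth tendsto_matrix_vec lam_tendsto)
  fix j :: 'n
  have "continuous_on W (\<lambda>x. DB x (axis j 1))"
    unfolding DB_def by (rule C_diff_on_imp_continuous_on[of "Suc 0"])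
      (use g_smooth in \<open>simp add: numeral_2_eq_2\<close>)
  then show "((\<lambda>x. DB x (axis j 1)) \<longlongrightarrow> DB xs (axis j 1)) F"
    using W continuous_on_eq_continuous_at by (intro F_tendsto) blast
qed

lemma Jm_tendsto: "(Jm \<longlongrightarrow> Jm xs) F"
  unfolding Jm_def
  by (intro tendsto_minus tendsto_add tendsto_diff tendsto_scaleR tendsto_matrix tendsto_const
      \<Lambda>_tendsto hessian_tendsto Q_tendsto)

lemma P_tendsto: "(P \<longlongrightarrow> P xs) F"
  by (intro tendsto_nhds_in differentiable_imp_continuous_within Proj_differentiable[OF submanifold xs])

lemma ord_secant: "ord 2 (\<lambda>x. E x - P x *v E x)"
proof -
  obtain K where "K \<ge> 0" "\<forall>\<^sub>F x in nhds xs. x \<in> \<M> \<longrightarrow> norm (E x - P x *v E x) \<le> K * (norm (E x))\<^sup>2"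
    by (rule secant_almost_tangent[OF submanifold xs])
  then show ?thesis by (intro vanishesI[of K]) (simp_all add: eventually_inf_principal)
qed

text \<open>
  In \<open>\<Lambda>_v\<close> replace the differences of the gradient and of the frame by their linearizations at \<open>x\<close>, and the
  multiplier at \<open>xs\<close> by the one at \<open>x\<close>; the errors \<open>?r1\<close> and \<open>?r2\<close> are quadratic. The resulting
  matrix agrees with \<open>Jm x\<close> only on tangent vectors, so \<open>x - xs\<close> is also replaced by its tangential part.
\<close>

lemma v_newton_expansion: "ord 2 (\<lambda>x. v x - Jm x *v (P x *v E x))"
proof (rule vanishes_cong)
  let ?N = "\<lambda>x. N0 x - t *\<^sub>R (\<Lambda> x ** (hessian f x + Q x))"
  let ?r1 = "\<lambda>x. grad f x - grad f xs - hessian f x *v E x"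
  let ?r2 = "\<lambda>x. (B x - B xs - DB x (E x)) *v lam xs - DB x (E x) *v (lam x - lam xs)"
  have DBE: "ord (Suc 0) (\<lambda>x. DB x (E x))"
  proof (rule vanishes_cong)
    show "ord (Suc 0) (\<lambda>x. (B x - B xs) - (B x - B xs - DB x (E x)))"
      by (intro vanishes_diff ord_B vanishes_le[OF F_le ord_B2]) simp
  qed simp
  have "ord (2 + 0) (\<lambda>x. (B x - B xs - DB x (E x)) *v lam xs)"
    by (intro vanishes_mult_vec ord_B2 ord_const)
  moreover have "ord (Suc 0 + Suc 0) (\<lambda>x. DB x (E x) *v (lam x - lam xs))"
    by (intro vanishes_mult_vec DBE ord_lam)
  ultimately have "ord 2 (\<lambda>x. ?r1 x + ?r2 x)"
    by (intro vanishes_add vanishes_diff ord_grad2) (simp_all add: numeral_2_eq_2)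
  then have o1: "ord (0 + (0 + 2)) (\<lambda>x. t *\<^sub>R (\<Lambda> x *v (?r1 x + ?r2 x)))"
    by (intro vanishes_scaleR vanishes_mult_vec ord_const vanishes_0_of_tendsto[OF \<Lambda>_tendsto])
  have "(?N \<longlongrightarrow> ?N xs) F"
    by (intro tendsto_add tendsto_diff tendsto_scaleR tendsto_matrix tendsto_const
      \<Lambda>_tendsto hessian_tendsto Q_tendsto N0_tendsto)
  then have "ord (0 + 2) (\<lambda>x. ?N x *v (E x - P x *v E x))"
    by (intro vanishes_mult_vec ord_secant vanishes_0_of_tendsto)
  then show "ord 2 (\<lambda>x. ?N x *v (E x - P x *v E x) - t *\<^sub>R (\<Lambda> x *v (?r1 x + ?r2 x)))"
    using o1 unfolding add_0 by (rule vanishes_diff)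
  show "\<forall>\<^sub>F x in F. v x - Jm x *v (P x *v E x) = ?N x *v (E x - P x *v E x) - t *\<^sub>R (\<Lambda> x *v (?r1 x + ?r2 x))"
    using v_split \<Lambda>_v F_in
  proof eventually_elim
    case (elim x)
    let ?w = "P x *v E x"
    have xW: "x \<in> W" and xM: "x \<in> \<M>" using elim(3) by auto
    have "?w \<in> T x" by (rule Proj_facts(1)[OF submanifold xM])
    then have Bw: "transpose (B x) *v ?w = 0" using frame_facts(2)[of x] xM by blast
    have mulN: "?N x *v z = N0 x *v z - t *\<^sub>R (\<Lambda> x *v (hessian f x *v z + DB x z *v lam x))" for z
      by (simp add: matrix_vector_mult_diff_rdistrib scaleR_matrix_vector_assoc[symmetric]
          matrix_vector_mul_assoc[symmetric] matrix_vector_mult_add_rdistrib Q_mult[OF xW])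
    have N0w: "N0 x *v w = - (w - \<Lambda> x *v w)" if "transpose (B x) *v w = 0" for w
      unfolding N0_def \<Lambda>_def
      by (simp add: matrix_vector_mult_diff_rdistrib matrix_vector_mul_assoc[symmetric]
          matrix_vector_mult_diff_distrib that)
    have Jw: "Jm x *v ?w = ?N x *v ?w" unfolding mulN Jm_mult[OF xW] N0w[OF Bw] by simp
    let ?X = "hessian f x *v E x + DB x (E x) *v lam x" and ?Y = "?r1 x + ?r2 x"
    have split: "(grad f x - grad f xs) + (B x - B xs) *v lam xs = ?X + ?Y"
      by (simp add: matrix_vector_mult_diff_rdistrib matrix_vector_mult_diff_distrib)
    have "\<Lambda> x *v v x = - (t *\<^sub>R (\<Lambda> x *v ?X)) - t *\<^sub>R (\<Lambda> x *v ?Y)"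
      using elim(2) unfolding split matrix_vector_right_distrib[of "\<Lambda> x" ?X ?Y] scaleR_right_distrib
      by simp
    then have "N0 x *v E x + \<Lambda> x *v v x = ?N x *v E x - t *\<^sub>R (\<Lambda> x *v ?Y)"
      unfolding mulN by (simp only: diff_conv_add_uminus add.assoc)
    with elim(1) have "v x = ?N x *v E x - t *\<^sub>R (\<Lambda> x *v ?Y)" by (rule trans)
    then show ?case unfolding Jw by (simp add: matrix_vector_mult_diff_distrib)
  qed
qed

text \<open>
  \<open>J(x)\<close> on the tangent space and the identity on the normal space. As a matrix on the whole ambient space it
  depends continuously on \<open>x\<close>, so invertibility and a bound on the inverse propagate from \<open>xs\<close>.
\<close>

definition K where "K x = Jm x ** P x + (mat 1 - P x)"

lemma K_mult: "K x *v z = Jm x *v (P x *v z) + (z - P x *v z)"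
  unfolding K_def by (simp add: matrix_vector_mult_add_rdistrib matrix_vector_mult_diff_rdistrib
      matrix_vector_mul_assoc)

lemma K_tendsto: "(K \<longlongrightarrow> K xs) F"
  unfolding K_def by (intro tendsto_add tendsto_diff tendsto_matrix tendsto_const Jm_tendsto P_tendsto)

lemma Jm_tangent: "\<forall>\<^sub>F x in F. \<forall>w\<in>T x. Jm x *v w \<in> T x"
  using A_invertible F_in
proof eventually_elim
  case (elim x)
  have T: "T x = {w. transpose (B x) *v w = 0}" using frame_facts(2)[of x] elim(2) by blast
  show ?case
    unfolding T using elim(2)
    by (auto simp: Jm_mult matrix_vector_right_distrib matrix_vector_mult_diff_distrib
        matrix_vector_mult_scaleR \<Lambda>_algebra(2)[OF elim(1)])
qed

lemma K_preimage_tangent: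
  assumes x: "x \<in> \<M>" and J: "\<And>w. w \<in> T x \<Longrightarrow> Jm x *v w \<in> T x" and Kz: "K x *v z \<in> T x"
  shows "P x *v z = z" "z \<in> T x"
proof -
  note PF = Proj_facts[OF submanifold x]
  have "z - P x *v z = K x *v z - Jm x *v (P x *v z)" by (simp add: K_mult)
  also have "\<dots> \<in> T x" by (intro subspace_diff[OF T_subspace[OF x]] Kz J PF)
  finally have "P x *v (z - P x *v z) = z - P x *v z" by (rule PF(2))
  moreover have "P x *v (z - P x *v z) = 0"
    by (simp add: matrix_vector_mult_diff_distrib PF(2)[OF PF(1)])
  ultimately show eq: "P x *v z = z" by simp
  show "z \<in> T x" using PF(1)[of z] unfolding eq .
qed

lemma K_invertible_xs: "invertible (K xs)"
proof -
  have "z = 0" if z: "K xs *v z = 0" for z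
  proof -
    note J = eventually_nhds_in[OF xs Jm_tangent, rule_format]
    note zP = K_preimage_tangent[OF xs J, of z]
    have zT: "P xs *v z = z" "z \<in> T xs" using zP z subspace_0[OF T_subspace[OF xs]] by simp_all
    then have "Jm xs *v z = 0" using z by (simp add: K_mult)
    then have "J_op \<M> f \<mu> t (B xs) (lam xs) xs z = J_op \<M> f \<mu> t (B xs) (lam xs) xs 0"
      using eventually_nhds_in[OF xs J_op_eq] zT(2) subspace_0[OF T_subspace[OF xs]] by simp
    then show ?thesis
      using J_xs zT(2) subspace_0[OF T_subspace[OF xs]]
      unfolding J_nonsingular_def bij_betw_def by (meson inj_onD)
  qed
  then show ?thesis by (metis invertible_left_inverse matrix_left_invertible_ker)
qed

lemma K_invertible: "\<forall>\<^sub>F x in F. invertible (K x)"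
  by (rule tendsto_matrix_inv(2)[OF K_tendsto K_invertible_xs])

lemma J_nonsingular_nearby: "\<forall>\<^sub>F x in F. J_nonsingular \<M> f \<mu> t (B x) (lam x) x"
  using K_invertible Jm_tangent J_op_eq BMB_eq A_invertible F_in
proof eventually_elim
  case (elim x)
  have x: "x \<in> \<M>" using elim(6) by blast
  note PF = Proj_facts[OF submanifold x] and KI = matrix_inv_inverse[OF elim(1)]
  have KJ: "K x *v w = Jm x *v w" if "w \<in> T x" for w using PF(2)[OF that] by (simp add: K_mult)
  have "bij_betw ((*v) (Jm x)) (T x) (T x)"
  proof (rule bij_betw_byWitness[where f' = "(*v) (matrix_inv (K x))"])
    show "\<forall>a\<in>T x. matrix_inv (K x) *v (Jm x *v a) = a"
      by (simp add: KJ[symmetric] matrix_vector_mul_assoc KI)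
    have *: "K x *v (matrix_inv (K x) *v a) = a" for a by (simp add: matrix_vector_mul_assoc KI)
    have Kin: "matrix_inv (K x) *v a \<in> T x" if "a \<in> T x" for a
      using K_preimage_tangent(2)[OF x, of "matrix_inv (K x) *v a"] elim(2) that * by simp
    then show "\<forall>a\<in>T x. Jm x *v (matrix_inv (K x) *v a) = a" by (simp add: KJ[symmetric] *)
    show "(*v) (Jm x) ` T x \<subseteq> T x" "(*v) (matrix_inv (K x)) ` T x \<subseteq> T x"
      using elim(2) Kin by auto
  qed
  then have "bij_betw (J_op \<M> f \<mu> t (B x) (lam x) x) (T x) (T x)"
    using elim(3) by (subst bij_betw_cong[where g = "(*v) (Jm x)"]) auto
  then show ?case using elim(4,5) unfolding J_nonsingular_def by simp
qed

theorem newton_step_quadratic: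
  obtains C where "C \<ge> 0"
    "\<forall>\<^sub>F x in F. \<forall>x'. phase2_step \<M> R f \<mu> t B lam x x' \<longrightarrow> norm (x' - xs) \<le> C * (norm (x - xs))\<^sup>2"
proof -
  \<comment> \<open>On tangent vectors \<open>K x\<close> acts as \<open>J(x)\<close>, so this is the solution of the linear system of Phase 2.\<close>
  define u where "u x = - (matrix_inv (K x) *v v x)" for x
  have Ki: "ord 0 (\<lambda>x. matrix_inv (K x))"
    by (rule vanishes_0_of_tendsto[OF tendsto_matrix_inv(1)[OF K_tendsto K_invertible_xs]])
  have ord_u: "ord (Suc 0) u"
    using vanishes_minus[OF vanishes_mult_vec[OF Ki ord_v]] unfolding u_def by simp
  have ord_uw: "ord 2 (\<lambda>x. u x + P x *v E x)"
  proof (rule vanishes_cong)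
    show "ord 2 (\<lambda>x. - (matrix_inv (K x) *v (v x - Jm x *v (P x *v E x))))"
      using vanishes_minus[OF vanishes_mult_vec[OF Ki v_newton_expansion]] by (simp only: add_0)
    show "\<forall>\<^sub>F x in F. u x + P x *v E x = - (matrix_inv (K x) *v (v x - Jm x *v (P x *v E x)))"
      using K_invertible F_in
    proof eventually_elim
      case (elim x)
      note PF = Proj_facts[OF submanifold, of x]
      have "K x *v (P x *v E x) = Jm x *v (P x *v E x)"
        using PF elim(2) by (simp add: K_mult)
      then have "matrix_inv (K x) *v (Jm x *v (P x *v E x)) = P x *v E x"
        by (metis matrix_vector_mul_assoc matrix_inv_inverse(1)[OF elim(1)] matrix_vector_mul_lid)
      then show ?case by (simp add: u_def matrix_vector_mult_diff_distrib)
    qed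
  qed
  obtain r KR where R: "r > 0" "KR \<ge> 0"
    "\<And>x u. x \<in> \<M> \<Longrightarrow> u \<in> T x \<Longrightarrow> norm (x - xs) < r \<Longrightarrow> norm u < r \<Longrightarrow>
       norm (R x u - x - u) \<le> KR * (norm u)\<^sup>2"
    using retraction_second_order[OF retraction xs T_subspace] by metis
  obtain Cu where Cu: "Cu \<ge> 0" "\<forall>\<^sub>F x in F. norm (u x) \<le> Cu * norm (x - xs)"
    using ord_u unfolding vanishes_def by auto
  have "ord 2 (\<lambda>x. (E x - P x *v E x) + (u x + P x *v E x))"
    by (intro vanishes_add ord_secant ord_uw)
  then have "ord 2 (\<lambda>x. E x + u x)" by (rule vanishes_cong) simp
  then obtain C2 where C2: "C2 \<ge> 0" "\<forall>\<^sub>F x in F. norm (E x + u x) \<le> C2 * (norm (x - xs))\<^sup>2"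
    unfolding vanishes_def by blast
  have small: "\<forall>\<^sub>F x in F. norm (u x) < r"
    using order_tendstoD(2)[OF tendsto_norm[OF vanishes_tendsto_0[OF F_le ord_u]]] R(1) by simp
  have near: "\<forall>\<^sub>F x in F. norm (E x) < r"
    using order_tendstoD(2)[OF tendsto_norm[OF vanishes_tendsto_0[OF F_le ord_E]]] R(1) by simp
  have "\<forall>\<^sub>F x in F. \<forall>x'. phase2_step \<M> R f \<mu> t B lam x x' \<longrightarrow>
      norm (x' - xs) \<le> (KR * Cu\<^sup>2 + C2) * (norm (x - xs))\<^sup>2"
    using Cu(2) C2(2) small near K_invertible J_op_eq F_in
  proof eventually_elim
    case (elim x)
    have x: "x \<in> \<M>" using elim(7) by blast
    show ?case
    proof (intro allI impI)
      fix x' assume "phase2_step \<M> R f \<mu> t B lam x x'"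
      then obtain u' where u': "u' \<in> T x" "J_op \<M> f \<mu> t (B x) (lam x) x u' = - v x" "x' = R x u'"
        unfolding phase2_step_def by blast
      have "K x *v u' = - v x"
        using u'(1,2) elim(6) Proj_facts(2)[OF submanifold x u'(1)] by (simp add: K_mult)
      then have "matrix_inv (K x) *v (K x *v u') = u x" by (simp add: u_def)
      then have uu: "u' = u x"
        by (simp add: matrix_vector_mul_assoc matrix_inv_inverse(1)[OF elim(5)])
      have "norm (x' - x - u x) \<le> KR * (norm (u x))\<^sup>2"
        using R(3)[OF x u'(1)] elim(3,4) unfolding u'(3) uu by blast
      also have "\<dots> \<le> KR * (Cu * norm (x - xs))\<^sup>2"
        using elim(1) R(2) by (intro mult_left_mono power_mono) auto
      finally have "norm (x' - x - u x) \<le> KR * Cu\<^sup>2 * (norm (x - xs))\<^sup>2"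
        by (simp add: power_mult_distrib)
      then show "norm (x' - xs) \<le> (KR * Cu\<^sup>2 + C2) * (norm (x - xs))\<^sup>2"
        using elim(2) norm_triangle_ineq[of "x' - x - u x" "E x + u x"] by (simp add: distrib_right)
    qed
  qed
  then show ?thesis using that[of "KR * Cu\<^sup>2 + C2"] R(2) C2(1) by simp
qed

end


section \<open>Switching between the phases\<close>

context newton_setting
begin

lemma newton_basin:
  obtains d C where "d > 0"
    "\<And>x. x \<in> \<M> \<Longrightarrow> norm (x - xs) < d \<Longrightarrow> \<exists>x'. phase2_step \<M> R f \<mu> t B lam x x'"
    "\<And>x x'. x \<in> \<M> \<Longrightarrow> norm (x - xs) < d \<Longrightarrow> phase2_step \<M> R f \<mu> t B lam x x' \<Longrightarrow>
       norm (x' - xs) \<le> C * (norm (x - xs))\<^sup>2 \<and> norm (x' - xs) \<le> norm (x - xs) / 2"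
proof -
  obtain C where C: "C \<ge> 0"
    "\<forall>\<^sub>F x in F. \<forall>x'. phase2_step \<M> R f \<mu> t B lam x x' \<longrightarrow> norm (x' - xs) \<le> C * (norm (x - xs))\<^sup>2"
    by (rule newton_step_quadratic)
  have "\<forall>\<^sub>F x in F. J_nonsingular \<M> f \<mu> t (B x) (lam x) x \<and>
      (\<forall>x'. phase2_step \<M> R f \<mu> t B lam x x' \<longrightarrow> norm (x' - xs) \<le> C * (norm (x - xs))\<^sup>2)"
    using J_nonsingular_nearby C(2) by (rule eventually_conj)
  then obtain e where e: "e > 0" "\<And>x. x \<in> \<M> \<Longrightarrow> norm (x - xs) < e \<Longrightarrow>
      J_nonsingular \<M> f \<mu> t (B x) (lam x) x \<and>
      (\<forall>x'. phase2_step \<M> R f \<mu> t B lam x x' \<longrightarrow> norm (x' - xs) \<le> C * (norm (x - xs))\<^sup>2)"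
    unfolding eventually_inf_principal eventually_nhds_metric by (auto simp: dist_norm)
  \<comment> \<open>Within this radius \<open>C * norm (x - xs) \<le> 1 / 2\<close>, so the quadratic bound also halves the distance.\<close>
  define d where "d = min e (1 / (2 * (C + 1)))"
  show ?thesis
  proof (rule that[of d C])
    show "d > 0" using e(1) C(1) by (simp add: d_def)
    fix x assume x: "x \<in> \<M>" "norm (x - xs) < d"
    then have e': "norm (x - xs) < e" by (simp add: d_def)
    have J: "J_nonsingular \<M> f \<mu> t (B x) (lam x) x" using e(2)[OF x(1) e'] by blast
    have "- v x \<in> T x" by (intro subspace_neg T_subspace v_tangent x)
    then obtain u where "u \<in> T x" "J_op \<M> f \<mu> t (B x) (lam x) x u = - v x"
      using J unfolding J_nonsingular_def bij_betw_def by (metis imageE)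
    then show "\<exists>x'. phase2_step \<M> R f \<mu> t B lam x x'"
      using J unfolding phase2_step_def by blast
    fix x' assume step: "phase2_step \<M> R f \<mu> t B lam x x'"
    have q: "norm (x' - xs) \<le> C * (norm (x - xs))\<^sup>2" using e(2)[OF x(1) e'] step by blast
    have "C * norm (x - xs) \<le> C * (1 / (2 * (C + 1)))"
      using x(2) C(1) by (intro mult_left_mono) (auto simp: d_def)
    also have "\<dots> \<le> 1 / 2" using C(1) by (simp add: field_simps)
    finally have "(C * norm (x - xs)) * norm (x - xs) \<le> 1 / 2 * norm (x - xs)"
      by (rule mult_right_mono) simp
    then show "norm (x' - xs) \<le> C * (norm (x - xs))\<^sup>2 \<and> norm (x' - xs) \<le> norm (x - xs) / 2"
      using q by (simp add: power2_eq_square mult.assoc)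
  qed
qed

text \<open>
  Halving the distance keeps the iterates in the basin, which makes the quadratic estimate available at every
  step.
\<close>

lemma newton_iteration_converges:
  assumes d: "\<And>x x'. x \<in> \<M> \<Longrightarrow> norm (x - xs) < d \<Longrightarrow> phase2_step \<M> R f \<mu> t B lam x x' \<Longrightarrow>
       norm (x' - xs) \<le> C * (norm (x - xs))\<^sup>2 \<and> norm (x' - xs) \<le> norm (x - xs) / 2"
    and start: "x k0 \<in> \<M>" "norm (x k0 - xs) < d"
    and step: "\<And>k. k \<ge> k0 \<Longrightarrow> phase2_step \<M> R f \<mu> t B lam (x k) (x (Suc k))"
  shows "converges_quadratically x xs"
proof -
  have inv: "x k \<in> \<M> \<and> norm (x k - xs) \<le> norm (x k0 - xs) * (1 / 2) ^ (k - k0)" if "k \<ge> k0" for k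
    using that
  proof (induction k rule: dec_induct)
    case (step k)
    have "norm (x k0 - xs) * (1 / 2) ^ (k - k0) \<le> norm (x k0 - xs)"
      by (intro mult_left_le power_le_one) auto
    then have "norm (x k - xs) < d" using step.IH start(2) by linarith
    then have "norm (x (Suc k) - xs) \<le> norm (x k - xs) / 2"
      using d[OF _ _ assms(4)[OF step(1)]] step.IH by blast
    also have "\<dots> \<le> norm (x k0 - xs) * (1 / 2) ^ (k - k0) / 2" using step.IH by simp
    finally show ?case
      using step.IH phase2_step_in[OF assms(4)[OF step(1)]] step(1) by (simp add: Suc_diff_le)
  qed (use start in simp)
  have small: "norm (x k - xs) < d" if "k \<ge> k0" for k
  proof -
    have "norm (x k0 - xs) * (1 / 2) ^ (k - k0) \<le> norm (x k0 - xs)"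
      by (intro mult_left_le power_le_one) auto
    then show ?thesis using inv[OF that] start(2) by linarith
  qed
  have "(\<lambda>k. x (k + k0) - xs) \<longlonglongrightarrow> 0"
  proof (rule Lim_null_comparison)
    show "\<forall>\<^sub>F k in sequentially. norm (x (k + k0) - xs) \<le> norm (x k0 - xs) * (1 / 2) ^ k"
      using inv[of "_ + k0"] by (intro always_eventually allI) simp
    have "(\<lambda>k. norm (x k0 - xs) * (1 / 2 :: real) ^ k) \<longlonglongrightarrow> norm (x k0 - xs) * 0"
      by (intro tendsto_mult tendsto_const LIMSEQ_realpow_zero) auto
    then show "(\<lambda>k. norm (x k0 - xs) * (1 / 2 :: real) ^ k) \<longlonglongrightarrow> 0" by simp
  qed
  then have "(\<lambda>k. x (k + k0)) \<longlonglongrightarrow> xs" by (simp add: LIM_zero_iff)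
  then have "x \<longlonglongrightarrow> xs" by (rule LIMSEQ_offset)
  moreover have "\<forall>\<^sub>F k in sequentially. norm (x (Suc k) - xs) \<le> C * (norm (x k - xs))\<^sup>2"
    using eventually_ge_at_top[of k0]
  proof eventually_elim
    case (elim k)
    show ?case using d[OF _ small[OF elim] step[OF elim]] inv[OF elim] by blast
  qed
  ultimately show ?thesis unfolding converges_quadratically_def by blast
qed

text \<open>
  With \<open>N\<close> the first index from which \<open>y\<close> stays in the basin, no earlier iterate is stationary: \<open>y\<close> would be
  constant from there on and would already have stayed in the basin. So a positive threshold
  below \<open>norm (v (y i))\<close> for all \<open>i < N\<close> exists, and a run with that threshold cannot leave Phase 1 before \<open>N\<close>.
\<close>

lemma switching_threshold_exists:
  assumes run: "RPN_G_run \<M> R f \<mu> t B lam \<rho> x0 0 y" and x0: "x0 \<in> \<M>"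
    and lim: "y \<longlonglongrightarrow> xs"
    and absorbing: "\<And>i k. v (y i) = 0 \<Longrightarrow> k \<ge> i \<Longrightarrow> y k = y i"
  shows "\<exists>\<epsilon>>0. (\<exists>x. RPN_G_run \<M> R f \<mu> t B lam \<rho> x0 \<epsilon> x) \<and>
               (\<forall>x. RPN_G_run \<M> R f \<mu> t B lam \<rho> x0 \<epsilon> x \<longrightarrow> converges_quadratically x xs)"
proof -
  obtain d C where d: "d > 0"
    "\<And>x. x \<in> \<M> \<Longrightarrow> norm (x - xs) < d \<Longrightarrow> \<exists>x'. phase2_step \<M> R f \<mu> t B lam x x'"
    "\<And>x x'. x \<in> \<M> \<Longrightarrow> norm (x - xs) < d \<Longrightarrow> phase2_step \<M> R f \<mu> t B lam x x' \<Longrightarrow>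
       norm (x' - xs) \<le> C * (norm (x - xs))\<^sup>2 \<and> norm (x' - xs) \<le> norm (x - xs) / 2"
    using newton_basin by metis
  have yM: "y k \<in> \<M>" for k by (rule run_in_manifold[OF run x0])
  have "\<exists>N. \<forall>k\<ge>N. norm (y k - xs) < d" using LIMSEQ_D[OF lim d(1)] by blast
  define N where "N = (LEAST N. \<forall>k\<ge>N. norm (y k - xs) < d)"
  have N: "norm (y k - xs) < d" if "k \<ge> N" for k
    using LeastI_ex[OF \<open>\<exists>N. \<forall>k\<ge>N. norm (y k - xs) < d\<close>] that unfolding N_def by blast
  have vN: "v (y i) \<noteq> 0" if "i < N" for i
  proof
    assume "v (y i) = 0"
    then have absorbed: "y k = y i" if "k \<ge> i" for k using absorbing that by blast
    have "norm (y k - xs) < d" if "k \<ge> i" for k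
      using N[of "max i N"] absorbed[of "max i N"] absorbed[OF that] by simp
    then have "N \<le> i" unfolding N_def by (intro Least_le) blast
    then show False using that by simp
  qed
  \<comment> \<open>The element \<open>1\<close> only makes the set nonempty when \<open>N = 0\<close>.\<close>
  define V where "V = insert 1 ((\<lambda>i. norm (v (y i))) ` {..<N})"
  define \<epsilon> where "\<epsilon> = Min V / 2"
  have V: "finite V" "V \<noteq> {}" "\<And>a. a \<in> V \<Longrightarrow> a > 0" using vN by (auto simp: V_def)
  then have Min: "Min V > 0" by simp
  then have \<epsilon>: "\<epsilon> > 0" by (simp add: \<epsilon>_def)
  have large: "norm (v (y i)) > \<epsilon>" if "i < N" for i
  proof -
    have "Min V \<le> norm (v (y i))" using V(1) that by (intro Min_le) (auto simp: V_def)
    then show ?thesis using Min unfolding \<epsilon>_def by linarith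
  qed
  have "filterlim y F sequentially" by (rule filterlim_nhds_in[OF lim yM])
  then have "(\<lambda>k. v (y k)) \<longlonglongrightarrow> 0"
    using filterlim_compose[OF v_tendsto[OF xs]] v_xs by force
  then have "\<exists>k. norm (v (y k)) \<le> \<epsilon>"
    using LIMSEQ_D[OF _ \<epsilon>, of "\<lambda>k. v (y k)" 0] by (auto intro: less_imp_le)
  define k0 where "k0 = (LEAST k. norm (v (y k)) \<le> \<epsilon>)"
  have k0: "norm (v (y k0)) \<le> \<epsilon>" unfolding k0_def by (rule LeastI_ex) fact
  have before: "norm (v (y i)) > \<epsilon>" if "i < k0" for i
    using not_less_Least[OF that[unfolded k0_def]] by simp
  have "N \<le> k0" using large[of k0] k0 by (meson not_less)
  then have near: "norm (y k0 - xs) < d" by (rule N)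
  have phase1: "phase1_step \<M> R f \<mu> t \<rho> (y k) (y (Suc k))" if "k < k0" for k
  proof -
    have "\<forall>i\<le>k. norm (v (y i)) > 0" using before that \<epsilon> by (meson le_less_trans less_trans)
    then show ?thesis using run unfolding RPN_G_run_def by presburger
  qed
  have conv: "converges_quadratically x xs" if x: "RPN_G_run \<M> R f \<mu> t B lam \<rho> x0 \<epsilon> x" for x
  proof -
    have same: "\<forall>i\<le>k. x i = y i" if "k \<le> k0" for k
      using that
    proof (induction k)
      case 0
      then show ?case using x run unfolding RPN_G_run_def by simp
    next
      case (Suc k)
      then have IH: "\<forall>i\<le>k. x i = y i" by simp
      then have "\<forall>i\<le>k. norm (v (x i)) > \<epsilon>" using before Suc.prems by simp
      then have "phase1_step \<M> R f \<mu> t \<rho> (x k) (x (Suc k))"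
        using x unfolding RPN_G_run_def by presburger
      then have "x (Suc k) = y (Suc k)"
        using phase1_step_unique[OF _ phase1[of k]] IH Suc.prems by simp
      then show ?case using IH by (auto simp: le_Suc_eq)
    qed
    then have xk0: "x k0 = y k0" by blast
    have "phase2_step \<M> R f \<mu> t B lam (x k) (x (Suc k))" if "k \<ge> k0" for k
    proof -
      have "\<not> (\<forall>i\<le>k. norm (v (x i)) > \<epsilon>)" using that k0 xk0 by (metis not_less)
      then show ?thesis using x unfolding RPN_G_run_def by presburger
    qed
    then show ?thesis
      using yM[of k0] near unfolding xk0[symmetric] by (intro newton_iteration_converges[OF d(3)])
  qed
  define step where "step z = (SOME z'. phase2_step \<M> R f \<mu> t B lam z z')" for z
  have step: "phase2_step \<M> R f \<mu> t B lam z (step z)" if "z \<in> \<M>" "norm (z - xs) < d" for z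
    unfolding step_def by (rule someI_ex[OF d(2)[OF that]])
  define x where "x k = (if k \<le> k0 then y k else (step ^^ (k - k0)) (y k0))" for k
  have newton: "(step ^^ j) (y k0) \<in> \<M> \<and> norm ((step ^^ j) (y k0) - xs) < d" for j
  proof (induction j)
    case 0
    then show ?case using yM near by simp
  next
    case (Suc j)
    let ?z = "(step ^^ j) (y k0)"
    have st: "phase2_step \<M> R f \<mu> t B lam ?z (step ?z)"
      using step Suc by blast
    have "norm (step ?z - xs) \<le> norm (?z - xs) / 2"
      using d(3)[OF _ _ st] Suc by blast
    moreover have "norm (?z - xs) < d" using Suc by blast
    ultimately have "norm (step ?z - xs) < d" using norm_ge_zero[of "?z - xs"] by linarith
    then show ?case using phase2_step_in[OF st] Suc by simp
  qed
  have "RPN_G_run \<M> R f \<mu> t B lam \<rho> x0 \<epsilon> x"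
    unfolding RPN_G_run_def
  proof (intro conjI allI)
    show "x 0 = x0" using run unfolding RPN_G_run_def x_def by simp
    fix k
    show "if \<forall>i\<le>k. norm (v (x i)) > \<epsilon> then phase1_step \<M> R f \<mu> t \<rho> (x k) (x (Suc k))
        else phase2_step \<M> R f \<mu> t B lam (x k) (x (Suc k))"
    proof (cases "k < k0")
      case True
      then have "\<forall>i\<le>k. norm (v (x i)) > \<epsilon>" using before by (simp add: x_def)
      then show ?thesis using phase1[OF True] True by (simp add: x_def)
    next
      case False
      then have switched: "\<not> (\<forall>i\<le>k. norm (v (x i)) > \<epsilon>)"
        using k0 by (auto simp: x_def not_less intro!: exI[of _ k0])
      have "x k = (step ^^ (k - k0)) (y k0)" using False by (auto simp: x_def)
      moreover have "x (Suc k) = step ((step ^^ (k - k0)) (y k0))"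
        using False by (simp add: x_def Suc_diff_le)
      moreover have "phase2_step \<M> R f \<mu> t B lam ((step ^^ (k - k0)) (y k0)) (step ((step ^^ (k - k0)) (y k0)))"
        using step newton by blast
      ultimately have "phase2_step \<M> R f \<mu> t B lam (x k) (x (Suc k))" by (simp only:)
      then show ?thesis by (simp only: switched if_False)
    qed
  qed
  then show ?thesis using \<epsilon> conv by blast
qed

end

theorem theorem4p1:
  fixes \<M> :: "(real^'n) set"
    and f :: "real^'n \<Rightarrow> real"
    and R :: "real^'n \<Rightarrow> real^'n \<Rightarrow> real^'n"
    and B :: "real^'n \<Rightarrow> real^'d^'n"
    and lam :: "real^'n \<Rightarrow> real^'d"
    and \<mu> t \<rho> L :: real
    and x0 xs :: "real^'n"
    and xhat :: "nat \<Rightarrow> real^'n"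
  assumes submanifold: "embedded_submanifold TYPE('d) \<M>"
    and f_smooth: "C_diff_on 3 UNIV f"
    and mu_pos: "\<mu> > 0"
    and t_pos: "t > 0"
    and rho: "0 < \<rho>" "\<rho> \<le> 1 / 2"
    and x0: "x0 \<in> \<M>"
    and frame: "\<And>x. x \<in> \<M> \<Longrightarrow> orthonormal_normal_frame \<M> x (B x)"
    and frame_smooth: "\<exists>U. open U \<and> xs \<in> U \<and> smooth_map_on (\<M> \<inter> U) B"
    and multiplier: "\<And>x. x \<in> \<M> \<Longrightarrow> is_multiplier \<M> f \<mu> t (B x) x (lam x)"
    and compact: "compact \<M>"
    and retraction: "global_retraction \<M> R"
    and lipschitz: "L-lipschitz_on (convex hull \<M>) (grad f)"
    and run: "RPN_G_run \<M> R f \<mu> t B lam \<rho> x0 0 xhat"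
    and accumulation: "\<exists>r. strict_mono r \<and> (xhat \<circ> r) \<longlonglongrightarrow> xs"
  shows "(t < 2 \<longrightarrow> stationary \<M> f \<mu> t xs) \<and>
    (strict_isolated_minimum \<M> f \<mu> t xs \<and>
     assumption_A (B xs) xs \<and> assumption_B \<M> f \<mu> t xs \<and>
     J_nonsingular \<M> f \<mu> t (B xs) (lam xs) xs \<longrightarrow>
       (\<exists>\<epsilon>>0. (\<exists>x. RPN_G_run \<M> R f \<mu> t B lam \<rho> x0 \<epsilon> x) \<and>
               (\<forall>x. RPN_G_run \<M> R f \<mu> t B lam \<rho> x0 \<epsilon> x \<longrightarrow> converges_quadratically x xs)))"
proof -
  interpret rpn_setting \<M> f R B lam \<mu> t \<rho>
    by unfold_locales (fact submanifold f_smooth mu_pos t_pos rho frame multiplier compact retraction)+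
  obtain r where r: "strict_mono r" "(xhat \<circ> r) \<longlonglongrightarrow> xs" using accumulation by blast
  have xM: "xhat k \<in> \<M>" for k by (rule run_in_manifold[OF run x0])
  have xsM: "xs \<in> \<M>"
    using closed_sequentially[OF compact_imp_closed[OF compact], of "xhat \<circ> r" xs] xM r(2) by simp
  have term_limit: "xs = xhat k0" "xhat \<longlonglongrightarrow> xs" if "\<And>k. k \<ge> k0 \<Longrightarrow> xhat k = xhat k0" for k0
  proof -
    have "\<forall>\<^sub>F k in sequentially. xhat k0 = xhat k"
      using eventually_ge_at_top[of k0] by (rule eventually_mono) (rule that[symmetric])
    then have l: "xhat \<longlonglongrightarrow> xhat k0" by (rule Lim_transform_eventually[OF tendsto_const])
    show "xs = xhat k0" by (rule LIMSEQ_unique[OF r(2) LIMSEQ_subseq_LIMSEQ[OF l r(1)]])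
    then show "xhat \<longlonglongrightarrow> xs" using l by simp
  qed
  have first: "stationary \<M> f \<mu> t xs" if "t < 2"
    using run x0
  proof (cases rule: run_zero_cases)
    case infinite
    then have "v xs = 0" by (intro phase1_accumulation_stationary[OF that xM _ r xsM])
    then show ?thesis using xsM by (simp add: stationary_def)
  next
    case (terminates k0)
    have "xs = xhat k0" by (rule term_limit(1)[OF terminates(3)])
    then show ?thesis using xsM terminates(1) by (simp add: stationary_def)
  qed
  have second: "\<exists>\<epsilon>>0. (\<exists>x. RPN_G_run \<M> R f \<mu> t B lam \<rho> x0 \<epsilon> x) \<and>
               (\<forall>x. RPN_G_run \<M> R f \<mu> t B lam \<rho> x0 \<epsilon> x \<longrightarrow> converges_quadratically x xs)"
    if min: "strict_isolated_minimum \<M> f \<mu> t xs" and asmB: "assumption_B \<M> f \<mu> t xs"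
      and J: "J_nonsingular \<M> f \<mu> t (B xs) (lam xs) xs"
  proof -
    obtain U where U: "open U" "xs \<in> U" "smooth_map_on (\<M> \<inter> U) B" using frame_smooth by blast
    have "\<exists>W g. xs \<in> W \<and> smooth_on_open W g \<and> (\<forall>q\<in>W \<inter> (\<M> \<inter> U). g q = B q)"
      using U(3)[unfolded smooth_map_on_def] by (rule bspec) (use xsM U(2) in blast)
    then obtain W0 g where W0: "xs \<in> W0" "smooth_on_open W0 g" "\<forall>q\<in>W0 \<inter> (\<M> \<inter> U). g q = B q"
      by (elim exE conjE)
    interpret newton_setting \<M> f R B lam \<mu> t \<rho> xs "W0 \<inter> U" g
    proof unfold_locales
      show "xs \<in> \<M>" by (rule xsM)
      show "v xs = 0" using min unfolding strict_isolated_minimum_def stationary_def by blast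
      show "open (W0 \<inter> U)" using W0(2) U(1) unfolding smooth_on_open_def by blast
      show "xs \<in> W0 \<inter> U" using W0(1) U(2) by blast
      show "C_diff_on 2 (W0 \<inter> U) g"
        using W0(2) unfolding smooth_on_open_def by (blast intro: C_diff_on_subset)
      show "B x = g x" if "x \<in> W0 \<inter> U \<inter> \<M>" for x using W0(3) that by auto
    qed (rule asmB, rule J)
    obtain U' where U': "open U'" "xs \<in> U'" "\<And>y. y \<in> \<M> \<inter> U' \<Longrightarrow> y \<noteq> xs \<Longrightarrow> Obj y > Obj xs"
      using min unfolding strict_isolated_minimum_def by blast
    show ?thesis
      using run x0
    proof (cases rule: run_zero_cases)
      case infinite
      have "xhat \<longlonglongrightarrow> xs"
        by (rule phase1_converges_to_strict_minimum[OF xM infinite(2) r xsM U'])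
      then show ?thesis
        by (intro switching_threshold_exists[OF run x0]) (use infinite(1) in auto)
    next
      case (terminates k0)
      have "xhat k = xhat i" if "v (xhat i) = 0" "k \<ge> i" for i k
      proof -
        have "i \<ge> k0" using terminates(2) that(1) by (meson not_less)
        then have "xhat i = xhat k0" "xhat k = xhat k0"
          using that(2) by (auto intro: terminates(3))
        then show ?thesis by simp
      qed
      then show ?thesis
        by (intro switching_threshold_exists[OF run x0 term_limit(2)[OF terminates(3)]])
    qed
  qed
  show ?thesis using first second by blast
qed

end
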